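(* Let $c,a:\mathbb{R}\to\mathbb{R}$ be smooth functions such that $c^{(l)}$ and $a^{(l)}$ are bounded on $\mathbb{R}$ for $l=1,2,3$, and $|c'(z)|\ge m_0$, $|a(z)|\ge m_0$ for all $z\in\mathbb{R}$, for some constant $m_0>0$. Let $\varphi_1\in\mathbb{R}$ be a constant with $c(\varphi_1)=0$, and let $\varphi_2,\psi_1,\psi_2:\mathbb{R}\to\mathbb{R}$ be smooth functions such that $\varphi_2^{(j)}$ ($j=1,\dots,4$) and $\psi_1^{(k)},\psi_2^{(k)}$ ($k=0,1,2,3$) are bounded on $\mathbb{R}$, and $|\psi_1(x)|\ge \psi_0$ for all $x\in\mathbb{R}$, for some constant $\psi_0>0$. Then there exist constants $\lambda_0>0$ and $\delta>0$ such that for every $\lambda\in\mathbb{R}$ with $|\lambda|\le\lambda_0$, the degenerate Cauchy problem consisting of the system \[ \begin{aligned} R_{1t}-cR_{1x}&=\tfrac{c'(R_1+S_1)}{4}\tfrac{R_1-S_1}{c}+\lambda aa'\tfrac{R_2-S_2}{c}-\tfrac{a^2c'}{4}\tfrac{(R_2-S_2)^2}{c}+aa'R_2S_2,\\ S_{1t}+cS_{1x}&=\tfrac{c'(R_1+S_1)}{4}\tfrac{S_1-R_1}{c}+\lambda aa'\tfrac{R_2-S_2}{c}-\tfrac{a^2c'}{4}\tfrac{(R_2-S_2)^2}{c}+aa'R_2S_2,\\ R_{2t}-cR_{2x}&=\tfrac{c'R_1}{2}\tfrac{R_2-S_2}{c}-\tfrac{\lambda a'}{a}\tfrac{R_1-S_1}{c}-\tfrac{a'}{a}(R_1S_2+S_1R_2),\\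 S_{2t}+cS_{2x}&=\tfrac{c'S_1}{2}\tfrac{S_2-R_2}{c}-\tfrac{\lambda a'}{a}\tfrac{R_1-S_1}{c}-\tfrac{a'}{a}(R_1S_2+S_1R_2),\\ u_t&=\tfrac{R_1+S_1}{2},\qquad v_t=\tfrac{R_2+S_2}{2}, \end{aligned} \] (where $c,c',a,a'$ are evaluated at $u$) together with the initial conditions, for all $x\in\mathbb{R}$, \[ R_1(0,x)=S_1(0,x)=\psi_1(x),\quad R_2(0,x)=S_2(0,x)=\psi_2(x), \] \[ R_{1t}(0,x)=S_{1t}(0,x)=f_{11}(x),\quad R_{2t}(0,x)=f_{21}(x),\quad S_{2t}(0,x)=f_{22}(x), \] \[ u(0,x)=\varphi_1,\ u_t(0,x)=\psi_1(x),\ v(0,x)=\varphi_2(x),\ v_t(0,x)=\psi_2(x), \] has a classical solution $(R_1,S_1,R_2,S_2,u,v)$ on $[0,\delta]\times\mathbb{R}$.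
   Context: Here $f_{11}(x)=a(\varphi_1)a'(\varphi_1)\psi_2^2(x)+2\lambda a(\varphi_1)a'(\varphi_1)\varphi_2'(x)$, $f_{21}(x)=c'(\varphi_1)\psi_1(x)\varphi_2'(x)-\frac{2a'(\varphi_1)}{a(\varphi_1)}\psi_1(x)\psi_2(x)$, $f_{22}(x)=-c'(\varphi_1)\psi_1(x)\varphi_2'(x)-\frac{2a'(\varphi_1)}{a(\varphi_1)}\psi_1(x)\psi_2(x)$. The system is obtained from the variational wave system below by setting $R_1=u_t+c(u)u_x$, $S_1=u_t-c(u)u_x$, $R_2=v_t+c(u)v_x$, $S_2=v_t-c(u)v_x$. Since $c(u(0,x))=c(\varphi_1)=0$, the system is parabolically degenerate on the initial line $t=0$ (its coefficients contain $1/c$). A classical solution means continuously differentiable functions on $[0,\delta]\times\mathbb{R}$ satisfying the equations (where $c(u)\ne0$, i.e. for $t>0$) and the initial conditions. *)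

theory Defs
  imports "HOL-Analysis.Analysis"
begin

definition smooth_fun :: "(real \<Rightarrow> real) \<Rightarrow> bool" where
  "smooth_fun f \<longleftrightarrow> (\<forall>n x. ((deriv ^^ n) f) differentiable (at x))"

definition strip :: "real \<Rightarrow> (real \<times> real) set" where
  "strip d = {0..d} \<times> UNIV"

text \<open>f(t,x) is continuously differentiable on the closed strip [0,d] x R, with partial
  derivatives ft (in t) and fx (in x); at t = 0 and t = d the t-derivative is one-sided.\<close>
definition C1_strip ::
  "real \<Rightarrow> (real \<Rightarrow> real \<Rightarrow> real) \<Rightarrow> (real \<Rightarrow> real \<Rightarrow> real) \<Rightarrow> (real \<Rightarrow> real \<Rightarrow> real) \<Rightarrow> bool" where
  "C1_strip d f ft fx \<longleftrightarrow>
     continuous_on (strip d) (\<lambda>p. ft (fst p) (snd p)) \<and>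
     continuous_on (strip d) (\<lambda>p. fx (fst p) (snd p)) \<and>
     (\<forall>p\<in>strip d. ((\<lambda>q. f (fst q) (snd q)) has_derivative
         (\<lambda>h. ft (fst p) (snd p) * fst h + fx (fst p) (snd p) * snd h)) (at p within strip d))"

definition f11 :: "(real \<Rightarrow> real) \<Rightarrow> real \<Rightarrow> real \<Rightarrow> (real \<Rightarrow> real) \<Rightarrow> (real \<Rightarrow> real) \<Rightarrow> real \<Rightarrow> real" where
  "f11 a \<phi>1 lam \<phi>2 \<psi>2 x =
     a \<phi>1 * deriv a \<phi>1 * (\<psi>2 x)\<^sup>2 + 2 * lam * a \<phi>1 * deriv a \<phi>1 * deriv \<phi>2 x"

definition f21 :: "(real \<Rightarrow> real) \<Rightarrow> (real \<Rightarrow> real) \<Rightarrow> real \<Rightarrow> (real \<Rightarrow> real) \<Rightarrow> (real \<Rightarrow> real) \<Rightarrow> (real \<Rightarrow> real) \<Rightarrow> real \<Rightarrow> real" where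
  "f21 c a \<phi>1 \<phi>2 \<psi>1 \<psi>2 x =
     deriv c \<phi>1 * \<psi>1 x * deriv \<phi>2 x - 2 * deriv a \<phi>1 / a \<phi>1 * \<psi>1 x * \<psi>2 x"

definition f22 :: "(real \<Rightarrow> real) \<Rightarrow> (real \<Rightarrow> real) \<Rightarrow> real \<Rightarrow> (real \<Rightarrow> real) \<Rightarrow> (real \<Rightarrow> real) \<Rightarrow> (real \<Rightarrow> real) \<Rightarrow> real \<Rightarrow> real" where
  "f22 c a \<phi>1 \<phi>2 \<psi>1 \<psi>2 x =
     - deriv c \<phi>1 * \<psi>1 x * deriv \<phi>2 x - 2 * deriv a \<phi>1 / a \<phi>1 * \<psi>1 x * \<psi>2 x"

end

theory Submission
  imports Defs
begin

text \<open>
  Subtracting from \<open>R1, S1, R2, S2, u, v\<close> their Taylor polynomials in \<open>t\<close> leaves remainders \<open>W\<^sub>i\<close> that solve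
  \<open>\<partial>\<^sub>t W\<^sub>i + t l\<^sub>i \<partial>\<^sub>x W\<^sub>i = t h\<^sub>i\<close>, where \<open>l\<^sub>i\<close> and \<open>h\<^sub>i\<close> are regular functions of \<open>t\<close>, \<open>x\<close> and \<open>y = W / t\<^sup>2\<close>, and where
  at \<open>t = 0\<close> the matrix of the \<open>y\<close>-linear part of \<open>h\<close> has absolute row sums close to 1 if \<open>\<lambda>\<close> is small.
  Because these row sums stay below 2, the bounds \<open>W = O(t\<^sup>2)\<close> are stable under the evolution.
  The solution is the limit of the explicit scheme \<open>V(x) \<mapsto> V(x - s t l) + s t h\<close>, which preserves, relative to \<open>t\<^sup>2\<close>, a sup bound,
  a Lipschitz bound and a bound on second differences in \<open>x\<close>. Halving the step \<open>s\<close> changes the \<open>n\<close>-th iterate by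
  \<open>O(s\<^sup>2 n\<^sup>3\<^sup>/\<^sup>2)\<close>, which is \<open>O(\<surd>s)\<close> for \<open>n s\<close> bounded, so the iterates converge; no characteristic curves and no derivatives
  of the iterates are needed, and the second difference bound makes the limit continuously differentiable.
\<close>

section \<open>Second differences and differentiability\<close>

text \<open>The differences \<open>R1 - S1\<close> and \<open>R2 - S2\<close> are divided by
  \<open>c(u)\<close>, which is of order t, so an error present at time r is amplified like (t /
  r)^\<theta>, where \<theta> bounds the row sums. For the a priori bounds any \<theta> < 2
  suffices, because a step from t to t + s increases \<open>t\<^sup>2\<close> by at least
  \<open>2 * s * t\<close>. Convergence depends on the local errors: they are of size s^2 each,
  without a factor t^2, and for \<theta> > 1 they add up after amplification to about s^2 n^\<theta>
  at step n, which tends to 0 for bounded n s if \<theta> < 2. The exponent 3/2 is a convenient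
  value between 1 and 2. It leads to a ladder of constants: 9/8 for the row sums at t = 0, 5/4 for
  those at short times, 21/16 for the Lipschitz constant of the whole source in y, 11/8 when the
  shift of the foot points is added; the gap from 11/8 to 3/2 absorbs the local errors.\<close>

lemma chord_bound_upper:
  fixes f :: "real \<Rightarrow> real"
  assumes cont: "continuous_on UNIV f" and L: "L > 0"
    and sd: "\<And>x k. f (x + k) + f (x - k) - 2 * f x \<ge> - L * k\<^sup>2"
    and ab: "a < b" and y: "a \<le> y" "y \<le> b"
  shows "f y - f a - (y - a) * ((f b - f a) / (b - a)) \<le> L * (y - a) * (b - y)"
proof (rule ccontr)
  define m where "m = (f b - f a) / (b - a)"
  \<comment> \<open>The subtracted parabola has second difference
    \<open>- 2 * L * s\<^sup>2\<close>, twice the slack in \<open>sd\<close>. Hence q has strictly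
    positive second differences and cannot have an interior maximum, while it vanishes at both
    ends.\<close>
  define q where "q z = f z - f a - (z - a) * m - L * (z - a) * (b - z)" for z
  assume "\<not> ?thesis"
  then have qy: "q y > 0" by (simp add: q_def m_def)
  have "continuous_on {a..b} q" unfolding q_def
    by (intro continuous_intros continuous_on_subset[OF cont]) auto
  then obtain z where z: "z \<in> {a..b}" and zmax: "\<And>w. w \<in> {a..b} \<Longrightarrow> q w \<le> q z"
    using continuous_attains_sup[of "{a..b}" q] ab by auto
  have "q z > 0" using zmax[of y] y qy by auto
  moreover have "q a = 0" by (simp add: q_def)
  moreover have "q b = 0" using ab by (simp add: q_def m_def)
  ultimately have zin: "a < z" "z < b" using z by (auto simp: less_le)
  define s where "s = min (z - a) (b - z)"
  have s: "s > 0" "z + s \<in> {a..b}" "z - s \<in> {a..b}" using zin by (auto simp: s_def)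
  have "q (z + s) + q (z - s) - 2 * q z = f (z + s) + f (z - s) - 2 * f z + 2 * L * s\<^sup>2"
    by (simp add: q_def power2_eq_square algebra_simps)
  also have "\<dots> \<ge> L * s\<^sup>2" using sd[of s z] by simp
  finally have "q (z + s) + q (z - s) - 2 * q z \<ge> L * s\<^sup>2" .
  moreover have "L * s\<^sup>2 > 0" using L s by simp
  ultimately have "q (z + s) + q (z - s) - 2 * q z > 0" by linarith
  with zmax[OF s(2)] zmax[OF s(3)] show False by simp
qed

lemma chord_bound:
  fixes f :: "real \<Rightarrow> real"
  assumes cont: "continuous_on UNIV f" and L: "L > 0"
    and sd: "\<And>x k. \<bar>f (x + k) + f (x - k) - 2 * f x\<bar> \<le> L * k\<^sup>2"
    and ab: "a < b" and y: "a \<le> y" "y \<le> b"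
  shows "\<bar>f y - f a - (y - a) * ((f b - f a) / (b - a))\<bar> \<le> L * (y - a) * (b - y)"
proof -
  have 1: "f (x + k) + f (x - k) - 2 * f x \<ge> - L * k\<^sup>2" for x k using sd[of x k] by linarith
  have 2: "(- f (x + k)) + (- f (x - k)) - 2 * (- f x) \<ge> - L * k\<^sup>2" for x k using sd[of x k] by linarith
  have "continuous_on UNIV (\<lambda>x. - f x)" by (intro continuous_intros cont)
  from chord_bound_upper[OF this L 2 ab y]
  have "- (f y - f a - (y - a) * ((f b - f a) / (b - a))) \<le> L * (y - a) * (b - y)"
    using ab by (simp add: field_simps)
  with chord_bound_upper[OF cont L 1 ab y] show ?thesis by (simp add: abs_le_iff)
qed

text \<open>By the chord bound, the difference quotients at x with steps k < h differ by at most
  \<open>L * h\<close>, so they converge as the step shrinks. The remainder is quadratic with a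
  constant independent of x, which later yields continuity of the derivative as well.\<close>

lemma second_difference_imp_differentiable:
  fixes f :: "real \<Rightarrow> real"
  assumes cont: "continuous_on UNIV f" and L: "L > 0"
    and sd: "\<And>x k. \<bar>f (x + k) + f (x - k) - 2 * f x\<bar> \<le> L * k\<^sup>2"
  shows "\<exists>f'. \<forall>x k. \<bar>f (x + k) - f x - k * f' x\<bar> \<le> 2 * L * k\<^sup>2"
proof -
  have "\<exists>d. \<forall>k. \<bar>f (x + k) - f x - k * d\<bar> \<le> 2 * L * k\<^sup>2" for x
  proof -
    define D where "D k = (f (x + k) - f x) / k" for k
    have D: "\<bar>D k - D h\<bar> \<le> L * h" if "0 < k" "k < h" for k h
    proof -
      have "\<bar>f (x + k) - f x - k * D h\<bar> \<le> L * k * (h - k)"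
        using chord_bound[OF cont L sd, of x "x + h" "x + k"] that by (simp add: D_def)
      moreover have "f (x + k) - f x - k * D h = k * (D k - D h)"
        using that by (simp add: D_def field_simps)
      moreover have "L * k * (h - k) \<le> k * (L * h)"
        using that L by (simp add: algebra_simps)
      ultimately have "\<bar>k * (D k - D h)\<bar> \<le> k * (L * h)" by simp
      then show ?thesis using that by (simp add: abs_mult)
    qed
    define e where "e n = inverse (real (Suc n))" for n
    have e0: "e \<longlonglongrightarrow> 0" unfolding e_def by (rule LIMSEQ_inverse_real_of_nat)
    have epos: "e n > 0" for n by (simp add: e_def)
    have "Cauchy (\<lambda>n. D (e n))"
    proof (rule metric_CauchyI)
      fix r :: real assume r: "r > 0"
      define h where "h = r / (3 * L)"
      have "h > 0" using r L by (simp add: h_def)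
      then obtain N where N: "\<And>n. n \<ge> N \<Longrightarrow> e n < h"
        using e0 order_tendstoD(2)[OF e0, of h] by (auto simp: eventually_sequentially)
      have "dist (D (e m)) (D (e n)) < r" if "m \<ge> N" "n \<ge> N" for m n
      proof -
        have "\<bar>D (e m) - D (e n)\<bar> \<le> 2 * (L * h)"
          using D[OF epos N[OF that(1)]] D[OF epos N[OF that(2)]] by linarith
        also have "\<dots> < r" using r L by (simp add: h_def)
        finally show ?thesis by (simp add: dist_real_def)
      qed
      then show "\<exists>M. \<forall>m\<ge>M. \<forall>n\<ge>M. dist (D (e m)) (D (e n)) < r" by blast
    qed
    then obtain d where d: "(\<lambda>n. D (e n)) \<longlonglongrightarrow> d"
      using Cauchy_convergent convergent_def by blast
    have pos: "\<bar>D h - d\<bar> \<le> L * h" if "h > 0" for h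
    proof (rule tendsto_upperbound)
      show "(\<lambda>n. \<bar>D h - D (e n)\<bar>) \<longlonglongrightarrow> \<bar>D h - d\<bar>" by (intro tendsto_intros d)
      show "\<forall>\<^sub>F n in sequentially. \<bar>D h - D (e n)\<bar> \<le> L * h"
        using order_tendstoD(2)[OF e0 that]
        by eventually_elim (use D[OF epos] in \<open>simp add: abs_minus_commute\<close>)
    qed simp
    have pos': "\<bar>f (x + h) - f x - h * d\<bar> \<le> L * h\<^sup>2" if "h > 0" for h
    proof -
      have "f (x + h) - f x - h * d = h * (D h - d)" using that by (simp add: D_def field_simps)
      then have "\<bar>f (x + h) - f x - h * d\<bar> = h * \<bar>D h - d\<bar>" using that by (simp add: abs_mult)
      also have "\<dots> \<le> h * (L * h)" using pos[OF that] that by simp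
      finally show ?thesis by (simp add: power2_eq_square algebra_simps)
    qed
    have "\<bar>f (x + k) - f x - k * d\<bar> \<le> 2 * L * k\<^sup>2" for k
    proof (cases k "0 :: real" rule: linorder_cases)
      case less
      \<comment> \<open>For a negative increment, \<open>f (x + k)\<close> is reflected through x by
        means of the second difference; this costs a further \<open>L * k\<^sup>2\<close> and
        explains the factor 2.\<close>
      then show ?thesis using pos'[of "- k"] sd[of x "- k"] by simp
    next
      case greater
      then have "L * k\<^sup>2 \<ge> 0" using L by simp
      then show ?thesis using pos'[OF greater] by linarith
    qed simp
    then show ?thesis by blast
  qed
  then show ?thesis by metis
qed

section \<open>The explicit scheme\<close>

lemma abs_mult_left_nonneg: "0 \<le> a \<Longrightarrow> \<bar>a * b\<bar> = a * \<bar>b\<bar>" for a b :: real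
  by (simp add: abs_mult)

lemma abs_midpoint_le: "\<bar>a\<bar> \<le> B \<Longrightarrow> \<bar>b\<bar> \<le> B \<Longrightarrow> \<bar>(a + b) / 2\<bar> \<le> B" for a b B :: real
  by (auto simp: abs_le_iff)

lemma second_difference_triangle:
  "\<bar>a + b - 2 * c\<bar> \<le> X \<Longrightarrow> 2 * \<bar>c - d\<bar> \<le> Y \<Longrightarrow> \<bar>a + b - 2 * d\<bar> \<le> X + Y" for a b c d X Y :: real
  by (auto simp: abs_if split: if_splits)

text \<open>The point r need not be the midpoint of p and q: the second difference is taken at the
  true midpoint, and the Lipschitz bound pays for the displacement. In the scheme, p, q and r are
  the foot points belonging to x + k, x - k and x.\<close>

lemma second_difference_compose:
  fixes f :: "real \<Rightarrow> real"
  assumes lip: "\<And>x z. \<bar>f x - f z\<bar> \<le> A * \<bar>x - z\<bar>"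
    and sd: "\<And>x k. \<bar>f (x + k) + f (x - k) - 2 * f x\<bar> \<le> B * k\<^sup>2"
  shows "\<bar>f p + f q - 2 * f r\<bar> \<le> B * ((p - q) / 2)\<^sup>2 + A * \<bar>p + q - 2 * r\<bar>"
proof -
  have "\<bar>f p + f q - 2 * f ((p + q) / 2)\<bar> \<le> B * ((p - q) / 2)\<^sup>2"
    using sd[of "(p + q) / 2" "(p - q) / 2"] by (simp add: field_simps)
  moreover have "2 * \<bar>f ((p + q) / 2) - f r\<bar> \<le> A * \<bar>p + q - 2 * r\<bar>"
  proof -
    have "2 * \<bar>f ((p + q) / 2) - f r\<bar> \<le> A * (2 * \<bar>(p + q) / 2 - r\<bar>)"
      using lip[of "(p + q) / 2" r] by (simp add: algebra_simps)
    also have "2 * \<bar>(p + q) / 2 - r\<bar> = \<bar>p + q - 2 * r\<bar>" by (simp add: abs_if field_simps)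
    finally show ?thesis .
  qed
  ultimately show ?thesis by (rule second_difference_triangle)
qed

text \<open>\<open>K\<close>, \<open>K1\<close>, \<open>K2\<close> are the sup, Lipschitz and second
  difference bounds relative to \<open>t\<^sup>2\<close>. The factor 2 in \<open>h_bound\<close> and
  on the right of \<open>small1\<close> and \<open>small2\<close> is that of the derivative of
  \<open>t\<^sup>2\<close>. \<open>h_lip_y\<close> separates the Lipschitz constant
  \<open>\<theta>\<close> in y alone, which has to stay well below 2, from the possibly large
  \<open>L\<close>. The variable e is a common bound for all increments.\<close>

locale transport_scheme =
  fixes l h :: "nat \<Rightarrow> real \<Rightarrow> real \<Rightarrow> (nat \<Rightarrow> real) \<Rightarrow> real"
    and \<delta> K K1 K2 L \<theta> :: real
  assumes delta: "0 < \<delta>" "\<delta> \<le> 1"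
    and nonneg: "0 \<le> K" "0 \<le> K1" "0 \<le> K2" "0 \<le> L" "0 \<le> \<theta>"
    and l_bound: "\<And>i t x y. \<lbrakk>0 \<le> t; t \<le> \<delta>; \<And>j. \<bar>y j\<bar> \<le> K\<rbrakk> \<Longrightarrow> \<bar>l i t x y\<bar> \<le> L"
    and l_lip: "\<And>i t t' x x' y y' e. \<lbrakk>0 \<le> t; t \<le> \<delta>; 0 \<le> t'; t' \<le> \<delta>; \<And>j. \<bar>y j\<bar> \<le> K; \<And>j. \<bar>y' j\<bar> \<le> K;
        \<bar>t - t'\<bar> \<le> e; \<bar>x - x'\<bar> \<le> e; \<And>j. \<bar>y j - y' j\<bar> \<le> e\<rbrakk> \<Longrightarrow> \<bar>l i t x y - l i t' x' y'\<bar> \<le> L * e"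
    and l_sd: "\<And>i t x k y y' e. \<lbrakk>0 \<le> t; t \<le> \<delta>; \<And>j. \<bar>y j\<bar> \<le> K; \<And>j. \<bar>y' j\<bar> \<le> K;
        \<bar>k\<bar> \<le> e; \<And>j. \<bar>y j - y' j\<bar> \<le> 2 * e\<rbrakk> \<Longrightarrow>
        \<bar>l i t (x + k) y + l i t (x - k) y' - 2 * l i t x (\<lambda>j. (y j + y' j) / 2)\<bar> \<le> L * e\<^sup>2"
    and h_bound: "\<And>i t x y. \<lbrakk>0 \<le> t; t \<le> \<delta>; \<And>j. \<bar>y j\<bar> \<le> K\<rbrakk> \<Longrightarrow> \<bar>h i t x y\<bar> \<le> 2 * K"
    and h_lip: "\<And>i t t' x x' y y' e. \<lbrakk>0 \<le> t; t \<le> \<delta>; 0 \<le> t'; t' \<le> \<delta>; \<And>j. \<bar>y j\<bar> \<le> K; \<And>j. \<bar>y' j\<bar> \<le> K;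
        \<bar>t - t'\<bar> \<le> e; \<bar>x - x'\<bar> \<le> e; \<And>j. \<bar>y j - y' j\<bar> \<le> e\<rbrakk> \<Longrightarrow> \<bar>h i t x y - h i t' x' y'\<bar> \<le> L * e"
    and h_lip_y: "\<And>i t x x' y y' e. \<lbrakk>0 \<le> t; t \<le> \<delta>; \<And>j. \<bar>y j\<bar> \<le> K; \<And>j. \<bar>y' j\<bar> \<le> K;
        \<And>j. \<bar>y j - y' j\<bar> \<le> e\<rbrakk> \<Longrightarrow> \<bar>h i t x y - h i t x' y'\<bar> \<le> L * \<bar>x - x'\<bar> + \<theta> * e"
    and h_sd: "\<And>i t x k y y' e. \<lbrakk>0 \<le> t; t \<le> \<delta>; \<And>j. \<bar>y j\<bar> \<le> K; \<And>j. \<bar>y' j\<bar> \<le> K;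
        \<bar>k\<bar> \<le> e; \<And>j. \<bar>y j - y' j\<bar> \<le> 2 * e\<rbrakk> \<Longrightarrow>
        \<bar>h i t (x + k) y + h i t (x - k) y' - 2 * h i t x (\<lambda>j. (y j + y' j) / 2)\<bar> \<le> L * e\<^sup>2"
    and small1: "K1 * \<delta>\<^sup>2 * (L * (1 + K1)) + L + \<theta> * K1 \<le> 2 * K1"
    and small2: "K2 * \<delta>\<^sup>2 * (2 * (L * (1 + K1)) + (L * (1 + K1))\<^sup>2)
        + K1 * \<delta>\<^sup>2 * (L * (1 + K1)\<^sup>2 + L * K2) + L * (1 + K1)\<^sup>2 + \<theta> * K2 \<le> 2 * K2"
    and small3: "\<theta> + K1 * L * \<delta>\<^sup>2 \<le> 11 / 8"
begin

text \<open>At \<open>t = 0\<close> the argument \<open>V j x / t\<^sup>2\<close> is the junk value 0, which is harmless: the iteration starts from \<open>V = 0\<close>.\<close>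

definition Step :: "real \<Rightarrow> real \<Rightarrow> (nat \<Rightarrow> real \<Rightarrow> real) \<Rightarrow> nat \<Rightarrow> real \<Rightarrow> real" where
  "Step t s V i x = V i (x - s * t * l i t x (\<lambda>j. V j x / t\<^sup>2)) + s * t * h i t x (\<lambda>j. V j x / t\<^sup>2)"

definition admissible :: "real \<Rightarrow> (nat \<Rightarrow> real \<Rightarrow> real) \<Rightarrow> bool" where
  "admissible t V \<longleftrightarrow> (\<forall>i x. \<bar>V i x\<bar> \<le> K * t\<^sup>2) \<and> (\<forall>i x z. \<bar>V i x - V i z\<bar> \<le> K1 * t\<^sup>2 * \<bar>x - z\<bar>) \<and>
     (\<forall>i x k. \<bar>V i (x + k) + V i (x - k) - 2 * V i x\<bar> \<le> K2 * t\<^sup>2 * k\<^sup>2)"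

lemma admissibleD:
  assumes "admissible t V"
  shows "\<bar>V i x\<bar> \<le> K * t\<^sup>2" "\<bar>V i x - V i z\<bar> \<le> K1 * t\<^sup>2 * \<bar>x - z\<bar>"
    "\<bar>V i (x + k) + V i (x - k) - 2 * V i x\<bar> \<le> K2 * t\<^sup>2 * k\<^sup>2"
  using assms by (auto simp: admissible_def)

lemma admissible_zero: "admissible t (\<lambda>i x. 0)"
  using nonneg by (simp add: admissible_def)

lemma admissible_at_0: "admissible 0 V \<Longrightarrow> V i x = 0"
  using admissibleD(1)[of 0 V i x] by simp

lemma admissible_scaled:
  assumes "admissible t V"
  shows "\<bar>V i x / t\<^sup>2\<bar> \<le> K" "\<bar>V i x / t\<^sup>2 - V i z / t\<^sup>2\<bar> \<le> K1 * \<bar>x - z\<bar>"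
    "\<bar>V i (x + k) / t\<^sup>2 + V i (x - k) / t\<^sup>2 - 2 * (V i x / t\<^sup>2)\<bar> \<le> K2 * k\<^sup>2"
proof -
  \<comment> \<open>The case t = 0 is included: the quotient is then 0 and the bound holds because b
    is nonnegative.\<close>
  have *: "\<bar>a / t\<^sup>2\<bar> \<le> b" if "\<bar>a\<bar> \<le> b * t\<^sup>2" "b \<ge> 0" for a b :: real
    using that by (cases "t = 0") (auto simp: abs_divide pos_divide_le_eq)
  show "\<bar>V i x / t\<^sup>2\<bar> \<le> K" using admissibleD(1)[OF assms] nonneg by (intro *) auto
  have "\<bar>(V i x - V i z) / t\<^sup>2\<bar> \<le> K1 * \<bar>x - z\<bar>"
    using admissibleD(2)[OF assms, of i x z] nonneg by (intro *) (auto simp: mult_ac)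
  then show "\<bar>V i x / t\<^sup>2 - V i z / t\<^sup>2\<bar> \<le> K1 * \<bar>x - z\<bar>" by (simp add: diff_divide_distrib)
  have "\<bar>(V i (x + k) + V i (x - k) - 2 * V i x) / t\<^sup>2\<bar> \<le> K2 * k\<^sup>2"
    using admissibleD(3)[OF assms, of i x k] nonneg by (intro *) (auto simp: mult_ac)
  then show "\<bar>V i (x + k) / t\<^sup>2 + V i (x - k) / t\<^sup>2 - 2 * (V i x / t\<^sup>2)\<bar> \<le> K2 * k\<^sup>2"
    by (simp add: diff_divide_distrib add_divide_distrib)
qed

text \<open>The third estimate counts the direct dependence on x and the dependence through y
  separately, so that \<open>K1\<close> is multiplied by \<open>\<theta>\<close> instead of
  \<open>L\<close>. This is what allows the Lipschitz bound to close in
  \<open>small1\<close>.\<close>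

lemma composed_lip:
  assumes V: "admissible t V" and t: "0 \<le> t" "t \<le> \<delta>"
  shows "\<bar>l i t x (\<lambda>j. V j x / t\<^sup>2) - l i t z (\<lambda>j. V j z / t\<^sup>2)\<bar> \<le> L * (1 + K1) * \<bar>x - z\<bar>"
    and "\<bar>h i t x (\<lambda>j. V j x / t\<^sup>2) - h i t z (\<lambda>j. V j z / t\<^sup>2)\<bar> \<le> L * (1 + K1) * \<bar>x - z\<bar>"
    and "\<bar>h i t x (\<lambda>j. V j x / t\<^sup>2) - h i t z (\<lambda>j. V j z / t\<^sup>2)\<bar> \<le> (L + \<theta> * K1) * \<bar>x - z\<bar>"
proof -
  have e: "\<bar>x - z\<bar> \<le> (1 + K1) * \<bar>x - z\<bar>" "\<bar>t - t\<bar> \<le> (1 + K1) * \<bar>x - z\<bar>"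
    using nonneg by (auto simp: algebra_simps)
  have ey: "\<bar>V j x / t\<^sup>2 - V j z / t\<^sup>2\<bar> \<le> (1 + K1) * \<bar>x - z\<bar>" for j
    using admissible_scaled(2)[OF V, of j x z] by (simp add: algebra_simps)
  have box: "\<bar>V j x / t\<^sup>2\<bar> \<le> K" "\<bar>V j z / t\<^sup>2\<bar> \<le> K" for j by (rule admissible_scaled(1)[OF V])+
  have ey': "\<bar>V j x / t\<^sup>2 - V j z / t\<^sup>2\<bar> \<le> K1 * \<bar>x - z\<bar>" for j by (rule admissible_scaled(2)[OF V])
  show "\<bar>l i t x (\<lambda>j. V j x / t\<^sup>2) - l i t z (\<lambda>j. V j z / t\<^sup>2)\<bar> \<le> L * (1 + K1) * \<bar>x - z\<bar>"
    using l_lip[OF t t box e(2,1) ey] by (simp add: mult_ac)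
  show "\<bar>h i t x (\<lambda>j. V j x / t\<^sup>2) - h i t z (\<lambda>j. V j z / t\<^sup>2)\<bar> \<le> L * (1 + K1) * \<bar>x - z\<bar>"
    using h_lip[OF t t box e(2,1) ey] by (simp add: mult_ac)
  show "\<bar>h i t x (\<lambda>j. V j x / t\<^sup>2) - h i t z (\<lambda>j. V j z / t\<^sup>2)\<bar> \<le> (L + \<theta> * K1) * \<bar>x - z\<bar>"
    using h_lip_y[where i=i and x=x and x'=z and y="\<lambda>j. V j x / t\<^sup>2" and y'="\<lambda>j. V j z / t\<^sup>2", OF t box ey'] by (simp add: algebra_simps)
qed

text \<open>The hypotheses on l and h compare with the value at the mean of the two outer y. That
  mean differs from the central y by at most \<open>K2 * k\<^sup>2 / 2\<close>, and replacing one by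
  the other costs \<open>L * K2\<close> for l, but only \<open>\<theta> * K2\<close> for h.\<close>

lemma composed_sd:
  assumes V: "admissible t V" and t: "0 \<le> t" "t \<le> \<delta>"
  shows "\<bar>l i t (x + k) (\<lambda>j. V j (x + k) / t\<^sup>2) + l i t (x - k) (\<lambda>j. V j (x - k) / t\<^sup>2)
       - 2 * l i t x (\<lambda>j. V j x / t\<^sup>2)\<bar> \<le> (L * (1 + K1)\<^sup>2 + L * K2) * k\<^sup>2"
    and "\<bar>h i t (x + k) (\<lambda>j. V j (x + k) / t\<^sup>2) + h i t (x - k) (\<lambda>j. V j (x - k) / t\<^sup>2)
       - 2 * h i t x (\<lambda>j. V j x / t\<^sup>2)\<bar> \<le> (L * (1 + K1)\<^sup>2 + \<theta> * K2) * k\<^sup>2"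
proof -
  let ?p = "\<lambda>j. V j (x + k) / t\<^sup>2" and ?q = "\<lambda>j. V j (x - k) / t\<^sup>2"
  let ?m = "\<lambda>j. (?p j + ?q j) / 2"
  have box: "\<bar>?p j\<bar> \<le> K" "\<bar>?q j\<bar> \<le> K" "\<bar>V j x / t\<^sup>2\<bar> \<le> K" for j
    using admissible_scaled(1)[OF V] by auto
  have boxm: "\<bar>?m j\<bar> \<le> K" for j using box(1,2)[of j] by (rule abs_midpoint_le)
  have e: "\<bar>k\<bar> \<le> (1 + K1) * \<bar>k\<bar>" using nonneg by (simp add: algebra_simps)
  have ey: "\<bar>?p j - ?q j\<bar> \<le> 2 * ((1 + K1) * \<bar>k\<bar>)" for j
  proof -
    have "\<bar>?p j - ?q j\<bar> \<le> K1 * \<bar>2 * k\<bar>"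
      using admissible_scaled(2)[OF V, of j "x + k" "x - k"] by simp
    then show ?thesis by (simp add: abs_mult algebra_simps)
  qed
  have em: "\<bar>?m j - V j x / t\<^sup>2\<bar> \<le> K2 * k\<^sup>2 / 2" for j
  proof -
    have "2 * (?m j - V j x / t\<^sup>2) = ?p j + ?q j - 2 * (V j x / t\<^sup>2)" by (simp only: right_diff_distrib) (simp add: field_simps)
    then have "\<bar>2 * (?m j - V j x / t\<^sup>2)\<bar> \<le> K2 * k\<^sup>2"
      using admissible_scaled(3)[OF V, of j x k] by (simp only:)
    then show ?thesis unfolding abs_mult by simp
  qed
  have sq: "((1 + K1) * \<bar>k\<bar>)\<^sup>2 = (1 + K1)\<^sup>2 * k\<^sup>2" by (simp add: power_mult_distrib)
  have "\<bar>l i t x ?m - l i t x (\<lambda>j. V j x / t\<^sup>2)\<bar> \<le> L * (K2 * k\<^sup>2 / 2)"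
    using l_lip[OF t t boxm box(3) _ _ em] nonneg by simp
  then have a: "2 * \<bar>l i t x ?m - l i t x (\<lambda>j. V j x / t\<^sup>2)\<bar> \<le> L * (K2 * k\<^sup>2)" by simp
  have b: "\<bar>l i t (x + k) ?p + l i t (x - k) ?q - 2 * l i t x ?m\<bar> \<le> L * ((1 + K1)\<^sup>2 * k\<^sup>2)"
    using l_sd[OF t box(1,2) e ey] unfolding sq .
  show "\<bar>l i t (x + k) ?p + l i t (x - k) ?q - 2 * l i t x (\<lambda>j. V j x / t\<^sup>2)\<bar>
      \<le> (L * (1 + K1)\<^sup>2 + L * K2) * k\<^sup>2"
    using second_difference_triangle[OF b a] by (simp add: algebra_simps)
  have "\<bar>h i t x ?m - h i t x (\<lambda>j. V j x / t\<^sup>2)\<bar> \<le> \<theta> * (K2 * k\<^sup>2 / 2)"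
    using h_lip_y[where i=i and x=x and x'=x and y="?m" and y'="\<lambda>j. V j x / t\<^sup>2", OF t boxm box(3) em] by simp
  then have a: "2 * \<bar>h i t x ?m - h i t x (\<lambda>j. V j x / t\<^sup>2)\<bar> \<le> \<theta> * (K2 * k\<^sup>2)" by simp
  have b: "\<bar>h i t (x + k) ?p + h i t (x - k) ?q - 2 * h i t x ?m\<bar> \<le> L * ((1 + K1)\<^sup>2 * k\<^sup>2)"
    using h_sd[OF t box(1,2) e ey] unfolding sq .
  show "\<bar>h i t (x + k) ?p + h i t (x - k) ?q - 2 * h i t x (\<lambda>j. V j x / t\<^sup>2)\<bar>
      \<le> (L * (1 + K1)\<^sup>2 + \<theta> * K2) * k\<^sup>2"
    using second_difference_triangle[OF b a] by (simp add: algebra_simps)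
qed

section \<open>Invariance of the three bounds under one step\<close>

lemma t_sq_le: "0 \<le> t \<Longrightarrow> t \<le> \<delta> \<Longrightarrow> t\<^sup>2 \<le> \<delta>\<^sup>2"
  by (simp add: power_mono)

text \<open>A shift leaves the sup norm unchanged, and \<open>(t + s)\<^sup>2\<close> exceeds
  \<open>t\<^sup>2\<close> by at least \<open>2 * s * t\<close>, which is exactly the room needed
  for a source bounded by \<open>2 * K\<close>.\<close>

lemma Step_bound:
  assumes V: "admissible t V" and t: "0 \<le> t" "t \<le> \<delta>" and s: "0 \<le> s"
  shows "\<bar>Step t s V i x\<bar> \<le> K * (t + s)\<^sup>2"
proof -
  have "\<bar>s * t * h i t x (\<lambda>j. V j x / t\<^sup>2)\<bar> \<le> s * t * (2 * K)"
    unfolding abs_mult using t s h_bound[OF t admissible_scaled(1)[OF V]] by (simp add: mult_left_mono)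
  then have "\<bar>Step t s V i x\<bar> \<le> K * t\<^sup>2 + s * t * (2 * K)"
    unfolding Step_def using admissibleD(1)[OF V, of i "x - s * t * l i t x (\<lambda>j. V j x / t\<^sup>2)"] by linarith
  also have "\<dots> = K * (t + s)\<^sup>2 - K * s\<^sup>2" by (simp add: power2_eq_square algebra_simps)
  also have "\<dots> \<le> K * (t + s)\<^sup>2" using nonneg by simp
  finally show ?thesis .
qed

text \<open>The foot point map stretches distances by at most the factor
  \<open>1 + s * t * P\<close>, and the source adds \<open>s * t * (L + \<theta> * K1)\<close>. By
  \<open>small1\<close> both together stay within the available
  \<open>2 * K1 * s * t\<close>.\<close>

lemma Step_lip:
  assumes V: "admissible t V" and t: "0 \<le> t" "t \<le> \<delta>" and s: "0 \<le> s"
  shows "\<bar>Step t s V i x - Step t s V i z\<bar> \<le> K1 * (t + s)\<^sup>2 * \<bar>x - z\<bar>"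
proof -
  define la where "la x = l i t x (\<lambda>j. V j x / t\<^sup>2)" for x
  define ha where "ha x = h i t x (\<lambda>j. V j x / t\<^sup>2)" for x
  define P where "P = L * (1 + K1)"
  define d where "d = \<bar>x - z\<bar>"
  have st: "0 \<le> s * t" using s t by simp
  have la: "\<bar>la x - la z\<bar> \<le> P * d" unfolding la_def P_def d_def by (rule composed_lip(1)[OF V t])
  have ha: "\<bar>ha x - ha z\<bar> \<le> (L + \<theta> * K1) * d" unfolding ha_def d_def by (rule composed_lip(3)[OF V t])
  have "\<bar>(x - s * t * la x) - (z - s * t * la z)\<bar> \<le> d + s * t * \<bar>la x - la z\<bar>"
  proof -
    have "(x - s * t * la x) - (z - s * t * la z) = (x - z) - s * t * (la x - la z)" by (simp add: algebra_simps)
    also have "\<bar>\<dots>\<bar> \<le> \<bar>x - z\<bar> + \<bar>s * t * (la x - la z)\<bar>" by (rule abs_triangle_ineq4)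
    finally show ?thesis using st by (simp only: abs_mult_left_nonneg d_def)
  qed
  also have "\<dots> \<le> d + s * t * (P * d)" using la st by (simp add: mult_left_mono)
  finally have g: "\<bar>(x - s * t * la x) - (z - s * t * la z)\<bar> \<le> d + s * t * (P * d)" .
  have "\<bar>V i (x - s * t * la x) - V i (z - s * t * la z)\<bar> \<le> K1 * t\<^sup>2 * (d + s * t * (P * d))"
    using admissibleD(2)[OF V] g nonneg by (meson mult_left_mono order_trans mult_nonneg_nonneg zero_le_power2)
  moreover have "\<bar>s * t * ha x - s * t * ha z\<bar> \<le> s * t * ((L + \<theta> * K1) * d)"
  proof -
    have "\<bar>s * t * ha x - s * t * ha z\<bar> = s * t * \<bar>ha x - ha z\<bar>"
      using st by (simp only: abs_mult_left_nonneg right_diff_distrib[symmetric])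
    then show ?thesis using ha st by (simp add: mult_left_mono)
  qed
  ultimately have "\<bar>Step t s V i x - Step t s V i z\<bar> \<le> K1 * t\<^sup>2 * (d + s * t * (P * d)) + s * t * ((L + \<theta> * K1) * d)"
    unfolding Step_def la_def ha_def by linarith
  also have "\<dots> = (K1 * t\<^sup>2 + s * t * (K1 * t\<^sup>2 * P + L + \<theta> * K1)) * d" by (simp add: algebra_simps)
  also have "\<dots> \<le> (K1 * t\<^sup>2 + s * t * (2 * K1)) * d"
  proof -
    have "K1 * t\<^sup>2 * P \<le> K1 * \<delta>\<^sup>2 * P"
      using t_sq_le[OF t] nonneg by (intro mult_right_mono mult_left_mono) (auto simp: P_def)
    then have "K1 * t\<^sup>2 * P + L + \<theta> * K1 \<le> 2 * K1" using small1 unfolding P_def by linarith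
    then show ?thesis using st by (intro mult_right_mono add_left_mono mult_left_mono) (auto simp: d_def)
  qed
  also have "\<dots> \<le> K1 * (t + s)\<^sup>2 * d"
    using nonneg by (intro mult_right_mono) (auto simp: d_def power2_eq_square algebra_simps)
  finally show ?thesis by (simp add: d_def)
qed

lemma Step_sd:
  assumes V: "admissible t V" and t: "0 \<le> t" "t + s \<le> \<delta>" and s: "0 \<le> s"
  shows "\<bar>Step t s V i (x + k) + Step t s V i (x - k) - 2 * Step t s V i x\<bar> \<le> K2 * (t + s)\<^sup>2 * k\<^sup>2"
proof -
  have t': "t \<le> \<delta>" using t s by linarith
  define la where "la x = l i t x (\<lambda>j. V j x / t\<^sup>2)" for x
  define ha where "ha x = h i t x (\<lambda>j. V j x / t\<^sup>2)" for x
  define P where "P = L * (1 + K1)"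
  define N where "N = L * (1 + K1)\<^sup>2 + L * K2"
  define g where "g x = x - s * t * la x" for x
  have P: "P \<ge> 0" and N: "N \<ge> 0" using nonneg by (auto simp: P_def N_def)
  have st: "0 \<le> s * t" using s t by simp
  have st1: "s * t \<le> 1"
    using s t t' delta by (metis add_increasing mult_le_one order_trans add.commute add_decreasing2 le_add_same_cancel2)
  have la: "\<bar>la (x + k) - la (x - k)\<bar> \<le> P * (2 * \<bar>k\<bar>)"
    using composed_lip(1)[OF V t(1) t', of i "x + k" "x - k"] unfolding la_def P_def by (simp add: abs_mult)
  have las: "\<bar>la (x + k) + la (x - k) - 2 * la x\<bar> \<le> N * k\<^sup>2"
    unfolding la_def N_def by (rule composed_sd(1)[OF V t(1) t'])
  have has: "\<bar>ha (x + k) + ha (x - k) - 2 * ha x\<bar> \<le> (L * (1 + K1)\<^sup>2 + \<theta> * K2) * k\<^sup>2"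
    unfolding ha_def by (rule composed_sd(2)[OF V t(1) t'])
  have gd: "\<bar>(g (x + k) - g (x - k)) / 2\<bar> \<le> (1 + s * t * P) * \<bar>k\<bar>"
  proof -
    have "(g (x + k) - g (x - k)) / 2 = k - s * t * ((la (x + k) - la (x - k)) / 2)"
      unfolding g_def by (simp add: field_simps)
    also have "\<bar>\<dots>\<bar> \<le> \<bar>k\<bar> + \<bar>s * t * ((la (x + k) - la (x - k)) / 2)\<bar>" by (rule abs_triangle_ineq4)
    also have "\<bar>s * t * ((la (x + k) - la (x - k)) / 2)\<bar> = s * t * \<bar>(la (x + k) - la (x - k)) / 2\<bar>"
      using st by (simp only: abs_mult_left_nonneg)
    also have "\<bar>k\<bar> + s * t * \<bar>(la (x + k) - la (x - k)) / 2\<bar> \<le> \<bar>k\<bar> + s * t * (P * \<bar>k\<bar>)"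
      using la st by (intro add_left_mono mult_left_mono) auto
    finally show ?thesis by (simp add: algebra_simps)
  qed
  have gd2: "((g (x + k) - g (x - k)) / 2)\<^sup>2 \<le> (1 + s * t * (2 * P + P\<^sup>2)) * k\<^sup>2"
  proof -
    have "((g (x + k) - g (x - k)) / 2)\<^sup>2 \<le> ((1 + s * t * P) * \<bar>k\<bar>)\<^sup>2"
      using gd by (rule abs_le_square_iff[THEN iffD1, OF order_trans]) simp
    also have "\<dots> = (1 + s * t * (2 * P) + (s * t) * (s * t) * P\<^sup>2) * k\<^sup>2"
      by (simp add: power2_eq_square algebra_simps)
    \<comment> \<open>Since \<open>s * t \<le> 1\<close>, the quadratic term is also bounded by a
      multiple of \<open>s * t\<close>; every contribution can then be compared with the available
      \<open>2 * K2 * s * t\<close>.\<close>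
    also have "\<dots> \<le> (1 + s * t * (2 * P) + s * t * P\<^sup>2) * k\<^sup>2"
      using st st1 by (intro mult_right_mono add_left_mono) (auto simp: mult_left_le)
    finally show ?thesis by (simp add: algebra_simps)
  qed
  have gs: "\<bar>g (x + k) + g (x - k) - 2 * g x\<bar> \<le> s * t * (N * k\<^sup>2)"
  proof -
    have "g (x + k) + g (x - k) - 2 * g x = - (s * t * (la (x + k) + la (x - k) - 2 * la x))"
      unfolding g_def by (simp add: algebra_simps)
    then have "\<bar>g (x + k) + g (x - k) - 2 * g x\<bar> = s * t * \<bar>la (x + k) + la (x - k) - 2 * la x\<bar>"
      using st by (simp only: abs_minus_cancel abs_mult_left_nonneg)
    then show ?thesis using las st by (simp add: mult_left_mono)
  qed
  have "\<bar>V i (g (x + k)) + V i (g (x - k)) - 2 * V i (g x)\<bar>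
      \<le> K2 * t\<^sup>2 * ((g (x + k) - g (x - k)) / 2)\<^sup>2 + K1 * t\<^sup>2 * \<bar>g (x + k) + g (x - k) - 2 * g x\<bar>"
    by (rule second_difference_compose) (use admissibleD[OF V] in auto)
  also have "\<dots> \<le> K2 * t\<^sup>2 * ((1 + s * t * (2 * P + P\<^sup>2)) * k\<^sup>2) + K1 * t\<^sup>2 * (s * t * (N * k\<^sup>2))"
    using gd2 gs nonneg by (intro add_mono mult_left_mono) auto
  finally have 1: "\<bar>V i (g (x + k)) + V i (g (x - k)) - 2 * V i (g x)\<bar> \<le> \<dots>" .
  have "\<bar>s * t * (ha (x + k) + ha (x - k) - 2 * ha x)\<bar> = s * t * \<bar>ha (x + k) + ha (x - k) - 2 * ha x\<bar>"
    using st by (simp only: abs_mult_left_nonneg)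
  also have "\<dots> \<le> s * t * ((L * (1 + K1)\<^sup>2 + \<theta> * K2) * k\<^sup>2)" using has st by (rule mult_left_mono)
  finally have 2: "\<bar>s * t * (ha (x + k) + ha (x - k) - 2 * ha x)\<bar> \<le> \<dots>" .
  have "Step t s V i (x + k) + Step t s V i (x - k) - 2 * Step t s V i x
      = (V i (g (x + k)) + V i (g (x - k)) - 2 * V i (g x)) + s * t * (ha (x + k) + ha (x - k) - 2 * ha x)"
    unfolding Step_def g_def la_def ha_def by (simp add: algebra_simps)
  then have "\<bar>Step t s V i (x + k) + Step t s V i (x - k) - 2 * Step t s V i x\<bar>
      \<le> K2 * t\<^sup>2 * ((1 + s * t * (2 * P + P\<^sup>2)) * k\<^sup>2) + K1 * t\<^sup>2 * (s * t * (N * k\<^sup>2))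
        + s * t * ((L * (1 + K1)\<^sup>2 + \<theta> * K2) * k\<^sup>2)"
    using 1 2 by linarith
  also have "\<dots> = (K2 * t\<^sup>2 + s * t * (K2 * t\<^sup>2 * (2 * P + P\<^sup>2) + K1 * t\<^sup>2 * N + L * (1 + K1)\<^sup>2 + \<theta> * K2)) * k\<^sup>2"
    by (simp add: algebra_simps)
  also have "\<dots> \<le> (K2 * t\<^sup>2 + s * t * (2 * K2)) * k\<^sup>2"
  proof -
    have "K2 * t\<^sup>2 * (2 * P + P\<^sup>2) \<le> K2 * \<delta>\<^sup>2 * (2 * P + P\<^sup>2)" "K1 * t\<^sup>2 * N \<le> K1 * \<delta>\<^sup>2 * N"
      using t_sq_le[OF t(1) t'] nonneg P N by (intro mult_right_mono mult_left_mono; auto)+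
    then have "K2 * t\<^sup>2 * (2 * P + P\<^sup>2) + K1 * t\<^sup>2 * N + L * (1 + K1)\<^sup>2 + \<theta> * K2 \<le> 2 * K2"
      using small2 unfolding P_def N_def by linarith
    then show ?thesis using st by (intro mult_right_mono add_left_mono mult_left_mono) auto
  qed
  also have "\<dots> \<le> K2 * (t + s)\<^sup>2 * k\<^sup>2"
    using nonneg by (intro mult_right_mono) (auto simp: power2_eq_square algebra_simps)
  finally show ?thesis .
qed

lemma Step_admissible:
  assumes "admissible t V" "0 \<le> t" "0 \<le> s" "t + s \<le> \<delta>"
  shows "admissible (t + s) (Step t s V)"
  using Step_bound Step_lip Step_sd assms unfolding admissible_def[of "t + s"] by simp

section \<open>Stability and consistency of the steps\<close>

lemma Step_0 [simp]: "Step t 0 V = V"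
  by (simp add: Step_def fun_eq_iff)

lemma Step_increment:
  assumes V: "admissible t V" and t: "0 \<le> t" "t \<le> \<delta>" and s: "0 \<le> s"
  shows "\<bar>Step t s V i x - V i x\<bar> \<le> s * t * (K1 * L + 2 * K)"
proof -
  let ?la = "l i t x (\<lambda>j. V j x / t\<^sup>2)" and ?ha = "h i t x (\<lambda>j. V j x / t\<^sup>2)"
  have st: "0 \<le> s * t" using s t by simp
  have la: "\<bar>?la\<bar> \<le> L" and ha: "\<bar>?ha\<bar> \<le> 2 * K"
    using l_bound[OF t] h_bound[OF t] admissible_scaled(1)[OF V] by auto
  have "\<bar>V i (x - s * t * ?la) - V i x\<bar> \<le> K1 * t\<^sup>2 * (s * t * \<bar>?la\<bar>)"
    using admissibleD(2)[OF V, of i "x - s * t * ?la" x] st by (simp add: abs_mult mult.assoc s t)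
  also have "\<dots> \<le> K1 * 1 * (s * t * L)"
    using la nonneg st t delta power_le_one[of t 2] by (intro mult_mono mult_left_mono) auto
  finally have "\<bar>V i (x - s * t * ?la) - V i x\<bar> \<le> s * t * (K1 * L)" by (simp add: mult_ac)
  moreover have "\<bar>s * t * ?ha\<bar> \<le> s * t * (2 * K)"
    using ha st by (metis abs_mult abs_of_nonneg mult_left_mono)
  ultimately show ?thesis unfolding Step_def distrib_left by linarith
qed

text \<open>A difference E of the data becomes \<open>E / t\<^sup>2\<close> in the argument y and is
  weighted by \<open>s * t\<close>, which gives the singular factor \<open>s / t\<close>. The
  different foot points are compared through the Lipschitz constant \<open>K1 * t\<^sup>2\<close> of
  V', whose factor \<open>t\<^sup>2\<close> removes the singularity; this part is small by the
  choice of \<open>\<delta>\<close> and is included in \<open>small3\<close>.\<close>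

lemma Step_stable:
  assumes V: "admissible t V" and V': "admissible t V'" and t: "0 < t" "t \<le> \<delta>" and s: "0 \<le> s"
    and E: "\<And>i x. \<bar>V i x - V' i x\<bar> \<le> E"
  shows "\<bar>Step t s V i x - Step t s V' i x\<bar> \<le> E * (1 + s * (11 / 8) / t)"
proof -
  define la where "la = l i t x (\<lambda>j. V j x / t\<^sup>2)"
  define lb where "lb = l i t x (\<lambda>j. V' j x / t\<^sup>2)"
  define ha where "ha = h i t x (\<lambda>j. V j x / t\<^sup>2)"
  define hb where "hb = h i t x (\<lambda>j. V' j x / t\<^sup>2)"
  have t0: "0 \<le> t" using t by simp
  have E0: "0 \<le> E" using E[of 0 0] by linarith
  have st: "0 \<le> s * t" using s t by simp
  have ey: "\<bar>V j x / t\<^sup>2 - V' j x / t\<^sup>2\<bar> \<le> E / t\<^sup>2" for j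
    using divide_right_mono[OF E[of j x], of "t\<^sup>2"] by (simp add: diff_divide_distrib[symmetric] abs_divide)
  have box: "\<bar>V j x / t\<^sup>2\<bar> \<le> K" and box': "\<bar>V' j x / t\<^sup>2\<bar> \<le> K" for j
    by (rule admissible_scaled(1)[OF V], rule admissible_scaled(1)[OF V'])
  have la: "\<bar>la - lb\<bar> \<le> L * (E / t\<^sup>2)"
    unfolding la_def lb_def
    by (rule l_lip[OF t0 t(2) t0 t(2) box box' _ _ ey]) (use E0 in auto)
  have ha: "\<bar>ha - hb\<bar> \<le> \<theta> * (E / t\<^sup>2)"
    using h_lip_y[where i=i and x=x and x'=x and y="\<lambda>j. V j x / t\<^sup>2" and y'="\<lambda>j. V' j x / t\<^sup>2", OF t0 t(2) box box' ey]
    unfolding ha_def hb_def by simp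
  have "\<bar>V' i (x - s * t * la) - V' i (x - s * t * lb)\<bar> \<le> K1 * t\<^sup>2 * \<bar>s * t * (la - lb)\<bar>"
    using admissibleD(2)[OF V', of i "x - s * t * la" "x - s * t * lb"]
    by (simp add: right_diff_distrib abs_minus_commute)
  also have "\<dots> = K1 * t\<^sup>2 * (s * t * \<bar>la - lb\<bar>)" using st by (simp only: abs_mult_left_nonneg)
  also have "\<dots> \<le> K1 * t\<^sup>2 * (s * t * (L * (E / t\<^sup>2)))"
    using la nonneg st by (intro mult_left_mono) auto
  also have "\<dots> = E * s * (K1 * L * t\<^sup>2) / t" using t by (simp add: field_simps power2_eq_square)
  finally have 1: "\<bar>V' i (x - s * t * la) - V' i (x - s * t * lb)\<bar> \<le> E * s * (K1 * L * t\<^sup>2) / t" .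
  have "\<bar>s * t * (ha - hb)\<bar> = s * t * \<bar>ha - hb\<bar>" using st by (simp only: abs_mult_left_nonneg)
  also have "\<dots> \<le> s * t * (\<theta> * (E / t\<^sup>2))" using ha st by (rule mult_left_mono)
  also have "\<dots> = E * s * \<theta> / t" using t by (simp add: field_simps power2_eq_square)
  finally have 2: "\<bar>s * t * (ha - hb)\<bar> \<le> E * s * \<theta> / t" .
  have "Step t s V i x - Step t s V' i x = (V i (x - s * t * la) - V' i (x - s * t * la))
      + (V' i (x - s * t * la) - V' i (x - s * t * lb)) + s * t * (ha - hb)"
    unfolding Step_def la_def lb_def ha_def hb_def by (simp add: algebra_simps)
  then have "\<bar>Step t s V i x - Step t s V' i x\<bar> \<le> E + E * s * (K1 * L * t\<^sup>2) / t + E * s * \<theta> / t"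
    using 1 2 E[of i "x - s * t * la"] by linarith
  also have "\<dots> = E + E * s * (\<theta> + K1 * L * t\<^sup>2) / t"
    by (simp add: add_divide_distrib distrib_left)
  also have "\<dots> \<le> E + E * s * (11 / 8) / t"
  proof -
    have "K1 * L * t\<^sup>2 \<le> K1 * L * \<delta>\<^sup>2" using t_sq_le[OF t0 t(2)] nonneg by (intro mult_left_mono) auto
    then show ?thesis using small3 E0 s t by (intro add_left_mono divide_right_mono mult_left_mono) auto
  qed
  finally show ?thesis by (simp add: field_simps)
qed

definition increment_const :: real where "increment_const = K1 * L + 4 * K"
text \<open>The three summands are the coefficients of \<open>r * s\<close> that arise from the
  displacement of the foot point, multiplied by \<open>K1\<close>, from the variation of the source
  between x and the intermediate foot point, and from the change of t times the source during the
  first substep.\<close>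

definition consistency_const :: real where
  "consistency_const = K1 * (L * (increment_const + 2) + L * (1 + K1) * L) + L * (1 + K1) * L + (L * (increment_const + 1) + 2 * K)"

lemma increment_const_nonneg: "0 \<le> increment_const" using nonneg by (simp add: increment_const_def)

lemma two_K_le_consistency_const: "2 * K \<le> consistency_const"
  using nonneg increment_const_nonneg by (simp add: consistency_const_def)

lemma consistency_const_nonneg: "0 \<le> consistency_const" using two_K_le_consistency_const nonneg by linarith

text \<open>The quotient changes because V does, at rate \<open>K1 * L + 2 * K\<close>, and because
  the factor 1 / t^2 does, at rate \<open>2 * K\<close>; the sum is \<open>increment_const\<close>.
  Only one of the two powers of t is recovered from the step weight, hence the bound by r / (t + r)
  instead of r.\<close>

lemma Step_scaled_increment:
  assumes V: "admissible t V" and t: "0 < t" and r: "0 \<le> r" and tr: "t + r \<le> \<delta>"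
  shows "\<bar>V j x / t\<^sup>2 - Step t r V j x / (t + r)\<^sup>2\<bar> \<le> increment_const * (r / (t + r))"
proof -
  define t' where "t' = t + r"
  define V' where "V' = Step t r V"
  have t': "0 < t'" "t \<le> t'" "r = t' - t" using t r by (auto simp: t'_def)
  have "\<bar>V' j x - V j x\<bar> \<le> r * t * (K1 * L + 2 * K)"
    unfolding V'_def using Step_increment[OF V _ _ r] t r tr by simp
  then have "\<bar>V' j x - V j x\<bar> / t'\<^sup>2 \<le> r * t * (K1 * L + 2 * K) / t'\<^sup>2"
    by (rule divide_right_mono) simp
  also have "\<dots> \<le> r * t' * (K1 * L + 2 * K) / t'\<^sup>2"
    using t' r nonneg by (intro divide_right_mono mult_right_mono mult_left_mono) auto
  also have "\<dots> = (K1 * L + 2 * K) * (r / t')" using t' by (simp add: power2_eq_square)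
  finally have 1: "\<bar>V' j x - V j x\<bar> / t'\<^sup>2 \<le> (K1 * L + 2 * K) * (r / t')" .
  have "V j x / t\<^sup>2 - V j x / t'\<^sup>2 = (V j x / t\<^sup>2) * ((t'\<^sup>2 - t\<^sup>2) / t'\<^sup>2)"
    using t t' by (simp add: field_simps)
  then have "\<bar>V j x / t\<^sup>2 - V j x / t'\<^sup>2\<bar> = \<bar>V j x / t\<^sup>2\<bar> * \<bar>(t'\<^sup>2 - t\<^sup>2) / t'\<^sup>2\<bar>" by (simp only: abs_mult)
  also have "\<dots> \<le> K * (2 * (r / t'))"
  proof (rule mult_mono)
    have "\<bar>(t'\<^sup>2 - t\<^sup>2) / t'\<^sup>2\<bar> = r * (t + t') / t'\<^sup>2"
      using t t' power_mono[of t t' 2] by (simp add: abs_divide) (simp add: power2_eq_square algebra_simps)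
    also have "\<dots> \<le> r * (t' + t') / t'\<^sup>2" using t' r by (intro divide_right_mono mult_left_mono) auto
    also have "\<dots> = 2 * (r / t')" using t' by (simp add: power2_eq_square field_simps)
    finally show "\<bar>(t'\<^sup>2 - t\<^sup>2) / t'\<^sup>2\<bar> \<le> 2 * (r / t')" .
  qed (use admissible_scaled(1)[OF V] nonneg in auto)
  finally have 2: "\<bar>V j x / t\<^sup>2 - V j x / t'\<^sup>2\<bar> \<le> K * (2 * (r / t'))" .
  have "V j x / t\<^sup>2 - V' j x / t'\<^sup>2 = (V j x / t\<^sup>2 - V j x / t'\<^sup>2) - (V' j x - V j x) / t'\<^sup>2"
    by (simp add: diff_divide_distrib)
  then have "\<bar>V j x / t\<^sup>2 - V' j x / t'\<^sup>2\<bar> \<le> \<bar>V j x / t\<^sup>2 - V j x / t'\<^sup>2\<bar> + \<bar>(V' j x - V j x) / t'\<^sup>2\<bar>"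
    by (simp only: abs_triangle_ineq4)
  also have "\<bar>(V' j x - V j x) / t'\<^sup>2\<bar> = \<bar>V' j x - V j x\<bar> / t'\<^sup>2" by (simp add: abs_divide)
  finally have "\<bar>V j x / t\<^sup>2 - V' j x / t'\<^sup>2\<bar> \<le> K * (2 * (r / t')) + (K1 * L + 2 * K) * (r / t')"
    using 1 2 by linarith
  also have "\<dots> = increment_const * (r / t')" unfolding increment_const_def by (simp add: algebra_simps)
  finally show ?thesis by (simp add: V'_def t'_def)
qed

text \<open>One step of length r + s is compared with a step r followed by a step s. Although the
  scaled argument y varies by r / (t + r), which is not small near t = 0, the error is of order
  \<open>r * s\<close> uniformly in t, since the coefficients occur only with a weight of the size
  of the time.\<close>

lemma Step_consistent_pos:
  assumes V: "admissible t V" and t: "0 < t" and r: "0 \<le> r" and s: "0 \<le> s" and trs: "t + r + s \<le> \<delta>"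
  shows "\<bar>Step t (r + s) V i x - Step (t + r) s (Step t r V) i x\<bar> \<le> consistency_const * (r * s)"
proof -
  define t' where "t' = t + r"
  define V' where "V' = Step t r V"
  have t': "0 < t'" "t \<le> t'" "t' \<le> \<delta>" "t' \<le> 1" "0 \<le> t'" using t r s trs delta by (auto simp: t'_def)
  have t0: "0 \<le> t" "t \<le> \<delta>" "t \<le> 1" using t t' by auto
  have V': "admissible t' V'" unfolding V'_def t'_def using Step_admissible[OF V] t r s trs by simp
  define la where "la z = l i t z (\<lambda>j. V j z / t\<^sup>2)" for z
  define ha where "ha z = h i t z (\<lambda>j. V j z / t\<^sup>2)" for z
  define lb where "lb = l i t' x (\<lambda>j. V' j x / t'\<^sup>2)"
  define hb where "hb = h i t' x (\<lambda>j. V' j x / t'\<^sup>2)"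
  define P where "P = L * (1 + K1)"
  define w where "w = x - s * t' * lb"
  have P: "0 \<le> P" using nonneg by (simp add: P_def)
  have box: "\<bar>V j x / t\<^sup>2\<bar> \<le> K" and box': "\<bar>V' j x / t'\<^sup>2\<bar> \<le> K" for j
    by (rule admissible_scaled(1)[OF V], rule admissible_scaled(1)[OF V'])
  have rt: "r \<le> r / t'" "0 \<le> r / t'" using t' r by (auto simp: pos_le_divide_eq mult_left_le)
  have e1: "\<bar>t - t'\<bar> \<le> (increment_const + 1) * (r / t')"
  proof -
    have "\<bar>t - t'\<bar> = r" using r by (simp add: t'_def)
    moreover have "0 \<le> increment_const * (r / t')" using increment_const_nonneg rt by (intro mult_nonneg_nonneg)
    ultimately show ?thesis using rt(1) by (simp only: distrib_right)
  qed
  have e2: "\<bar>x - x\<bar> \<le> (increment_const + 1) * (r / t')" using e1 by linarith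
  have e3: "\<bar>V j x / t\<^sup>2 - V' j x / t'\<^sup>2\<bar> \<le> (increment_const + 1) * (r / t')" for j
  proof -
    have "\<bar>V j x / t\<^sup>2 - V' j x / t'\<^sup>2\<bar> \<le> increment_const * (r / t')"
      unfolding t'_def V'_def using Step_scaled_increment[OF V t r] s trs by simp
    also have "\<dots> \<le> (increment_const + 1) * (r / t')" using rt by (intro mult_right_mono) auto
    finally show ?thesis .
  qed
  have lab: "\<bar>la x - lb\<bar> \<le> L * ((increment_const + 1) * (r / t'))"
    unfolding la_def lb_def by (rule l_lip[OF t0(1,2) t'(5,3) box box' e1 e2 e3])
  have hab: "\<bar>ha x - hb\<bar> \<le> L * ((increment_const + 1) * (r / t'))"
    unfolding ha_def hb_def by (rule h_lip[OF t0(1,2) t'(5,3) box box' e1 e2 e3])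
  have la1: "\<bar>la x\<bar> \<le> L" unfolding la_def by (rule l_bound[OF t0(1,2) box])
  have ha1: "\<bar>ha x\<bar> \<le> 2 * K" unfolding ha_def by (rule h_bound[OF t0(1,2) box])
  have lb1: "\<bar>lb\<bar> \<le> L" unfolding lb_def by (rule l_bound[OF t'(5,3) box'])
  \<comment> \<open>The weight \<open>t'\<close> cancels the denominator \<open>t'\<close> in the
    variation of the coefficients; the rest comes from the difference of the weights
    \<open>t\<close> and \<open>t'\<close>, which is r.\<close>
  have conv: "\<bar>t' * b - t * a\<bar> \<le> L * (increment_const + 1) * r + r * B"
    if "\<bar>a - b\<bar> \<le> L * ((increment_const + 1) * (r / t'))" "\<bar>a\<bar> \<le> B" for a b B
  proof -
    have "t' * b - t * a = r * a - t' * (a - b)" by (simp add: t'_def algebra_simps)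
    then have "\<bar>t' * b - t * a\<bar> \<le> \<bar>r * a\<bar> + \<bar>t' * (a - b)\<bar>" by simp
    also have "\<dots> = r * \<bar>a\<bar> + t' * \<bar>a - b\<bar>" using r t' by (simp add: abs_mult)
    also have "\<dots> \<le> r * B + t' * (L * ((increment_const + 1) * (r / t')))"
      using that r t' by (intro add_mono mult_left_mono) auto
    also have "t' * (L * ((increment_const + 1) * (r / t'))) = L * (increment_const + 1) * r" using t' by simp
    finally show ?thesis by simp
  qed
  have lam: "\<bar>t' * lb - t * la x\<bar> \<le> L * (increment_const + 2) * r"
    using conv[OF lab la1] by (simp add: algebra_simps)
  have ham: "\<bar>t' * hb - t * ha x\<bar> \<le> (L * (increment_const + 1) + 2 * K) * r"
    using conv[OF hab ha1] by (simp add: algebra_simps)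
  have wx: "\<bar>w - x\<bar> \<le> s * L"
  proof -
    have "\<bar>w - x\<bar> = s * (t' * \<bar>lb\<bar>)" using s t' by (simp add: w_def abs_mult)
    also have "\<dots> \<le> s * (1 * L)" using s t' lb1 by (intro mult_left_mono mult_mono) auto
    finally show ?thesis by simp
  qed
  have law: "\<bar>la w - la x\<bar> \<le> P * (s * L)"
    using composed_lip(1)[OF V t0(1,2), of i w x] wx mult_left_mono[OF wx P] unfolding la_def P_def by linarith
  have haw: "\<bar>ha w - ha x\<bar> \<le> P * (s * L)"
    using composed_lip(2)[OF V t0(1,2), of i w x] wx mult_left_mono[OF wx P] unfolding ha_def P_def by linarith
  have rt1: "0 \<le> r * t" "r * t \<le> r" using r t0 by (auto simp: mult_left_le)
  have tr: "\<bar>r * t * z\<bar> \<le> r * B" if "\<bar>z\<bar> \<le> B" for z B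
  proof -
    have "\<bar>r * t * z\<bar> = r * t * \<bar>z\<bar>" using rt1 by (simp only: abs_mult_left_nonneg)
    also have "\<dots> \<le> r * B" using that rt1 r by (intro mult_mono) auto
    finally show ?thesis .
  qed
  have sz: "\<bar>s * z\<bar> \<le> s * B" if "\<bar>z\<bar> \<le> B" for z B
    using that s by (simp add: abs_mult mult_left_mono)
  have arg: "\<bar>(x - (r + s) * t * la x) - (w - r * t * la w)\<bar> \<le> s * (L * (increment_const + 2) * r) + r * (P * (s * L))"
  proof -
    have "(x - (r + s) * t * la x) - (w - r * t * la w) = s * (t' * lb - t * la x) + r * t * (la w - la x)"
      unfolding w_def by (simp add: algebra_simps)
    then show ?thesis using sz[OF lam] tr[OF law] by linarith
  qed
  have "\<bar>V i (x - (r + s) * t * la x) - V i (w - r * t * la w)\<bar>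
      \<le> K1 * t\<^sup>2 * (s * (L * (increment_const + 2) * r) + r * (P * (s * L)))"
    using admissibleD(2)[OF V] arg nonneg by (meson mult_left_mono order_trans mult_nonneg_nonneg zero_le_power2)
  also have "\<dots> \<le> K1 * 1 * (s * (L * (increment_const + 2) * r) + r * (P * (s * L)))"
    using nonneg increment_const_nonneg P r s t0 power_le_one[of t 2] by (intro mult_right_mono mult_left_mono) auto
  finally have 1: "\<bar>V i (x - (r + s) * t * la x) - V i (w - r * t * la w)\<bar> \<le> \<dots>" .
  have "Step t (r + s) V i x - Step t' s V' i x =
      (V i (x - (r + s) * t * la x) - V i (w - r * t * la w)) - r * t * (ha w - ha x) - s * (t' * hb - t * ha x)"
  proof -
    have "Step t' s V' i x = V' i w + s * t' * hb" unfolding Step_def w_def lb_def hb_def ..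
    moreover have "V' i w = V i (w - r * t * la w) + r * t * ha w" unfolding V'_def Step_def la_def ha_def ..
    moreover have "Step t (r + s) V i x = V i (x - (r + s) * t * la x) + (r + s) * t * ha x"
      unfolding Step_def la_def ha_def ..
    ultimately show ?thesis by (simp add: algebra_simps)
  qed
  then have "\<bar>Step t (r + s) V i x - Step t' s V' i x\<bar>
      \<le> K1 * 1 * (s * (L * (increment_const + 2) * r) + r * (P * (s * L))) + r * (P * (s * L)) + s * ((L * (increment_const + 1) + 2 * K) * r)"
    using 1 tr[OF haw] sz[OF ham] by linarith
  also have "\<dots> = consistency_const * (r * s)" unfolding consistency_const_def P_def by (simp add: algebra_simps)
  finally show ?thesis by (simp add: t'_def V'_def)
qed

lemma Step_at_0: "Step 0 s V = V"
  by (simp add: Step_def fun_eq_iff)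

lemma Step_consistent:
  assumes V: "admissible t V" and t: "0 \<le> t" and r: "0 \<le> r" and s: "0 \<le> s" and trs: "t + r + s \<le> \<delta>"
  shows "\<bar>Step t (r + s) V i x - Step (t + r) s (Step t r V) i x\<bar> \<le> consistency_const * (r * s)"
proof (cases "t = 0")
  \<comment> \<open>From time 0 the weight \<open>s * t\<close> vanishes, so both the long step and
    the first short step do nothing. With V = 0 the whole error is the source term of the second
    short step, bounded by \<open>2 * K * r * s\<close>.\<close>
  case True
  have V0: "V i x = 0" for i x using admissible_at_0 V True by simp
  have "admissible r V" using Step_admissible[OF V t r] s trs by (simp add: True Step_at_0)
  then have "\<bar>h i r x (\<lambda>j. V j x / r\<^sup>2)\<bar> \<le> 2 * K"
    using r s trs True by (intro h_bound admissible_scaled) auto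
  then have "\<bar>h i r x (\<lambda>j. V j x / r\<^sup>2)\<bar> \<le> consistency_const" using two_K_le_consistency_const by linarith
  then have "\<bar>s * r * h i r x (\<lambda>j. V j x / r\<^sup>2)\<bar> \<le> s * r * consistency_const"
    using abs_mult_left_nonneg[of "s * r"] r s by (simp add: mult_left_mono)
  then show ?thesis using True by (simp add: Step_at_0) (simp add: Step_def V0 mult_ac)
qed (use Step_consistent_pos assms in auto)

section \<open>Iterates and step halving\<close>

primrec iter :: "real \<Rightarrow> nat \<Rightarrow> nat \<Rightarrow> real \<Rightarrow> real" where
  "iter d 0 = (\<lambda>i x. 0)"
| "iter d (Suc n) = Step (real n * d) d (iter d n)"

lemma iter_admissible:
  assumes "0 \<le> d" "real n * d \<le> \<delta>"
  shows "admissible (real n * d) (iter d n)"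
  using assms(2)
proof (induction n)
  case 0
  show ?case using admissible_zero by simp
next
  case (Suc n)
  then have n: "real n * d + d \<le> \<delta>" by (simp add: distrib_right add.commute)
  with Suc assms have "admissible (real n * d) (iter d n)" by simp
  from Step_admissible[OF this _ assms(1)] n assms show ?case by (simp add: distrib_right add.commute)
qed

lemma iter_time_lip:
  assumes "0 \<le> d" "real (n + m) * d \<le> \<delta>"
  shows "\<bar>iter d (n + m) i x - iter d n i x\<bar> \<le> real m * d * (K1 * L + 2 * K)"
  using assms(2)
proof (induction m)
  case (Suc m)
  let ?t = "real (n + m) * d"
  have t: "?t + d \<le> \<delta>" using Suc.prems by (simp add: algebra_simps)
  then have t': "?t \<le> \<delta>" "0 \<le> ?t" "?t \<le> 1" using assms(1) delta by (auto simp del: of_nat_add)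
  have "\<bar>Step ?t d (iter d (n + m)) i x - iter d (n + m) i x\<bar> \<le> d * ?t * (K1 * L + 2 * K)"
    by (rule Step_increment[OF iter_admissible[OF assms(1) t'(1)] t'(2,1) assms(1)])
  also have "\<dots> \<le> d * 1 * (K1 * L + 2 * K)"
    using assms(1) t' nonneg by (intro mult_right_mono mult_left_mono) auto
  finally have "\<bar>iter d (n + Suc m) i x - iter d (n + m) i x\<bar> \<le> d * (K1 * L + 2 * K)" by simp
  with Suc.IH[OF t'(1)] have "\<bar>iter d (n + Suc m) i x - iter d n i x\<bar> \<le> real m * d * (K1 * L + 2 * K) + d * (K1 * L + 2 * K)"
    by linarith
  then show ?case by (simp add: algebra_simps)
qed simp

text \<open>Many small steps are close to a single long one, with an error quadratic in its length;
  in the limit this becomes the first order expansion in time. The condition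
  \<open>2 * m \<le> n\<close> keeps the amplification harmless: it contributes at most
  \<open>m * d\<^sup>2\<close> per step, as does the consistency error, and m^2 + 2 m <= (m + 1)^2
  closes the induction.\<close>

lemma iter_eq_Step:
  assumes d: "0 < d" and n: "0 < n" and nm: "real (n + m) * d \<le> \<delta>" and m: "2 * m \<le> n"
  shows "\<bar>iter d (n + m) i x - Step (real n * d) (real m * d) (iter d n) i x\<bar> \<le> consistency_const * (real m * d)\<^sup>2"
  using nm m
proof (induction m arbitrary: i x)
  case (Suc m)
  let ?n = "real n * d" and ?m = "real m * d"
  let ?t = "real (n + m) * d"
  let ?V = "Step ?n ?m (iter d n)"
  have t: "?t + d \<le> \<delta>" using Suc.prems by (simp add: algebra_simps)
  have teq: "?t = ?n + ?m" by (simp add: algebra_simps)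
  have t': "?t \<le> \<delta>" "0 < ?t" using d n t by (auto simp del: of_nat_add)
  have "0 \<le> ?m" using d by simp
  then have nle: "?n \<le> \<delta>" using t' teq by linarith
  have A: "admissible ?n (iter d n)" using iter_admissible d nle by simp
  have B: "admissible ?t (iter d (n + m))" by (rule iter_admissible) (use d t' in auto)
  have C: "admissible ?t ?V" unfolding teq using Step_admissible[OF A] d t' teq by simp
  have IH: "\<bar>iter d (n + m) i x - ?V i x\<bar> \<le> consistency_const * ?m\<^sup>2" for i x using Suc.IH[OF t'(1)] Suc.prems by simp
  have 1: "\<bar>iter d (n + Suc m) i x - Step ?t d ?V i x\<bar> \<le> consistency_const * ?m\<^sup>2 * (1 + d * (11 / 8) / ?t)"
    using Step_stable[OF B C t'(2,1) _ IH, of d i x] d by simp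
  have 2: "\<bar>Step ?n (?m + d) (iter d n) i x - Step ?t d ?V i x\<bar> \<le> consistency_const * (?m * d)"
    unfolding teq by (rule Step_consistent[OF A]) (use d t teq in auto)
  have "?m\<^sup>2 * (d * (11 / 8) / ?t) \<le> ?m * d"
  proof -
    define N where "N = real (n + m)"
    have "0 < N" using n by (simp add: N_def)
    then have "?m\<^sup>2 * (d * (11 / 8) / ?t) = ?m * d * (real m * (11 / 8) / real (n + m))"
      unfolding N_def[symmetric] using d by (simp add: power2_eq_square field_simps)
    also have "\<dots> \<le> ?m * d * 1"
    proof (rule mult_left_mono)
      have "real m * (11 / 8) \<le> real (n + m)" using Suc.prems by simp
      then show "real m * (11 / 8) / real (n + m) \<le> 1" using n by (simp add: divide_le_eq_1)
    qed (use d in auto)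
    finally show ?thesis by simp
  qed
  then have "consistency_const * ?m\<^sup>2 * (1 + d * (11 / 8) / ?t) \<le> consistency_const * (?m\<^sup>2 + ?m * d)"
    using mult_left_mono[OF _ consistency_const_nonneg] by (simp only: mult.assoc distrib_left mult_1_right add_left_mono)
  then have "\<bar>iter d (n + Suc m) i x - Step ?n (?m + d) (iter d n) i x\<bar> \<le> consistency_const * (?m\<^sup>2 + ?m * d) + consistency_const * (?m * d)"
    using 1 2 by linarith
  also have "\<dots> \<le> consistency_const * (?m + d)\<^sup>2"
    using consistency_const_nonneg d mult_nonneg_nonneg[of d "d * consistency_const"] by (simp add: power2_eq_square algebra_simps)
  finally show ?case by (simp add: algebra_simps)
qed simp

text \<open>A discrete form of the derivative 3/2 n^(1/2) of n^(3/2). With a and b the two square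
  roots, the difference of the sides is the nonnegative product
  \<open>(b - a)\<^sup>2 * (b + a / 2)\<close>.\<close>

lemma sqrt_growth: "real n * sqrt n + 3 / 2 * sqrt n \<le> real (Suc n) * sqrt (Suc n)"
proof -
  define a where "a = sqrt n"
  define b where "b = sqrt (Suc n)"
  have ab: "0 \<le> a" "a \<le> b" "a\<^sup>2 = real n" "b\<^sup>2 = a\<^sup>2 + 1" by (auto simp: a_def b_def)
  have "b * b\<^sup>2 - a * a\<^sup>2 - 3 / 2 * a * (b\<^sup>2 - a\<^sup>2) = (b - a)\<^sup>2 * (b + a / 2)"
    by (simp add: power2_eq_square field_simps)
  also have "\<dots> \<ge> 0" using ab by simp
  finally have "b * b\<^sup>2 - a * a\<^sup>2 - 3 / 2 * a \<ge> 0" using ab by simp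
  moreover have "b\<^sup>2 = real (Suc n)" by (simp add: b_def)
  ultimately have "b * real (Suc n) - a * real n - 3 / 2 * a \<ge> 0" using ab(3) by simp
  then have "real n * a + 3 / 2 * a \<le> real (Suc n) * b" by (simp add: mult.commute del: of_nat_Suc)
  then show ?thesis by (simp only: a_def b_def)
qed

text \<open>An error at step n is multiplied by 1 + (11/8) / n, and
  \<open>consistency_const * d\<^sup>2 / 4\<close> is added. The function n^(3/2) dominates this
  recursion: its increment is at least 3/2 sqrt n, the amplification uses 11/8 sqrt n of it, and the
  remaining 1/8 sqrt n exceeds the 1/32 needed for the new error, given the prefactor 8.\<close>

lemma iter_halving:
  assumes d: "0 < d" and "real n * d \<le> \<delta>"
  shows "\<bar>iter d n i x - iter (d / 2) (2 * n) i x\<bar> \<le> 8 * consistency_const * d\<^sup>2 * (real n * sqrt n)"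
  using assms(2)
proof (induction n arbitrary: i x)
  case (Suc n)
  let ?t = "real n * d"
  let ?A = "iter d n" and ?B = "iter (d / 2) (2 * n)"
  have t: "?t + d \<le> \<delta>" using Suc.prems by (simp add: algebra_simps)
  have t': "?t \<le> \<delta>" "0 \<le> ?t" using d t by auto
  have A: "admissible ?t ?A" using iter_admissible d t' by simp
  have B: "admissible ?t ?B" using iter_admissible[of "d / 2" "2 * n"] d t' by simp
  have "iter (d / 2) (2 * Suc n) = Step (?t + d / 2) (d / 2) (Step ?t (d / 2) ?B)"
    by (simp add: algebra_simps)
  moreover have "\<bar>Step ?t (d / 2 + d / 2) ?B i x - Step (?t + d / 2) (d / 2) (Step ?t (d / 2) ?B) i x\<bar> \<le> consistency_const * (d / 2 * (d / 2))"
    by (rule Step_consistent[OF B]) (use d t t' in auto)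
  ultimately have 1: "\<bar>Step ?t d ?B i x - iter (d / 2) (2 * Suc n) i x\<bar> \<le> consistency_const * (d\<^sup>2 / 4)"
    by (simp add: power2_eq_square)
  show ?case
  proof (cases "n = 0")
    \<comment> \<open>The amplification factor is singular at time 0, but the two iterates agree
      there, so only the consistency error remains.\<close>
    case True
    have "consistency_const * (d\<^sup>2 / 4) \<le> 8 * consistency_const * d\<^sup>2" using consistency_const_nonneg by simp
    then have "\<bar>Step ?t d ?B i x - iter (d / 2) (2 * Suc n) i x\<bar> \<le> 8 * consistency_const * d\<^sup>2" using 1 by linarith
    then show ?thesis using True by simp
  next
    case False
    have sq: "1 \<le> sqrt n" using False by simp
    have tpos: "0 < ?t" using d False by simp
    have "\<bar>Step ?t d ?A i x - Step ?t d ?B i x\<bar> \<le> 8 * consistency_const * d\<^sup>2 * (real n * sqrt n) * (1 + d * (11 / 8) / ?t)"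
      by (rule Step_stable[OF A B tpos t'(1)]) (use d Suc.IH[OF t'(1)] in auto)
    also have "\<dots> = 8 * consistency_const * d\<^sup>2 * (real n * sqrt n + 11 / 8 * sqrt n)"
      using d False by (simp add: field_simps)
    finally have "\<bar>Step ?t d ?A i x - iter (d / 2) (2 * Suc n) i x\<bar>
        \<le> 8 * consistency_const * d\<^sup>2 * (real n * sqrt n + 11 / 8 * sqrt n) + consistency_const * (d\<^sup>2 / 4)" using 1 by linarith
    also have "\<dots> = 8 * consistency_const * d\<^sup>2 * (real n * sqrt n + 11 / 8 * sqrt n + 1 / 32)" by (simp add: algebra_simps)
    also have "\<dots> \<le> 8 * consistency_const * d\<^sup>2 * (real (Suc n) * sqrt (Suc n))"
    proof (rule mult_left_mono)
      show "real n * sqrt n + 11 / 8 * sqrt n + 1 / 32 \<le> real (Suc n) * sqrt (Suc n)"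
        using sqrt_growth[of n] sq by linarith
    qed (use consistency_const_nonneg in auto)
    finally show ?thesis by simp
  qed
qed simp

end

section \<open>The limit of the scheme\<close>

lemma geometric_Cauchy_limit:
  fixes f :: "nat \<Rightarrow> real"
  assumes step: "\<And>k. \<bar>f k - f (Suc k)\<bar> \<le> M * q ^ k" and q: "0 \<le> q" "q < 1"
  shows "convergent f" "\<bar>f k - lim f\<bar> \<le> M / (1 - q) * q ^ k"
proof -
  define M' where "M' = M / (1 - q)"
  have M0: "0 \<le> M" using order_trans[OF abs_ge_zero step[of 0]] by simp
  then have M'0: "0 \<le> M'" using q by (simp add: M'_def)
  have halving_const: "M = M' * (1 - q)" using q by (simp add: M'_def)
  have diff: "\<bar>f m - f (m + n)\<bar> \<le> M' * (q ^ m - q ^ (m + n))" for m n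
  proof (induction n)
    case (Suc n)
    have "\<bar>f m - f (m + Suc n)\<bar> \<le> M' * (q ^ m - q ^ (m + n)) + M * q ^ (m + n)"
      using Suc step[of "m + n"] by simp
    also have "\<dots> = M' * (q ^ m - q ^ (m + Suc n))" unfolding halving_const by (simp add: algebra_simps)
    finally show ?case .
  qed simp
  have bnd: "\<bar>f m - f n\<bar> \<le> M' * q ^ m" if "m \<le> n" for m n
  proof -
    have "\<bar>f m - f n\<bar> \<le> M' * (q ^ m - q ^ n)" using diff[of m "n - m"] that by simp
    also have "\<dots> \<le> M' * q ^ m" using M'0 q by (intro mult_left_mono) auto
    finally show ?thesis .
  qed
  have tend: "(\<lambda>n. M' * q ^ n) \<longlonglongrightarrow> 0"
    using tendsto_mult[OF tendsto_const LIMSEQ_power_zero[of q]] q by fastforce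
  have "Cauchy f"
  proof (rule metric_CauchyI)
    fix e :: real assume "e > 0"
    then have "\<forall>\<^sub>F n in sequentially. M' * q ^ n < e / 2" using order_tendstoD(2)[OF tend, of "e / 2"] by simp
    then obtain N where N: "M' * q ^ N < e / 2" by (auto simp: eventually_sequentially)
    have "dist (f m) (f n) < e" if "m \<ge> N" "n \<ge> N" for m n
      using bnd[OF that(1)] bnd[OF that(2)] N unfolding dist_real_def by linarith
    then show "\<exists>N. \<forall>m\<ge>N. \<forall>n\<ge>N. dist (f m) (f n) < e" by blast
  qed
  then show conv: "convergent f" by (simp add: Cauchy_convergent)
  then have "f \<longlonglongrightarrow> lim f" by (simp add: convergent_LIMSEQ_iff)
  then have "(\<lambda>n. \<bar>f k - f n\<bar>) \<longlonglongrightarrow> \<bar>f k - lim f\<bar>" by (intro tendsto_intros)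
  moreover have "\<forall>\<^sub>F n in sequentially. \<bar>f k - f n\<bar> \<le> M' * q ^ k"
    using eventually_ge_at_top[of k] by eventually_elim (rule bnd)
  ultimately show "\<bar>f k - lim f\<bar> \<le> M / (1 - q) * q ^ k"
    unfolding M'_def by (rule tendsto_upperbound) simp
qed

section \<open>Convergence of the dyadic schemes\<close>

context transport_scheme
begin

text \<open>The mesh is halved at each level so that \<open>iter_halving\<close> relates consecutive
  approximations.\<close>

definition mesh :: "nat \<Rightarrow> real" where "mesh k = \<delta> / 2 ^ k"
definition ind :: "nat \<Rightarrow> real \<Rightarrow> nat" where "ind k t = nat \<lfloor>t / mesh k\<rfloor>"
definition app :: "nat \<Rightarrow> real \<Rightarrow> nat \<Rightarrow> real \<Rightarrow> real" where "app k t = iter (mesh k) (ind k t)"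

lemma mesh_pos: "0 < mesh k" using delta by (simp add: mesh_def)

lemma mesh_Suc: "mesh (Suc k) = mesh k / 2" by (simp add: mesh_def)

lemma mesh_tendsto: "mesh \<longlonglongrightarrow> 0"
proof -
  have "(\<lambda>k. \<delta> * (1 / 2) ^ k) \<longlonglongrightarrow> \<delta> * 0"
    by (intro tendsto_intros LIMSEQ_power_zero) simp
  then show ?thesis by (simp add: mesh_def[abs_def] power_divide)
qed

lemma ind_bounds:
  assumes "0 \<le> t"
  shows "real (ind k t) * mesh k \<le> t" "t < (real (ind k t) + 1) * mesh k"
proof -
  have "0 \<le> t / mesh k" using assms mesh_pos[of k] by simp
  then have "real (ind k t) \<le> t / mesh k" "t / mesh k < real (ind k t) + 1"
    unfolding ind_def by (auto simp: of_nat_nat)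
  then show "real (ind k t) * mesh k \<le> t" "t < (real (ind k t) + 1) * mesh k"
    using mesh_pos[of k] by (auto simp: pos_le_divide_eq pos_divide_less_eq)
qed

lemma ind_mono: "t \<le> t' \<Longrightarrow> ind k t \<le> ind k t'"
  unfolding ind_def using mesh_pos[of k] by (intro nat_mono floor_mono divide_right_mono) auto

lemma ind_Suc: "0 \<le> t \<Longrightarrow> ind (Suc k) t = 2 * ind k t \<or> ind (Suc k) t = 2 * ind k t + 1"
proof -
  assume t: "0 \<le> t"
  have "real (ind (Suc k) t) * (mesh k / 2) \<le> t" "t < (real (ind (Suc k) t) + 1) * (mesh k / 2)"
    "real (ind k t) * mesh k \<le> t" "t < (real (ind k t) + 1) * mesh k"
    using ind_bounds[OF t, of "Suc k"] ind_bounds[OF t, of k] unfolding mesh_Suc by auto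
  then have "real (ind (Suc k) t) * (mesh k / 2) < (real (ind k t) + 1) * mesh k"
    "real (ind k t) * mesh k < (real (ind (Suc k) t) + 1) * (mesh k / 2)" by linarith+
  then have "real (ind (Suc k) t) * mesh k < (2 * real (ind k t) + 2) * mesh k"
    "(2 * real (ind k t)) * mesh k < (real (ind (Suc k) t) + 1) * mesh k" by (auto simp: algebra_simps)
  then have "real (ind (Suc k) t) < 2 * real (ind k t) + 2" "2 * real (ind k t) < real (ind (Suc k) t) + 1"
    using mesh_pos[of k] by (auto simp: mult_less_cancel_right_pos)
  then show ?thesis by linarith
qed

lemma ind_tendsto: "0 \<le> t \<Longrightarrow> (\<lambda>k. real (ind k t) * mesh k) \<longlonglongrightarrow> t"
proof (rule tendsto_sandwich[where f = "\<lambda>k. t - mesh k" and h = "\<lambda>k. t"])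
  assume t: "0 \<le> t"
  show "\<forall>\<^sub>F k in sequentially. t - mesh k \<le> real (ind k t) * mesh k"
    using ind_bounds(2)[OF t] by (simp add: algebra_simps less_imp_le)
  show "\<forall>\<^sub>F k in sequentially. real (ind k t) * mesh k \<le> t" using ind_bounds(1)[OF t] by simp
  have "(\<lambda>k. t - mesh k) \<longlonglongrightarrow> t - 0" by (intro tendsto_intros mesh_tendsto)
  then show "(\<lambda>k. t - mesh k) \<longlonglongrightarrow> t" by simp
qed simp

lemma app_admissible:
  assumes "0 \<le> t" "t \<le> \<delta>"
  shows "admissible (real (ind k t) * mesh k) (app k t)"
  unfolding app_def by (rule iter_admissible) (use mesh_pos[of k] ind_bounds(1)[OF assms(1), of k] assms in auto)

definition halving_const :: real where "halving_const = 8 * consistency_const + (K1 * L + 2 * K)"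

text \<open>The grid index at the finer level is twice the coarser one, possibly plus 1. The first
  case is \<open>iter_halving\<close>, the second costs one extra half step. The error bound is
  geometric because d^2 n^(3/2) = sqrt d (n d)^(3/2) is at most sqrt d.\<close>

lemma app_step:
  assumes t: "0 \<le> t" "t \<le> \<delta>"
  shows "\<bar>app k t i x - app (Suc k) t i x\<bar> \<le> halving_const * sqrt (1 / 2) ^ k"
proof -
  let ?d = "mesh k" and ?n = "ind k t"
  let ?q = "sqrt (1 / 2) ^ k"
  have d: "0 < ?d" by (rule mesh_pos)
  have nd: "real ?n * ?d \<le> \<delta>" "real ?n * ?d \<le> 1" using ind_bounds(1)[OF t(1), of k] t delta by auto
  have dq: "sqrt ?d \<le> ?q"
  proof -
    have "?d \<le> 1 / 2 ^ k" using delta by (simp add: mesh_def divide_right_mono)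
    then have "sqrt ?d \<le> sqrt ((1 / 2) ^ k)" by (intro real_sqrt_le_mono) (simp add: power_divide)
    then show ?thesis by (simp add: real_sqrt_power)
  qed
  have d1: "?d \<le> 1" using delta by (simp add: mesh_def divide_le_eq_1 order_trans[OF delta(2)])
  then have "?d \<le> sqrt ?d" using d by (simp add: real_le_rsqrt power2_eq_square mult_left_le)
  with dq have dq': "?d \<le> ?q" by simp
  have "?d\<^sup>2 * (real ?n * sqrt ?n) = sqrt ?d * ((real ?n * ?d) * sqrt (real ?n * ?d))"
    using d by (simp add: power2_eq_square real_sqrt_mult)
  also have "\<dots> \<le> sqrt ?d * 1"
  proof (rule mult_left_mono)
    show "real ?n * ?d * sqrt (real ?n * ?d) \<le> 1"
      by (rule mult_le_one) (use nd d in \<open>auto simp: real_sqrt_le_1_iff\<close>)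
  qed (use d in auto)
  finally have key: "?d\<^sup>2 * (real ?n * sqrt ?n) \<le> ?q" using dq by simp
  have "\<bar>app k t i x - iter (?d / 2) (2 * ?n) i x\<bar> \<le> 8 * consistency_const * ?d\<^sup>2 * (real ?n * sqrt ?n)"
    unfolding app_def by (rule iter_halving[OF d nd(1)])
  also have "\<dots> = 8 * consistency_const * (?d\<^sup>2 * (real ?n * sqrt ?n))" by simp
  also have "\<dots> \<le> 8 * consistency_const * ?q" using key consistency_const_nonneg by (intro mult_left_mono) auto
  finally have 1: "\<bar>app k t i x - iter (?d / 2) (2 * ?n) i x\<bar> \<le> 8 * consistency_const * ?q" .
  have C: "0 \<le> K1 * L + 2 * K" using nonneg by simp
  have 2: "\<bar>app (Suc k) t i x - iter (?d / 2) (2 * ?n) i x\<bar> \<le> (K1 * L + 2 * K) * ?q"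
  proof (cases "ind (Suc k) t = 2 * ?n")
    case True
    then show ?thesis using C by (simp add: app_def mesh_Suc)
  next
    case False
    then have e: "ind (Suc k) t = 2 * ?n + 1" using ind_Suc[OF t(1)] by blast
    have "real (2 * ?n + 1) * (?d / 2) \<le> \<delta>" using ind_bounds(1)[OF t(1), of "Suc k"] t e by (simp add: mesh_Suc)
    from iter_time_lip[OF _ this, of i x] d
    have "\<bar>app (Suc k) t i x - iter (?d / 2) (2 * ?n) i x\<bar> \<le> (?d / 2) * (K1 * L + 2 * K)"
      by (simp add: app_def mesh_Suc e)
    also have "\<dots> \<le> ?q * (K1 * L + 2 * K)" using dq' d C by (intro mult_right_mono) auto
    finally show ?thesis by (simp add: mult.commute)
  qed
  have "\<bar>app k t i x - app (Suc k) t i x\<bar> \<le> 8 * consistency_const * ?q + (K1 * L + 2 * K) * ?q" using 1 2 by linarith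
  then show ?thesis by (simp add: halving_const_def distrib_right)
qed

definition sol :: "real \<Rightarrow> nat \<Rightarrow> real \<Rightarrow> real" where "sol t i x = lim (\<lambda>k. app k t i x)"

definition err :: "nat \<Rightarrow> real" where "err k = halving_const / (1 - sqrt (1 / 2)) * sqrt (1 / 2) ^ k"

lemma err_tendsto: "err \<longlonglongrightarrow> 0"
proof -
  have "(\<lambda>k. halving_const / (1 - sqrt (1 / 2)) * sqrt (1 / 2) ^ k) \<longlonglongrightarrow> halving_const / (1 - sqrt (1 / 2)) * 0"
    by (intro tendsto_intros LIMSEQ_power_zero) simp
  then show ?thesis by (simp add: err_def[abs_def])
qed

lemma app_sol:
  assumes "0 \<le> t" "t \<le> \<delta>"
  shows "\<bar>app k t i x - sol t i x\<bar> \<le> err k"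
  unfolding sol_def err_def by (rule geometric_Cauchy_limit(2)[OF app_step[OF assms]]) auto

lemma app_tendsto:
  assumes "0 \<le> t" "t \<le> \<delta>"
  shows "(\<lambda>k. app k t i x) \<longlonglongrightarrow> sol t i x"
proof -
  have "(\<lambda>k. app k t i x - sol t i x) \<longlonglongrightarrow> 0"
    by (rule Lim_null_comparison[OF _ err_tendsto]) (simp add: app_sol[OF assms])
  then show ?thesis by (rule LIM_zero_cancel)
qed

lemma sol_admissible:
  assumes t: "0 \<le> t" "t \<le> \<delta>"
  shows "admissible t (sol t)"
  unfolding admissible_def
proof (intro conjI allI)
  note tt = app_tendsto[OF t] ind_tendsto[OF t(1)]
  fix i x z k
  show "\<bar>sol t i x\<bar> \<le> K * t\<^sup>2"
    by (rule tendsto_le[of sequentially "\<lambda>k. K * (real (ind k t) * mesh k)\<^sup>2" _ "\<lambda>k. \<bar>app k t i x\<bar>"])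
       (auto intro!: tendsto_intros tt always_eventually admissibleD[OF app_admissible[OF t]])
  show "\<bar>sol t i x - sol t i z\<bar> \<le> K1 * t\<^sup>2 * \<bar>x - z\<bar>"
    by (rule tendsto_le[of sequentially "\<lambda>k. K1 * (real (ind k t) * mesh k)\<^sup>2 * \<bar>x - z\<bar>" _ "\<lambda>k. \<bar>app k t i x - app k t i z\<bar>"])
       (auto intro!: tendsto_intros tt always_eventually admissibleD[OF app_admissible[OF t]])
  show "\<bar>sol t i (x + k) + sol t i (x - k) - 2 * sol t i x\<bar> \<le> K2 * t\<^sup>2 * k\<^sup>2"
    by (rule tendsto_le[of sequentially "\<lambda>n. K2 * (real (ind n t) * mesh n)\<^sup>2 * k\<^sup>2" _
          "\<lambda>n. \<bar>app n t i (x + k) + app n t i (x - k) - 2 * app n t i x\<bar>"])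
       (auto intro!: tendsto_intros tt always_eventually admissibleD[OF app_admissible[OF t]])
qed

lemma sol_time_lip_le:
  assumes t: "0 \<le> t" "t \<le> t'" "t' \<le> \<delta>"
  shows "\<bar>sol t' i x - sol t i x\<bar> \<le> (t' - t) * (K1 * L + 2 * K)"
proof (rule tendsto_le)
  let ?m = "\<lambda>k. ind k t' - ind k t"
  show "(\<lambda>k. (real (ind k t') * mesh k - real (ind k t) * mesh k) * (K1 * L + 2 * K))
      \<longlonglongrightarrow> (t' - t) * (K1 * L + 2 * K)"
    using t by (intro tendsto_intros ind_tendsto) auto
  show "(\<lambda>k. \<bar>app k t' i x - app k t i x\<bar>) \<longlonglongrightarrow> \<bar>sol t' i x - sol t i x\<bar>"
    using t by (intro tendsto_intros app_tendsto) auto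
  have "\<bar>app k t' i x - app k t i x\<bar> \<le> (real (ind k t') * mesh k - real (ind k t) * mesh k) * (K1 * L + 2 * K)" for k
  proof -
    have e: "ind k t + ?m k = ind k t'" using ind_mono[OF t(2), of k] by simp
    have "real (ind k t') * mesh k \<le> \<delta>" using ind_bounds(1)[of t' k] t by auto
    then have "\<bar>iter (mesh k) (ind k t + ?m k) i x - iter (mesh k) (ind k t) i x\<bar> \<le> real (?m k) * mesh k * (K1 * L + 2 * K)"
      using mesh_pos[of k] by (intro iter_time_lip) (auto simp only: e less_imp_le)
    then show ?thesis unfolding e app_def using ind_mono[OF t(2), of k] by (simp add: of_nat_diff algebra_simps)
  qed
  then show "\<forall>\<^sub>F k in sequentially. \<bar>app k t' i x - app k t i x\<bar>
      \<le> (real (ind k t') * mesh k - real (ind k t) * mesh k) * (K1 * L + 2 * K)" by simp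
qed simp

lemma sol_time_lip:
  assumes "0 \<le> t" "t \<le> \<delta>" "0 \<le> t'" "t' \<le> \<delta>"
  shows "\<bar>sol t' i x - sol t i x\<bar> \<le> \<bar>t' - t\<bar> * (K1 * L + 2 * K)"
proof (cases "t \<le> t'")
  case True
  then show ?thesis using sol_time_lip_le[of t t' i x] assms by simp
next
  case False
  then show ?thesis using sol_time_lip_le[of t' t i x] assms by (simp add: abs_minus_commute)
qed

text \<open>The approximation is evaluated at foot points that vary with k; the error bound
  \<open>err\<close>, uniform in x, and the Lipschitz bound of \<open>sol\<close> handle this. The
  restriction to t > 0 makes the division by the square of the grid time continuous in the
  limit.\<close>

lemma Step_app_tendsto:
  assumes t: "0 < t" "t \<le> \<delta>" and s: "sk \<longlonglongrightarrow> s"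
  shows "(\<lambda>k. Step (real (ind k t) * mesh k) (sk k) (app k t) i x) \<longlonglongrightarrow> Step t s (sol t) i x"
proof -
  define tk where "tk k = real (ind k t) * mesh k" for k
  have t0: "0 \<le> t" using t by simp
  have tk: "tk \<longlonglongrightarrow> t" unfolding tk_def by (rule ind_tendsto[OF t0])
  have tkr: "0 \<le> tk k" "tk k \<le> \<delta>" for k
    using ind_bounds(1)[OF t0, of k] t mesh_pos[of k] by (auto simp: tk_def)
  define yk where "yk k j = app k t j x / (tk k)\<^sup>2" for k j
  define y where "y j = sol t j x / t\<^sup>2" for j
  have adm: "admissible (tk k) (app k t)" for k unfolding tk_def by (rule app_admissible[OF t0 t(2)])
  have boxk: "\<bar>yk k j\<bar> \<le> K" for k j unfolding yk_def by (rule admissible_scaled(1)[OF adm])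
  have box: "\<bar>y j\<bar> \<le> K" for j unfolding y_def by (rule admissible_scaled(1)[OF sol_admissible[OF t0 t(2)]])
  \<comment> \<open>For small k the grid time \<open>tk k\<close> may be 0. The bounds
    \<open>e1\<close> to \<open>e3\<close> hold even then, with vanishing quotients, and only the
    limit of e matters.\<close>
  define e where "e k = \<bar>tk k - t\<bar> + (err k / (tk k)\<^sup>2 + K * t\<^sup>2 * \<bar>1 / (tk k)\<^sup>2 - 1 / t\<^sup>2\<bar>)" for k
  have "e \<longlonglongrightarrow> \<bar>t - t\<bar> + (0 / t\<^sup>2 + K * t\<^sup>2 * \<bar>1 / t\<^sup>2 - 1 / t\<^sup>2\<bar>)"
    unfolding e_def using t by (intro tendsto_intros tk err_tendsto) auto
  then have e: "e \<longlonglongrightarrow> 0" by simp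
  have err0: "0 \<le> err k" for k using order_trans[OF abs_ge_zero app_sol[OF t0 t(2)]] .
  have e1: "\<bar>tk k - t\<bar> \<le> e k" for k
    unfolding e_def using err0[of k] nonneg by simp
  have e2: "\<bar>x - x\<bar> \<le> e k" for k using e1[of k] by simp
  have e3: "\<bar>yk k j - y j\<bar> \<le> e k" for k j
  proof -
    have "yk k j - y j = (app k t j x - sol t j x) / (tk k)\<^sup>2 + sol t j x * (1 / (tk k)\<^sup>2 - 1 / t\<^sup>2)"
      by (simp add: yk_def y_def diff_divide_distrib algebra_simps)
    then have "\<bar>yk k j - y j\<bar> \<le> \<bar>(app k t j x - sol t j x) / (tk k)\<^sup>2\<bar> + \<bar>sol t j x * (1 / (tk k)\<^sup>2 - 1 / t\<^sup>2)\<bar>"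
      by (simp only: abs_triangle_ineq)
    also have "\<dots> \<le> err k / (tk k)\<^sup>2 + K * t\<^sup>2 * \<bar>1 / (tk k)\<^sup>2 - 1 / t\<^sup>2\<bar>"
      unfolding abs_mult abs_divide using app_sol[OF t0 t(2), of k j x] admissibleD(1)[OF sol_admissible[OF t0 t(2)], of j x]
      by (intro add_mono mult_right_mono) (auto intro: divide_right_mono)
    finally show ?thesis by (simp add: e_def)
  qed
  have Le: "(\<lambda>k. L * e k) \<longlonglongrightarrow> 0" using tendsto_mult[OF tendsto_const e, of L] by simp
  have la: "(\<lambda>k. l i (tk k) x (yk k)) \<longlonglongrightarrow> l i t x y"
    by (rule LIM_zero_cancel, rule Lim_null_comparison[OF _ Le])
       (simp add: l_lip[OF tkr t0 t(2) boxk box e1 e2 e3])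
  have ha: "(\<lambda>k. h i (tk k) x (yk k)) \<longlonglongrightarrow> h i t x y"
    by (rule LIM_zero_cancel, rule Lim_null_comparison[OF _ Le])
       (simp add: h_lip[OF tkr t0 t(2) boxk box e1 e2 e3])
  define zk where "zk k = x - sk k * tk k * l i (tk k) x (yk k)" for k
  define z where "z = x - s * t * l i t x y"
  have zk: "zk \<longlonglongrightarrow> z" unfolding zk_def z_def by (intro tendsto_intros s tk la)
  have "(\<lambda>k. app k t i (zk k) - sol t i z) \<longlonglongrightarrow> 0"
  proof (rule Lim_null_comparison)
    have "\<bar>app k t i (zk k) - sol t i z\<bar> \<le> err k + K1 * t\<^sup>2 * \<bar>zk k - z\<bar>" for k
      using app_sol[OF t0 t(2), of k i "zk k"] admissibleD(2)[OF sol_admissible[OF t0 t(2)], of i "zk k" z] by linarith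
    then show "\<forall>\<^sub>F k in sequentially. norm (app k t i (zk k) - sol t i z) \<le> err k + K1 * t\<^sup>2 * \<bar>zk k - z\<bar>" by simp
    have "(\<lambda>k. err k + K1 * t\<^sup>2 * \<bar>zk k - z\<bar>) \<longlonglongrightarrow> 0 + K1 * t\<^sup>2 * \<bar>z - z\<bar>"
      by (intro tendsto_intros err_tendsto zk)
    then show "(\<lambda>k. err k + K1 * t\<^sup>2 * \<bar>zk k - z\<bar>) \<longlonglongrightarrow> 0" by simp
  qed
  then have "(\<lambda>k. app k t i (zk k)) \<longlonglongrightarrow> sol t i z" by (rule LIM_zero_cancel)
  then have "(\<lambda>k. app k t i (zk k) + sk k * tk k * h i (tk k) x (yk k)) \<longlonglongrightarrow> sol t i z + s * t * h i t x y"
    by (intro tendsto_intros s tk ha)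
  then show ?thesis unfolding Step_def zk_def z_def tk_def[symmetric] yk_def[abs_def] y_def[abs_def] .
qed

text \<open>This is the limit of \<open>iter_eq_Step\<close>, applied between the grid indices of t
  and t + s.\<close>

lemma sol_Step:
  assumes t: "0 < t" and s: "0 \<le> s" "s \<le> t / 4" and ts: "t + s \<le> \<delta>"
  shows "\<bar>sol (t + s) i x - Step t s (sol t) i x\<bar> \<le> consistency_const * s\<^sup>2"
proof (rule tendsto_le)
  define sk where "sk k = real (ind k (t + s)) * mesh k - real (ind k t) * mesh k" for k
  have "sk \<longlonglongrightarrow> (t + s) - t" unfolding sk_def using t s by (intro tendsto_intros ind_tendsto) auto
  then have sk: "sk \<longlonglongrightarrow> s" by simp
  have tk: "(\<lambda>k. real (ind k t) * mesh k) \<longlonglongrightarrow> t" using t by (intro ind_tendsto) auto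
  show "(\<lambda>k. consistency_const * (sk k)\<^sup>2) \<longlonglongrightarrow> consistency_const * s\<^sup>2" by (intro tendsto_intros sk)
  show "(\<lambda>k. \<bar>app k (t + s) i x - Step (real (ind k t) * mesh k) (sk k) (app k t) i x\<bar>)
      \<longlonglongrightarrow> \<bar>sol (t + s) i x - Step t s (sol t) i x\<bar>"
    using t s ts by (intro tendsto_intros app_tendsto Step_app_tendsto sk) auto
  \<comment> \<open>The limit \<open>2 * s - t\<close> is strictly negative because s is at most t /
    4. Hence the number m of steps between the two indices eventually satisfies
    \<open>2 * m \<le> n\<close>.\<close>
  have "(\<lambda>k. 2 * sk k - real (ind k t) * mesh k) \<longlonglongrightarrow> 2 * s - t" by (intro tendsto_intros sk tk)
  then have "\<forall>\<^sub>F k in sequentially. 2 * sk k - real (ind k t) * mesh k < 0"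
    by (rule order_tendstoD(2)) (use s t in linarith)
  moreover have "\<forall>\<^sub>F k in sequentially. 0 < real (ind k t) * mesh k" by (rule order_tendstoD(1)[OF tk t])
  ultimately show "\<forall>\<^sub>F k in sequentially. \<bar>app k (t + s) i x - Step (real (ind k t) * mesh k) (sk k) (app k t) i x\<bar> \<le> consistency_const * (sk k)\<^sup>2"
  proof eventually_elim
    case (elim k)
    define m where "m = ind k (t + s) - ind k t"
    have e: "ind k (t + s) = ind k t + m" using ind_mono[of t "t + s" k] s by (simp add: m_def)
    have skm: "sk k = real m * mesh k" unfolding sk_def e by (simp add: algebra_simps)
    have "(2 * real m) * mesh k < real (ind k t) * mesh k" using elim(1) by (simp add: skm)
    then have "2 * real m < real (ind k t)" using mesh_pos[of k] by (simp add: mult_less_cancel_right_pos)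
    then have m2: "2 * m \<le> ind k t" by linarith
    have "0 < ind k t" using elim(2) by (cases "ind k t") auto
    moreover have "real (ind k t + m) * mesh k \<le> \<delta>" using ind_bounds(1)[of "t + s" k] t s ts e by (simp del: of_nat_add)
    ultimately show ?case using iter_eq_Step[OF mesh_pos _ _ m2, of k i x] by (simp add: app_def e skm)
  qed
qed simp

section \<open>Differentiability of the limit\<close>

lemma solx_exists:
  "\<exists>Wx. \<forall>i t x k. 0 \<le> t \<and> t \<le> \<delta> \<longrightarrow> \<bar>sol t i (x + k) - sol t i x - k * Wx i t x\<bar> \<le> 2 * (K2 + 1) * k\<^sup>2"
proof -
  have "\<exists>f'. \<forall>x k. \<bar>sol t i (x + k) - sol t i x - k * f' x\<bar> \<le> 2 * (K2 + 1) * k\<^sup>2"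
    if t: "0 \<le> t" "t \<le> \<delta>" for i t
  proof (rule second_difference_imp_differentiable)
    note A = sol_admissible[OF t]
    have "(K1 * t\<^sup>2)-lipschitz_on UNIV (sol t i)"
      by (rule lipschitz_onI) (use admissibleD(2)[OF A, of i] nonneg in \<open>auto simp: dist_real_def\<close>)
    then show "continuous_on UNIV (sol t i)" by (rule lipschitz_on_continuous_on)
    \<comment> \<open>\<open>K2\<close> may be 0, whereas the differentiability lemma asks for a
      positive constant.\<close>
    show "K2 + 1 > 0" using nonneg by simp
    fix x k
    have "\<bar>sol t i (x + k) + sol t i (x - k) - 2 * sol t i x\<bar> \<le> K2 * t\<^sup>2 * k\<^sup>2" by (rule admissibleD(3)[OF A])
    also have "\<dots> \<le> (K2 + 1) * k\<^sup>2"
      using nonneg t delta power_le_one[of t 2] by (intro mult_right_mono) (auto simp: mult_left_le add_increasing2)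
    finally show "\<bar>sol t i (x + k) + sol t i (x - k) - 2 * sol t i x\<bar> \<le> (K2 + 1) * k\<^sup>2" .
  qed
  then have "\<forall>i t. \<exists>f'. 0 \<le> t \<and> t \<le> \<delta> \<longrightarrow> (\<forall>x k. \<bar>sol t i (x + k) - sol t i x - k * f' x\<bar> \<le> 2 * (K2 + 1) * k\<^sup>2)"
    by blast
  then obtain Wx where "\<And>i t. 0 \<le> t \<and> t \<le> \<delta> \<longrightarrow>
      (\<forall>x k. \<bar>sol t i (x + k) - sol t i x - k * Wx i t x\<bar> \<le> 2 * (K2 + 1) * k\<^sup>2)" by metis
  then show ?thesis by blast
qed

definition solx :: "nat \<Rightarrow> real \<Rightarrow> real \<Rightarrow> real" where
  "solx = (SOME Wx. \<forall>i t x k. 0 \<le> t \<and> t \<le> \<delta> \<longrightarrow>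
      \<bar>sol t i (x + k) - sol t i x - k * Wx i t x\<bar> \<le> 2 * (K2 + 1) * k\<^sup>2)"

lemma solx:
  assumes "0 \<le> t" "t \<le> \<delta>"
  shows "\<bar>sol t i (x + k) - sol t i x - k * solx i t x\<bar> \<le> 2 * (K2 + 1) * k\<^sup>2"
  using someI_ex[OF solx_exists] assms unfolding solx_def by blast

text \<open>The equation is solved for the time derivative. That this expression really is the
  derivative is shown in \<open>sol_C1\<close>.\<close>

definition solt :: "nat \<Rightarrow> real \<Rightarrow> real \<Rightarrow> real" where
  "solt i t x = t * h i t x (\<lambda>j. sol t j x / t\<^sup>2) - t * l i t x (\<lambda>j. sol t j x / t\<^sup>2) * solx i t x"

lemma sol_lip:
  assumes "p \<in> strip \<delta>" "q \<in> strip \<delta>"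
  shows "\<bar>sol (fst p) i (snd p) - sol (fst q) i (snd q)\<bar> \<le> (K1 * L + 2 * K + K1) * dist p q"
proof -
  have p: "0 \<le> fst p" "fst p \<le> \<delta>" and q: "0 \<le> fst q" "fst q \<le> \<delta>" using assms by (auto simp: strip_def)
  have d: "\<bar>fst p - fst q\<bar> \<le> dist p q" "\<bar>snd p - snd q\<bar> \<le> dist p q"
    using dist_fst_le[of p q] dist_snd_le[of p q] by (auto simp: dist_real_def)
  have "\<bar>sol (fst p) i (snd p) - sol (fst q) i (snd p)\<bar> \<le> \<bar>fst p - fst q\<bar> * (K1 * L + 2 * K)"
    by (rule sol_time_lip) (use p q in auto)
  also have "\<dots> \<le> dist p q * (K1 * L + 2 * K)" using d nonneg by (intro mult_right_mono) auto
  finally have 1: "\<bar>sol (fst p) i (snd p) - sol (fst q) i (snd p)\<bar> \<le> dist p q * (K1 * L + 2 * K)" .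
  have "\<bar>sol (fst q) i (snd p) - sol (fst q) i (snd q)\<bar> \<le> K1 * (fst q)\<^sup>2 * \<bar>snd p - snd q\<bar>"
    by (rule admissibleD(2)[OF sol_admissible[OF q]])
  also have "\<dots> \<le> K1 * 1 * dist p q"
    using d nonneg q delta power_le_one[of "fst q" 2] by (intro mult_mono mult_left_mono) auto
  finally show ?thesis using 1 by (simp add: algebra_simps)
qed

lemma sol_continuous: "continuous_on (strip \<delta>) (\<lambda>p. sol (fst p) i (snd p))"
proof -
  have "(K1 * L + 2 * K + K1)-lipschitz_on (strip \<delta>) (\<lambda>p. sol (fst p) i (snd p))"
    by (rule lipschitz_onI) (use sol_lip nonneg in \<open>auto simp: dist_real_def\<close>)
  then show ?thesis by (rule lipschitz_on_continuous_on)
qed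

text \<open>The quadratic remainder in \<open>solx\<close> makes the difference quotients with step
  1 / (n + 1) converge uniformly on the strip.\<close>

lemma solx_continuous: "continuous_on (strip \<delta>) (\<lambda>p. solx i (fst p) (snd p))"
proof (rule uniform_limit_theorem)
  let ?D = "\<lambda>n p. (sol (fst p) i (snd p + inverse (real (Suc n))) - sol (fst p) i (snd p)) / inverse (real (Suc n))"
  have sh: "continuous_on (strip \<delta>) (\<lambda>p. sol (fst p) i (snd p + a))" for a
  proof -
    have "continuous_on (strip \<delta>) ((\<lambda>p. sol (fst p) i (snd p)) \<circ> (\<lambda>p. (fst p, snd p + a)))"
      by (intro continuous_on_compose continuous_on_subset[OF sol_continuous] continuous_intros)
         (auto simp: strip_def)
    then show ?thesis by (simp add: o_def)
  qed
  show "\<forall>\<^sub>F n in sequentially. continuous_on (strip \<delta>) (?D n)"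
    by (intro always_eventually allI continuous_intros sh sol_continuous) auto
  show "uniform_limit (strip \<delta>) ?D (\<lambda>p. solx i (fst p) (snd p)) sequentially"
  proof (rule uniform_limitI)
    fix e :: real assume e: "e > 0"
    have "(\<lambda>n. 2 * (K2 + 1) * inverse (real (Suc n))) \<longlonglongrightarrow> 2 * (K2 + 1) * 0"
      by (intro tendsto_intros LIMSEQ_inverse_real_of_nat)
    then have "\<forall>\<^sub>F n in sequentially. 2 * (K2 + 1) * inverse (real (Suc n)) < e"
      using e by (intro order_tendstoD(2)) auto
    then show "\<forall>\<^sub>F n in sequentially. \<forall>p\<in>strip \<delta>. dist (?D n p) (solx i (fst p) (snd p)) < e"
    proof eventually_elim
      case (elim n)
      show ?case
      proof
        fix p assume p: "p \<in> strip \<delta>"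
        define k where "k = inverse (real (Suc n))"
        have k: "k > 0" by (simp add: k_def)
        have "\<bar>sol (fst p) i (snd p + k) - sol (fst p) i (snd p) - k * solx i (fst p) (snd p)\<bar> \<le> 2 * (K2 + 1) * k\<^sup>2"
          by (rule solx) (use p in \<open>auto simp: strip_def\<close>)
        moreover have "sol (fst p) i (snd p + k) - sol (fst p) i (snd p) - k * solx i (fst p) (snd p)
            = k * ((sol (fst p) i (snd p + k) - sol (fst p) i (snd p)) / k - solx i (fst p) (snd p))"
          using k by (simp add: field_simps)
        ultimately have "k * \<bar>(sol (fst p) i (snd p + k) - sol (fst p) i (snd p)) / k - solx i (fst p) (snd p)\<bar> \<le> k * (2 * (K2 + 1) * k)"
          using k by (simp add: abs_mult power2_eq_square mult_ac)
        then have "\<bar>(sol (fst p) i (snd p + k) - sol (fst p) i (snd p)) / k - solx i (fst p) (snd p)\<bar> \<le> 2 * (K2 + 1) * k"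
          using k by (rule mult_left_le_imp_le)
        also have "\<dots> < e" using elim by (simp add: k_def)
        finally show "dist (?D n p) (solx i (fst p) (snd p)) < e" by (simp add: dist_real_def k_def)
      qed
    qed
  qed
qed simp

lemma solx_bound:
  assumes t: "0 \<le> t" "t \<le> \<delta>"
  shows "\<bar>solx i t x\<bar> \<le> K1 + 2 * (K2 + 1)"
proof -
  have "\<bar>sol t i (x + 1) - sol t i x\<bar> \<le> K1 * t\<^sup>2 * \<bar>(x + 1) - x\<bar>" by (rule admissibleD(2)[OF sol_admissible[OF t]])
  also have "\<dots> \<le> K1" using nonneg t delta power_le_one[of t 2] by (simp add: mult_left_le)
  finally show ?thesis using solx[OF t, of i x 1] by simp
qed

lemma solt_bound:
  assumes t: "0 \<le> t" "t \<le> \<delta>"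
  shows "\<bar>solt i t x\<bar> \<le> t * (2 * K + L * (K1 + 2 * (K2 + 1)))"
proof -
  have box: "\<bar>sol t j x / t\<^sup>2\<bar> \<le> K" for j by (rule admissible_scaled(1)[OF sol_admissible[OF t]])
  let ?h = "h i t x (\<lambda>j. sol t j x / t\<^sup>2)" and ?l = "l i t x (\<lambda>j. sol t j x / t\<^sup>2)"
  have hb: "\<bar>?h\<bar> \<le> 2 * K" by (rule h_bound[OF t box])
  have "\<bar>?l * solx i t x\<bar> \<le> L * (K1 + 2 * (K2 + 1))"
    unfolding abs_mult using l_bound[OF t box, of i x] solx_bound[OF t, of i x] nonneg by (intro mult_mono) auto
  then have "\<bar>?h - ?l * solx i t x\<bar> \<le> 2 * K + L * (K1 + 2 * (K2 + 1))"
    using hb by linarith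
  moreover have "solt i t x = t * (?h - ?l * solx i t x)" by (simp add: solt_def algebra_simps)
  ultimately show ?thesis using t by (simp add: abs_mult mult_left_mono)
qed

text \<open>\<open>F\<close> stands for a component of l or h. Only positive times are treated,
  since the argument is divided by the square of the time.\<close>

lemma coefficient_continuous:
  assumes t: "0 < fst p" "fst p \<le> \<delta>"
    and F: "\<And>t t' x x' y y' e. \<lbrakk>0 \<le> t; t \<le> \<delta>; 0 \<le> t'; t' \<le> \<delta>; \<And>j. \<bar>y j\<bar> \<le> K; \<And>j. \<bar>y' j\<bar> \<le> K;
        \<bar>t - t'\<bar> \<le> e; \<bar>x - x'\<bar> \<le> e; \<And>j. \<bar>y j - y' j\<bar> \<le> e\<rbrakk> \<Longrightarrow> \<bar>F t x y - F t' x' y'\<bar> \<le> L * e"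
  shows "((\<lambda>q. F (fst q) (snd q) (\<lambda>j. sol (fst q) j (snd q) / (fst q)\<^sup>2)) \<longlongrightarrow>
      F (fst p) (snd p) (\<lambda>j. sol (fst p) j (snd p) / (fst p)\<^sup>2)) (at p within strip \<delta>)"
proof -
  have p: "p \<in> strip \<delta>" "0 \<le> fst p" using t by (auto simp: strip_def mem_Times_iff)
  define C where "C = K1 * L + 2 * K + K1"
  define e where "e q = dist q p + (C * dist q p / (fst q)\<^sup>2 + K * (fst p)\<^sup>2 * \<bar>1 / (fst q)\<^sup>2 - 1 / (fst p)\<^sup>2\<bar>)" for q
  have C: "0 \<le> C" using nonneg by (simp add: C_def)
  have "((\<lambda>q. e q) \<longlongrightarrow> dist p p + (C * dist p p / (fst p)\<^sup>2 + K * (fst p)\<^sup>2 * \<bar>1 / (fst p)\<^sup>2 - 1 / (fst p)\<^sup>2\<bar>)) (at p within strip \<delta>)"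
    unfolding e_def using t by (intro tendsto_intros) auto
  then have "((\<lambda>q. L * e q) \<longlongrightarrow> L * 0) (at p within strip \<delta>)" by (intro tendsto_intros) simp
  then have Le: "((\<lambda>q. L * e q) \<longlongrightarrow> 0) (at p within strip \<delta>)" by simp
  have "\<bar>F (fst q) (snd q) (\<lambda>j. sol (fst q) j (snd q) / (fst q)\<^sup>2) - F (fst p) (snd p) (\<lambda>j. sol (fst p) j (snd p) / (fst p)\<^sup>2)\<bar> \<le> L * e q"
    if q: "q \<in> strip \<delta>" for q
  proof (rule F)
    show q': "0 \<le> fst q" "fst q \<le> \<delta>" using q by (auto simp: strip_def)
    show "0 \<le> fst p" "fst p \<le> \<delta>" using p t by auto
    show "\<bar>sol (fst q) j (snd q) / (fst q)\<^sup>2\<bar> \<le> K" for j by (rule admissible_scaled(1)[OF sol_admissible[OF q']])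
    show "\<bar>sol (fst p) j (snd p) / (fst p)\<^sup>2\<bar> \<le> K" for j by (rule admissible_scaled(1)[OF sol_admissible[OF p(2) t(2)]])
    have "dist q p \<le> e q" unfolding e_def using C nonneg by simp
    then show "\<bar>fst q - fst p\<bar> \<le> e q" "\<bar>snd q - snd p\<bar> \<le> e q"
      using dist_fst_le[of q p] dist_snd_le[of q p] by (auto simp: dist_real_def)
    fix j
    have "sol (fst q) j (snd q) / (fst q)\<^sup>2 - sol (fst p) j (snd p) / (fst p)\<^sup>2 =
       (sol (fst q) j (snd q) - sol (fst p) j (snd p)) / (fst q)\<^sup>2 + sol (fst p) j (snd p) * (1 / (fst q)\<^sup>2 - 1 / (fst p)\<^sup>2)"
      by (simp add: diff_divide_distrib algebra_simps)
    then have "\<bar>sol (fst q) j (snd q) / (fst q)\<^sup>2 - sol (fst p) j (snd p) / (fst p)\<^sup>2\<bar> \<le>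
       \<bar>(sol (fst q) j (snd q) - sol (fst p) j (snd p)) / (fst q)\<^sup>2\<bar> + \<bar>sol (fst p) j (snd p) * (1 / (fst q)\<^sup>2 - 1 / (fst p)\<^sup>2)\<bar>"
      by (simp only: abs_triangle_ineq)
    also have "\<dots> \<le> C * dist q p / (fst q)\<^sup>2 + K * (fst p)\<^sup>2 * \<bar>1 / (fst q)\<^sup>2 - 1 / (fst p)\<^sup>2\<bar>"
      unfolding abs_mult abs_divide
      using sol_lip[OF q p(1), of j] admissibleD(1)[OF sol_admissible[OF p(2) t(2)], of j "snd p"] unfolding C_def
      by (intro add_mono mult_right_mono) (auto intro: divide_right_mono)
    finally show "\<bar>sol (fst q) j (snd q) / (fst q)\<^sup>2 - sol (fst p) j (snd p) / (fst p)\<^sup>2\<bar> \<le> e q"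
      unfolding e_def by (simp add: add_increasing)
  qed
  then show ?thesis
    by (intro LIM_zero_cancel[OF Lim_null_comparison[OF _ Le]]) (auto simp: eventually_at_filter)
qed

lemma solt_continuous: "continuous_on (strip \<delta>) (\<lambda>p. solt i (fst p) (snd p))"
  unfolding continuous_on_def
proof
  fix p assume p: "p \<in> strip \<delta>"
  then have t: "0 \<le> fst p" "fst p \<le> \<delta>" by (auto simp: strip_def)
  show "((\<lambda>p. solt i (fst p) (snd p)) \<longlongrightarrow> solt i (fst p) (snd p)) (at p within strip \<delta>)"
  proof (cases "fst p = 0")
    case True
    \<comment> \<open>At t = 0 the scaled unknown need not have a limit, but its coefficients are
      bounded and carry the weight t, so \<open>solt\<close> tends to 0.\<close>
    let ?C = "2 * K + L * (K1 + 2 * (K2 + 1))"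
    have "((\<lambda>q. fst q * ?C) \<longlongrightarrow> fst p * ?C) (at p within strip \<delta>)" by (intro tendsto_intros)
    then have "((\<lambda>q. fst q * ?C) \<longlongrightarrow> 0) (at p within strip \<delta>)" using True by simp
    then have "((\<lambda>q. solt i (fst q) (snd q)) \<longlongrightarrow> 0) (at p within strip \<delta>)"
    proof (rule Lim_null_comparison[rotated])
      show "\<forall>\<^sub>F q in at p within strip \<delta>. norm (solt i (fst q) (snd q)) \<le> fst q * ?C"
        unfolding eventually_at_filter real_norm_def
        by (intro always_eventually allI impI solt_bound) (auto simp: strip_def)
    qed
    moreover have "solt i (fst p) (snd p) = 0" using True by (simp add: solt_def)
    ultimately show ?thesis by simp
  next
    case False
    then have t': "0 < fst p" using t by simp
    have "((\<lambda>q. solx i (fst q) (snd q)) \<longlongrightarrow> solx i (fst p) (snd p)) (at p within strip \<delta>)"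
      using solx_continuous p unfolding continuous_on_def by blast
    then show ?thesis unfolding solt_def
      by (intro tendsto_intros coefficient_continuous[OF t' t(2), of "h i"] coefficient_continuous[OF t' t(2), of "l i"] h_lip l_lip) auto
  qed
qed

text \<open>\<open>sol_Step\<close> replaces the later value by one explicit step, and
  \<open>solx\<close> linearizes the shift of that step by \<open>- s * t * l\<close>. The expansion
  is forward in time only.\<close>

lemma sol_increment:
  assumes t: "0 < t" and s: "0 \<le> s" "s \<le> t / 4" and ts: "t + s \<le> \<delta>"
  shows "\<bar>sol (t + s) i x - sol t i x - s * solt i t x\<bar> \<le> (consistency_const + 2 * (K2 + 1) * L\<^sup>2) * s\<^sup>2"
proof -
  have t': "0 \<le> t" "t \<le> \<delta>" "t \<le> 1" using t s ts delta by auto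
  have box: "\<bar>sol t j x / t\<^sup>2\<bar> \<le> K" for j by (rule admissible_scaled(1)[OF sol_admissible[OF t'(1,2)]])
  let ?h = "h i t x (\<lambda>j. sol t j x / t\<^sup>2)" and ?l = "l i t x (\<lambda>j. sol t j x / t\<^sup>2)"
  define k where "k = - (s * t * ?l)"
  have "\<bar>k\<bar> = s * (t * \<bar>?l\<bar>)" using t s by (simp add: k_def abs_mult)
  also have "\<dots> \<le> s * (1 * L)" using t' s l_bound[OF t'(1,2) box, of i x] by (intro mult_left_mono mult_mono) auto
  finally have "\<bar>k\<bar>\<^sup>2 \<le> (s * L)\<^sup>2" by (intro power_mono) auto
  then have "2 * (K2 + 1) * k\<^sup>2 \<le> 2 * (K2 + 1) * (s * L)\<^sup>2" using nonneg by (intro mult_left_mono) auto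
  then have 1: "\<bar>sol t i (x + k) - sol t i x - k * solx i t x\<bar> \<le> 2 * (K2 + 1) * L\<^sup>2 * s\<^sup>2"
    using solx[OF t'(1,2), of i x k] by (simp add: power_mult_distrib mult_ac)
  have "sol (t + s) i x - sol t i x - s * solt i t x =
      (sol (t + s) i x - Step t s (sol t) i x) + (sol t i (x + k) - sol t i x - k * solx i t x)"
    unfolding Step_def solt_def k_def by (simp add: algebra_simps)
  then show ?thesis using sol_Step[OF assms, of i x] 1 unfolding distrib_right by linarith
qed

lemma sol_C1: "C1_strip \<delta> (\<lambda>t x. sol t i x) (solt i) (solx i)"
  unfolding C1_strip_def
proof (intro conjI ballI solt_continuous solx_continuous)
  fix p assume p: "p \<in> strip \<delta>"
  then have t: "0 \<le> fst p" "fst p \<le> \<delta>" by (auto simp: strip_def)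
  let ?f = "\<lambda>q. sol (fst q) i (snd q)"
  let ?G = "\<lambda>q. solt i (fst q) (snd q)"
  let ?g = "solx i (fst p) (snd p)"
  have bl: "bounded_linear (\<lambda>h. ?G p * fst h + ?g * snd h)"
    by (intro bounded_linear_add bounded_linear_const_mult bounded_linear_fst bounded_linear_snd)
  define M where "M = consistency_const + 2 * (K2 + 1) * L\<^sup>2 + 2 * (K2 + 1) + K"
  have M: "consistency_const + 2 * (K2 + 1) * L\<^sup>2 \<le> M" "2 * (K2 + 1) \<le> M" "K \<le> M" "0 \<le> M"
    using consistency_const_nonneg nonneg by (auto simp: M_def)
  show "(?f has_derivative (\<lambda>h. ?G p * fst h + ?g * snd h)) (at p within strip \<delta>)"
    unfolding has_derivative_within_alt
  proof (intro conjI bl allI impI)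
    fix e :: real assume e: "0 < e"
    define B where "B q = \<bar>?f q - ?f p - (?G p * fst (q - p) + ?g * snd (q - p))\<bar>" for q
    have "\<exists>d>0. \<forall>q\<in>strip \<delta>. norm (q - p) < d \<longrightarrow> B q \<le> e * norm (q - p)"
    proof (cases "fst p = 0")
      case True
      have f0: "sol 0 j x = 0" for j x using admissible_at_0[OF sol_admissible] delta by simp
      have g0: "?G p = 0" using True by (simp add: solt_def)
      \<comment> \<open>\<open>solx\<close> is obtained by choice, so even for the zero function at
        t = 0 its value has to be derived from the remainder bound. The increment k is chosen to
        make that bound half of \<open>\<bar>?g\<bar>\<close>.\<close>
      have gx0: "?g = 0"
      proof (rule ccontr)
        assume g: "?g \<noteq> 0"
        define k where "k = \<bar>?g\<bar> / (4 * (K2 + 1))"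
        have k: "k > 0" using g nonneg by (simp add: k_def)
        have "k * \<bar>?g\<bar> \<le> k * (2 * (K2 + 1) * k)"
          using solx[OF t, of i "snd p" k] k True by (simp add: f0 abs_mult power2_eq_square mult_ac)
        then have "\<bar>?g\<bar> \<le> 2 * (K2 + 1) * k" using k by (rule mult_left_le_imp_le)
        also have "\<dots> = \<bar>?g\<bar> / 2" using nonneg by (simp add: k_def field_simps)
        finally show False using g by simp
      qed
      show ?thesis
      proof (intro exI conjI ballI impI)
        show "0 < e / (M + 1)" using e M by simp
        fix q assume q: "q \<in> strip \<delta>" and n: "norm (q - p) < e / (M + 1)"
        have q': "0 \<le> fst q" "fst q \<le> \<delta>" using q by (auto simp: strip_def)
        have fq: "fst q \<le> norm (q - p)" using dist_fst_le[of q p] True q' by (simp add: dist_norm)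
        have "B q = \<bar>?f q\<bar>" unfolding B_def g0 gx0 using True by (simp add: f0)
        also have "\<dots> \<le> K * (fst q)\<^sup>2" by (rule admissibleD(1)[OF sol_admissible[OF q']])
        also have "\<dots> \<le> (M + 1) * (norm (q - p) * norm (q - p))"
          unfolding power2_eq_square using M nonneg fq q' by (intro mult_mono) auto
        also have "\<dots> = ((M + 1) * norm (q - p)) * norm (q - p)" by (simp only: mult.assoc)
        also have "\<dots> \<le> e * norm (q - p)"
        proof (rule mult_right_mono)
          show "(M + 1) * norm (q - p) \<le> e"
            using n M by (simp add: pos_less_divide_eq mult.commute less_imp_le)
        qed simp
        finally show "B q \<le> e * norm (q - p)" .
      qed
    next
      case False
      then have t': "0 < fst p" using t by simp
      have "(?G \<longlongrightarrow> ?G p) (at p within strip \<delta>)" using solt_continuous p unfolding continuous_on_def by blast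
      then obtain d1 where d1: "d1 > 0" "\<And>q. q \<in> strip \<delta> \<Longrightarrow> dist q p < d1 \<Longrightarrow> dist (?G q) (?G p) < e / 2"
        using e unfolding tendsto_iff eventually_at by (metis dist_self half_gt_zero)
      \<comment> \<open>\<open>fst p / 8\<close> ensures that the time increment is at most a
        quarter of the earlier time, as \<open>sol_increment\<close> requires; the last entry bounds
        the two quadratic remainders by e / 2.\<close>
      define d where "d = min d1 (min (fst p / 8) (e / (4 * (M + 1))))"
      show ?thesis
      proof (intro exI conjI ballI impI)
        show "0 < d" using d1 t' e M by (simp add: d_def)
        fix q assume q: "q \<in> strip \<delta>" and n: "norm (q - p) < d"
        have q': "0 \<le> fst q" "fst q \<le> \<delta>" using q by (auto simp: strip_def)
        define n0 where "n0 = norm (q - p)"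
        have nf: "\<bar>fst q - fst p\<bar> \<le> n0" "\<bar>snd q - snd p\<bar> \<le> n0"
          using dist_fst_le[of q p] dist_snd_le[of q p] by (auto simp: n0_def dist_norm)
        have nd: "n0 < d1" "n0 < fst p / 8" "n0 < e / (4 * (M + 1))" "0 \<le> n0" using n by (auto simp: d_def n0_def)
        \<comment> \<open>Only forward expansions are available, so the earlier of the two times
          serves as base point, whichever of p and q it belongs to. Continuity of
          \<open>solt\<close> transfers the derivative from there to p.\<close>
        define \<tau> where "\<tau> = min (fst p) (fst q)"
        define s where "s = \<bar>fst q - fst p\<bar>"
        have s: "0 \<le> s" "s \<le> n0" using nf by (auto simp: s_def)
        have \<tau>: "0 < \<tau>" "s \<le> \<tau> / 4" "\<tau> + s \<le> \<delta>" "0 \<le> \<tau>" "\<tau> \<le> \<delta>"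
          using nf nd t' t q' by (auto simp: \<tau>_def s_def min_def abs_if split: if_splits)
        define r where "r = (\<tau>, snd q)"
        have r: "r \<in> strip \<delta>" using \<tau> by (simp add: r_def strip_def)
        have "\<bar>\<tau> - fst p\<bar> \<le> \<bar>fst q - fst p\<bar>" by (auto simp: \<tau>_def min_def)
        then have "dist r p \<le> dist q p"
          unfolding dist_prod_def r_def fst_conv snd_conv dist_real_def
          by (intro real_sqrt_le_mono add_right_mono power_mono) auto
        then have Gr: "\<bar>solt i \<tau> (snd q) - ?G p\<bar> \<le> e / 2"
          using d1(2)[OF r] nd by (simp add: r_def dist_real_def n0_def dist_norm)
        have inc: "\<bar>sol (\<tau> + s) i (snd q) - sol \<tau> i (snd q) - s * solt i \<tau> (snd q)\<bar> \<le> M * s\<^sup>2"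
          using sol_increment[OF \<tau>(1) s(1) \<tau>(2,3), of i "snd q"] mult_right_mono[OF M(1), of "s\<^sup>2"] by simp
        have sG: "\<bar>s * (solt i \<tau> (snd q) - ?G p)\<bar> \<le> s * (e / 2)"
          using Gr s by (simp only: abs_mult_left_nonneg mult_left_mono)
        have tt: "\<bar>?f q - sol (fst p) i (snd q) - (fst q - fst p) * ?G p\<bar> \<le> M * s\<^sup>2 + s * (e / 2)"
        proof (cases "fst p \<le> fst q")
          case True
          then have eq: "\<tau> = fst p" "s = fst q - fst p" "\<tau> + s = fst q" by (auto simp: \<tau>_def s_def)
          have "?f q - sol (fst p) i (snd q) - (fst q - fst p) * ?G p =
             (sol (\<tau> + s) i (snd q) - sol \<tau> i (snd q) - s * solt i \<tau> (snd q)) + s * (solt i \<tau> (snd q) - ?G p)"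
            unfolding eq(3) unfolding eq(1,2) by (simp add: algebra_simps)
          then show ?thesis using inc sG by linarith
        next
          case False
          then have eq: "\<tau> = fst q" "s = fst p - fst q" "\<tau> + s = fst p" by (auto simp: \<tau>_def s_def)
          have "?f q - sol (fst p) i (snd q) - (fst q - fst p) * ?G p =
             - ((sol (\<tau> + s) i (snd q) - sol \<tau> i (snd q) - s * solt i \<tau> (snd q)) + s * (solt i \<tau> (snd q) - ?G p))"
            unfolding eq(3) unfolding eq(1,2) by (simp add: algebra_simps)
          then show ?thesis using inc sG by linarith
        qed
        have xx: "\<bar>sol (fst p) i (snd q) - ?f p - (snd q - snd p) * ?g\<bar> \<le> M * (snd q - snd p)\<^sup>2"
          using solx[OF t, of i "snd p" "snd q - snd p"] mult_right_mono[OF M(2), of "(snd q - snd p)\<^sup>2"] by simp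
        have sq: "s\<^sup>2 \<le> n0 * n0" "(snd q - snd p)\<^sup>2 \<le> n0 * n0"
          using s nf(2) power_mono[OF nf(2), of 2] power_mono[of s n0 2] by (auto simp: power2_eq_square)
        have "?f q - ?f p - (?G p * fst (q - p) + ?g * snd (q - p)) =
            (?f q - sol (fst p) i (snd q) - (fst q - fst p) * ?G p) + (sol (fst p) i (snd q) - ?f p - (snd q - snd p) * ?g)"
          by (simp add: algebra_simps)
        then have "B q \<le> (M * s\<^sup>2 + s * (e / 2)) + M * (snd q - snd p)\<^sup>2"
          unfolding B_def using tt xx by linarith
        also have "\<dots> \<le> (M * (n0 * n0) + n0 * (e / 2)) + M * (n0 * n0)"
          using sq s e M by (intro add_mono mult_left_mono mult_right_mono) auto
        also have "\<dots> = (2 * M * n0 + e / 2) * n0" by (simp add: algebra_simps)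
        also have "\<dots> \<le> e * n0"
        proof (rule mult_right_mono)
          have "n0 * (4 * (M + 1)) < e" using nd(3) M by (simp add: pos_less_divide_eq)
          then show "2 * M * n0 + e / 2 \<le> e" using nd(4) M mult_nonneg_nonneg[of M n0] by (simp add: algebra_simps)
        qed (rule nd)
        finally show "B q \<le> e * norm (q - p)" by (simp add: n0_def)
      qed
    qed
    then show "\<exists>d>0. \<forall>q\<in>strip \<delta>. norm (q - p) < d \<longrightarrow>
        norm (?f q - ?f p - (?G p * fst (q - p) + ?g * snd (q - p))) \<le> e * norm (q - p)"
      by (simp add: B_def)
  qed
qed

theorem transport_solution:
  "\<exists>W Wt Wx. (\<forall>i. C1_strip \<delta> (W i) (Wt i) (Wx i)) \<and>
     (\<forall>i t x. 0 \<le> t \<and> t \<le> \<delta> \<longrightarrow> \<bar>W i t x\<bar> \<le> K * t\<^sup>2 \<and>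
        Wt i t x + t * l i t x (\<lambda>j. W j t x / t\<^sup>2) * Wx i t x = t * h i t x (\<lambda>j. W j t x / t\<^sup>2))"
proof (rule exI[of _ "\<lambda>i t x. sol t i x"], rule exI[of _ solt], rule exI[of _ solx], intro conjI allI impI)
  show "C1_strip \<delta> (\<lambda>t x. sol t i x) (solt i) (solx i)" for i by (rule sol_C1)
  show "\<bar>sol t i x\<bar> \<le> K * t\<^sup>2" if "0 \<le> t \<and> t \<le> \<delta>" for i t x
    using admissibleD(1)[OF sol_admissible] that by simp
qed (simp add: solt_def)

end

section \<open>Functions with bounded second differences\<close>

text \<open>A point collects \<open>\<lambda>\<close>, \<open>t\<close>, \<open>x\<close> and the rescaled unknowns \<open>Y\<^sub>j = W\<^sub>j / t\<close>.\<close>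

type_synonym pt = "real \<times> real \<times> real \<times> (nat \<Rightarrow> real)"

abbreviation (input) pl :: "pt \<Rightarrow> real" where "pl p \<equiv> fst p"
abbreviation (input) pt :: "pt \<Rightarrow> real" where "pt p \<equiv> fst (snd p)"
abbreviation (input) px :: "pt \<Rightarrow> real" where "px p \<equiv> fst (snd (snd p))"
abbreviation (input) pY :: "pt \<Rightarrow> nat \<Rightarrow> real" where "pY p \<equiv> snd (snd (snd p))"

definition dom_pt :: "real \<Rightarrow> pt set" where
  "dom_pt d = {p. \<bar>pl p\<bar> \<le> 1 \<and> 0 \<le> pt p \<and> pt p \<le> d \<and> (\<forall>j. \<bar>pY p j\<bar> \<le> 1)}"

text \<open>\<open>\<lambda>\<close> is a parameter and is never varied, so the bounds below hold
  uniformly in it. The point is that all later constants, and with them \<open>\<delta>\<close>, are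
  chosen before \<open>\<lambda>\<close>.\<close>

definition near :: "real \<Rightarrow> real \<Rightarrow> pt \<Rightarrow> pt \<Rightarrow> bool" where
  "near d e p q \<longleftrightarrow> p \<in> dom_pt d \<and> q \<in> dom_pt d \<and> pl p = pl q \<and> \<bar>pt p - pt q\<bar> \<le> e \<and>
     \<bar>px p - px q\<bar> \<le> e \<and> (\<forall>j. \<bar>pY p j - pY q j\<bar> \<le> e)"

text \<open>Second differences are taken in x and the rescaled unknowns at a fixed time, which is
  the form needed in \<open>l_sd\<close> and \<open>h_sd\<close>.\<close>

definition centred :: "real \<Rightarrow> real \<Rightarrow> pt \<Rightarrow> pt \<Rightarrow> pt \<Rightarrow> bool" where
  "centred d e p q r \<longleftrightarrow> near d e p q \<and> near d e p r \<and> pt p = pt q \<and> pt p = pt r \<and>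
     px q + px r = 2 * px p \<and> (\<forall>j. pY q j + pY r j = 2 * pY p j)"

definition nice_with :: "real \<Rightarrow> real \<Rightarrow> (pt \<Rightarrow> real) \<Rightarrow> bool" where
  "nice_with d B F \<longleftrightarrow> 0 \<le> B \<and> (\<forall>p\<in>dom_pt d. \<bar>F p\<bar> \<le> B) \<and> (\<forall>e p q. near d e p q \<longrightarrow> \<bar>F p - F q\<bar> \<le> B * e) \<and>
     (\<forall>e p q r. centred d e p q r \<longrightarrow> \<bar>F q + F r - 2 * F p\<bar> \<le> B * e\<^sup>2)"

definition nice :: "real \<Rightarrow> (pt \<Rightarrow> real) \<Rightarrow> bool" where
  "nice d F \<longleftrightarrow> (\<exists>B. nice_with d B F)"

lemma nice_withD:
  assumes "nice_with d B F"
  shows "0 \<le> B" "p \<in> dom_pt d \<Longrightarrow> \<bar>F p\<bar> \<le> B" "near d e p q \<Longrightarrow> \<bar>F p - F q\<bar> \<le> B * e"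
    "centred d e p q r \<Longrightarrow> \<bar>F q + F r - 2 * F p\<bar> \<le> B * e\<^sup>2"
  using assms unfolding nice_with_def by blast+

lemma nearD: "near d e p q \<Longrightarrow> p \<in> dom_pt d" "near d e p q \<Longrightarrow> q \<in> dom_pt d" "near d e p q \<Longrightarrow> 0 \<le> e"
  unfolding near_def by auto

lemma centredD: "centred d e p q r \<Longrightarrow> near d e p q" "centred d e p q r \<Longrightarrow> near d e p r"
  unfolding centred_def by auto

lemma nice_with_mono: "nice_with d B F \<Longrightarrow> B \<le> B' \<Longrightarrow> nice_with d B' F"
  unfolding nice_with_def
  by (meson mult_right_mono nearD(3) order_trans zero_le_power2)

lemma nice_withI:
  assumes "0 \<le> B1" "0 \<le> B2" "0 \<le> B3" "\<And>p. p \<in> dom_pt d \<Longrightarrow> \<bar>F p\<bar> \<le> B1"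
    "\<And>e p q. near d e p q \<Longrightarrow> \<bar>F p - F q\<bar> \<le> B2 * e"
    "\<And>e p q r. centred d e p q r \<Longrightarrow> \<bar>F q + F r - 2 * F p\<bar> \<le> B3 * e\<^sup>2"
  shows "nice_with d (B1 + B2 + B3) F"
  unfolding nice_with_def
proof (intro conjI ballI allI impI)
  show "0 \<le> B1 + B2 + B3" using assms by simp
  show "\<bar>F p\<bar> \<le> B1 + B2 + B3" if "p \<in> dom_pt d" for p using assms(4)[OF that] assms(2,3) by simp
  show "\<bar>F p - F q\<bar> \<le> (B1 + B2 + B3) * e" if "near d e p q" for e p q
    using assms(5)[OF that] mult_right_mono[of B2 "B1 + B2 + B3" e] nearD(3)[OF that] assms(1,3) by simp
  show "\<bar>F q + F r - 2 * F p\<bar> \<le> (B1 + B2 + B3) * e\<^sup>2" if "centred d e p q r" for e p q r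
    using assms(6)[OF that] mult_right_mono[of B3 "B1 + B2 + B3" "e\<^sup>2"] assms(1,2) by simp
qed

lemma nice_const: "nice d (\<lambda>p. c)"
proof -
  have "nice_with d (\<bar>c\<bar> + 0 + 0) (\<lambda>p. c)" by (rule nice_withI) auto
  then show ?thesis unfolding nice_def by blast
qed

lemma nice_lam: "nice d pl"
proof -
  have "nice_with d (1 + 0 + 0) pl"
    by (rule nice_withI) (auto simp: dom_pt_def near_def centred_def)
  then show ?thesis unfolding nice_def by blast
qed

lemma nice_time: "nice d pt"
proof -
  have "nice_with d (max d 0 + 1 + 0) pt"
    by (rule nice_withI) (auto simp: dom_pt_def near_def centred_def)
  then show ?thesis unfolding nice_def by blast
qed

lemma nice_Y: "nice d (\<lambda>p. pY p j)"
proof -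
  have "nice_with d (1 + 1 + 0) (\<lambda>p. pY p j)"
    by (rule nice_withI) (auto simp: dom_pt_def near_def centred_def)
  then show ?thesis unfolding nice_def by blast
qed

lemma nice_add: assumes "nice d F" "nice d G" shows "nice d (\<lambda>p. F p + G p)"
proof -
  obtain A B where F: "nice_with d A F" and G: "nice_with d B G" using assms unfolding nice_def by blast
  have "nice_with d ((A + B) + (A + B) + (A + B)) (\<lambda>p. F p + G p)"
  proof (rule nice_withI)
    show "0 \<le> A + B" using nice_withD(1) F G by (simp add: add_nonneg_nonneg)
    then show "0 \<le> A + B" "0 \<le> A + B" by auto
    show "\<bar>F p + G p\<bar> \<le> A + B" if "p \<in> dom_pt d" for p
      using nice_withD(2)[OF F that] nice_withD(2)[OF G that] by linarith
    show "\<bar>F p + G p - (F q + G q)\<bar> \<le> (A + B) * e" if "near d e p q" for e p q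
      using nice_withD(3)[OF F that] nice_withD(3)[OF G that] unfolding distrib_right by linarith
    show "\<bar>F q + G q + (F r + G r) - 2 * (F p + G p)\<bar> \<le> (A + B) * e\<^sup>2" if "centred d e p q r" for e p q r
      using nice_withD(4)[OF F that] nice_withD(4)[OF G that] unfolding distrib_right distrib_left by linarith
  qed
  then show ?thesis unfolding nice_def by blast
qed

lemma second_difference_product:
  fixes f g f1 g1 f2 g2 :: real
  assumes "\<bar>f\<bar> \<le> A" "\<bar>g\<bar> \<le> B" "\<bar>f1 - f\<bar> \<le> a" "\<bar>f2 - f\<bar> \<le> a" "\<bar>g1 - g\<bar> \<le> b" "\<bar>g2 - g\<bar> \<le> b"
    "\<bar>f1 + f2 - 2 * f\<bar> \<le> a2" "\<bar>g1 + g2 - 2 * g\<bar> \<le> b2"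
  shows "\<bar>f1 * g1 + f2 * g2 - 2 * (f * g)\<bar> \<le> B * a2 + A * b2 + 2 * (a * b)"
proof -
  have nn: "0 \<le> A" "0 \<le> B" "0 \<le> a" "0 \<le> b" using assms(1,2,3,5) by linarith+
  have m: "\<bar>x * y\<bar> \<le> X * Y" if "\<bar>x\<bar> \<le> X" "\<bar>y\<bar> \<le> Y" for x y X Y :: real
    unfolding abs_mult using that by (intro mult_mono) auto
  have "f1 * g1 + f2 * g2 - 2 * (f * g) =
      g * (f1 + f2 - 2 * f) + f * (g1 + g2 - 2 * g) + (f1 - f) * (g1 - g) + (f2 - f) * (g2 - g)"
    by (simp add: algebra_simps)
  then show ?thesis
    using m[OF assms(2,7)] m[OF assms(1,8)] m[OF assms(3,5)] m[OF assms(4,6)] by linarith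
qed

lemma nice_mult: assumes "nice d F" "nice d G" shows "nice d (\<lambda>p. F p * G p)"
proof -
  obtain A B where F: "nice_with d A F" and G: "nice_with d B G" using assms unfolding nice_def by blast
  have A: "0 \<le> A" and B: "0 \<le> B" using nice_withD(1) F G by auto
  have "nice_with d (A * B + (A * B + B * A) + (B * A + A * B + 2 * (A * B))) (\<lambda>p. F p * G p)"
  proof (rule nice_withI)
    show "\<bar>F p * G p\<bar> \<le> A * B" if "p \<in> dom_pt d" for p
      unfolding abs_mult using nice_withD(2)[OF F that] nice_withD(2)[OF G that] A by (intro mult_mono) auto
    show "\<bar>F p * G p - F q * G q\<bar> \<le> (A * B + B * A) * e" if n: "near d e p q" for e p q
    proof -
      have "F p * G p - F q * G q = F p * (G p - G q) + G q * (F p - F q)" by (simp add: algebra_simps)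
      then have "\<bar>F p * G p - F q * G q\<bar> \<le> \<bar>F p\<bar> * \<bar>G p - G q\<bar> + \<bar>G q\<bar> * \<bar>F p - F q\<bar>"
        by (metis abs_mult abs_triangle_ineq)
      also have "\<dots> \<le> A * (B * e) + B * (A * e)"
        using nice_withD(2)[OF F nearD(1)[OF n]] nice_withD(2)[OF G nearD(2)[OF n]] nice_withD(3)[OF F n] nice_withD(3)[OF G n] A B
        by (intro add_mono mult_mono) auto
      finally show ?thesis by (simp add: algebra_simps)
    qed
    show "\<bar>F q * G q + F r * G r - 2 * (F p * G p)\<bar> \<le> (B * A + A * B + 2 * (A * B)) * e\<^sup>2" if c: "centred d e p q r" for e p q r
    proof -
      note n = centredD[OF c]
      have "\<bar>F q * G q + F r * G r - 2 * (F p * G p)\<bar> \<le> B * (A * e\<^sup>2) + A * (B * e\<^sup>2) + 2 * ((A * e) * (B * e))"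
        by (rule second_difference_product)
           (use nice_withD[OF F] nice_withD[OF G] nearD(1)[OF n(1)] n c in \<open>auto simp: abs_minus_commute\<close>)
      then show ?thesis by (simp add: power2_eq_square algebra_simps)
    qed
  qed (use A B in auto)
  then show ?thesis unfolding nice_def by blast
qed

lemma nice_minus: "nice d F \<Longrightarrow> nice d (\<lambda>p. - F p)"
  using nice_mult[OF nice_const[of d "-1"]] by simp

lemma nice_diff: "nice d F \<Longrightarrow> nice d G \<Longrightarrow> nice d (\<lambda>p. F p - G p)"
  using nice_add[OF _ nice_minus] by simp

lemma nice_inverse:
  assumes "nice d F" and m: "0 < m" "\<And>p. p \<in> dom_pt d \<Longrightarrow> m \<le> \<bar>F p\<bar>"
  shows "nice d (\<lambda>p. inverse (F p))"
proof -
  obtain B where F: "nice_with d B F" using assms unfolding nice_def by blast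
  have B: "0 \<le> B" using nice_withD(1)[OF F] .
  have inv: "\<bar>inverse (F p)\<bar> \<le> inverse m" if "p \<in> dom_pt d" for p
    using m(1) m(2)[OF that] by (simp add: abs_inverse le_imp_inverse_le)
  have nz: "F p \<noteq> 0" if "p \<in> dom_pt d" for p using m(1) m(2)[OF that] by auto
  have m0: "0 \<le> inverse m" using m by simp
  have "nice_with d (inverse m + inverse m * inverse m * B + (inverse m * inverse m * B + 2 * (inverse m * inverse m * inverse m * (B * B)))) (\<lambda>p. inverse (F p))"
  proof (rule nice_withI)
    show "\<bar>inverse (F p) - inverse (F q)\<bar> \<le> inverse m * inverse m * B * e" if n: "near d e p q" for e p q
    proof -
      have "inverse (F p) - inverse (F q) = inverse (F p) * inverse (F q) * (F q - F p)"
        using nz[OF nearD(1)[OF n]] nz[OF nearD(2)[OF n]] by (simp add: field_simps)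
      then have "\<bar>inverse (F p) - inverse (F q)\<bar> = \<bar>inverse (F p)\<bar> * \<bar>inverse (F q)\<bar> * \<bar>F p - F q\<bar>"
        by (simp add: abs_mult abs_minus_commute)
      also have "\<dots> \<le> inverse m * inverse m * (B * e)"
        using inv[OF nearD(1)[OF n]] inv[OF nearD(2)[OF n]] nice_withD(3)[OF F n] m0 by (intro mult_mono) auto
      finally show ?thesis by simp
    qed
    show "\<bar>inverse (F q) + inverse (F r) - 2 * inverse (F p)\<bar>
        \<le> (inverse m * inverse m * B + 2 * (inverse m * inverse m * inverse m * (B * B))) * e\<^sup>2" if c: "centred d e p q r" for e p q r
    proof -
      note n = centredD[OF c]
      have D: "p \<in> dom_pt d" "q \<in> dom_pt d" "r \<in> dom_pt d" using nearD n by blast+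
      let ?i = "\<lambda>p. inverse (F p)"
      have eq: "?i q + ?i r - 2 * ?i p = - (?i p * ?i p * (F q + F r - 2 * F p))
          + ?i p * ?i p * ?i q * ((F p - F q) * (F p - F q)) + ?i p * ?i p * ?i r * ((F p - F r) * (F p - F r))"
      proof -
        \<comment> \<open>The expansion of 1 / b at a to first order with its exact remainder.
          Adding two instances turns the linear terms into the second difference of F.\<close>
        have *: "inverse b = inverse a - inverse a * inverse a * (b - a) + inverse a * inverse a * inverse b * ((a - b) * (a - b))"
          if "a \<noteq> 0" "b \<noteq> 0" for a b :: real
          using that by (simp add: field_simps)
        show ?thesis
          using *[OF nz[OF D(1)] nz[OF D(2)]] *[OF nz[OF D(1)] nz[OF D(3)]] by (simp add: algebra_simps)
      qed
      have m2: "\<bar>x * y\<bar> \<le> X * Y" if "\<bar>x\<bar> \<le> X" "\<bar>y\<bar> \<le> Y" for x y X Y :: real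
        unfolding abs_mult using that by (intro mult_mono) auto
      have "\<bar>?i p * ?i p * (F q + F r - 2 * F p)\<bar> \<le> inverse m * inverse m * (B * e\<^sup>2)"
        by (intro m2 inv D nice_withD(4)[OF F c])
      moreover have "\<bar>?i p * ?i p * ?i q * ((F p - F q) * (F p - F q))\<bar> \<le> inverse m * inverse m * inverse m * ((B * e) * (B * e))"
        by (intro m2 inv D nice_withD(3)[OF F n(1)])
      moreover have "\<bar>?i p * ?i p * ?i r * ((F p - F r) * (F p - F r))\<bar> \<le> inverse m * inverse m * inverse m * ((B * e) * (B * e))"
        by (intro m2 inv D nice_withD(3)[OF F n(2)])
      ultimately have "\<bar>?i q + ?i r - 2 * ?i p\<bar> \<le> inverse m * inverse m * (B * e\<^sup>2) + 2 * (inverse m * inverse m * inverse m * ((B * e) * (B * e)))"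
        unfolding eq by linarith
      then show ?thesis by (simp add: power2_eq_square algebra_simps)
    qed
  qed (use inv m0 B in auto)
  then show ?thesis unfolding nice_def by blast
qed

section \<open>Smooth functions of regular quantities and their averages\<close>

lemma smooth_fun_DERIV: "smooth_fun g \<Longrightarrow> (g has_real_derivative deriv g s) (at s)"
  unfolding smooth_fun_def by (metis DERIV_deriv_iff_real_differentiable funpow_0)

lemma smooth_fun_deriv: "smooth_fun g \<Longrightarrow> smooth_fun (deriv g)"
  unfolding smooth_fun_def by (metis comp_apply funpow_Suc_right)

lemma smooth_fun_continuous: "smooth_fun g \<Longrightarrow> continuous_on S g"
  by (meson DERIV_isCont continuous_at_imp_continuous_on smooth_fun_DERIV)

lemma smooth_increment_bounds:
  assumes g: "smooth_fun g"
    and M1: "\<And>s. s \<in> closed_segment a b \<Longrightarrow> \<bar>deriv g s\<bar> \<le> M"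
    and M2: "\<And>s. s \<in> closed_segment a b \<Longrightarrow> \<bar>deriv (deriv g) s\<bar> \<le> M"
  shows "\<bar>g b - g a\<bar> \<le> M * \<bar>b - a\<bar>" "\<bar>g b - g a - deriv g a * (b - a)\<bar> \<le> M * (b - a)\<^sup>2"
proof -
  have lip: "\<bar>f s - f a\<bar> \<le> M * \<bar>s - a\<bar>"
    if f: "smooth_fun f" and M: "\<And>s. s \<in> closed_segment a b \<Longrightarrow> \<bar>deriv f s\<bar> \<le> M" and s: "s \<in> closed_segment a b" for f s
  proof -
    have "norm (f s - f a) \<le> M * norm (s - a)"
    proof (rule field_differentiable_bound[of "closed_segment a b" f "deriv f"])
      show "(f has_field_derivative deriv f z) (at z within closed_segment a b)" for z
        using smooth_fun_DERIV[OF f] has_field_derivative_at_within by blast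
    qed (use M s in auto)
    then show ?thesis by simp
  qed
  show "\<bar>g b - g a\<bar> \<le> M * \<bar>b - a\<bar>" by (rule lip[OF g M1]) auto
  define G where "G s = g s - deriv g a * s" for s
  have "norm (G b - G a) \<le> (M * \<bar>b - a\<bar>) * norm (b - a)"
  proof (rule field_differentiable_bound[of "closed_segment a b" G "\<lambda>s. deriv g s - deriv g a"])
    show "(G has_field_derivative deriv g s - deriv g a) (at s within closed_segment a b)" for s
      unfolding G_def using has_field_derivative_at_within[OF smooth_fun_DERIV[OF g]]
      by (auto intro!: derivative_eq_intros)
    fix s assume s: "s \<in> closed_segment a b"
    have "\<bar>deriv g s - deriv g a\<bar> \<le> M * \<bar>s - a\<bar>" by (rule lip[OF smooth_fun_deriv[OF g] M2 s])
    also have "\<dots> \<le> M * \<bar>b - a\<bar>"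
    proof (rule mult_left_mono)
      show "\<bar>s - a\<bar> \<le> \<bar>b - a\<bar>" using s by (auto simp: closed_segment_eq_real_ivl split: if_splits)
      show "0 \<le> M" using M1[of a] by (meson abs_ge_zero ends_in_segment(1) order_trans)
    qed
    finally show "norm (deriv g s - deriv g a) \<le> M * \<bar>b - a\<bar>" by simp
  qed auto
  then show "\<bar>g b - g a - deriv g a * (b - a)\<bar> \<le> M * (b - a)\<^sup>2"
    by (simp add: G_def power2_eq_square algebra_simps)
qed

lemma smooth_second_difference:
  assumes g: "smooth_fun g" and S: "convex S" "a \<in> S" "b \<in> S" "c \<in> S"
    and M1: "\<And>s. s \<in> S \<Longrightarrow> \<bar>deriv g s\<bar> \<le> M" and M2: "\<And>s. s \<in> S \<Longrightarrow> \<bar>deriv (deriv g) s\<bar> \<le> M"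
    and w: "\<bar>b - a\<bar> \<le> w" "\<bar>c - a\<bar> \<le> w" and w2: "\<bar>b + c - 2 * a\<bar> \<le> w2"
  shows "\<bar>g b + g c - 2 * g a\<bar> \<le> M * w2 + 2 * (M * w\<^sup>2)"
proof -
  have seg: "closed_segment a b \<subseteq> S" "closed_segment a c \<subseteq> S" using S by (simp_all add: closed_segment_subset)
  have M0: "0 \<le> M" using M1[OF S(2)] by linarith
  have r: "\<bar>g z - g a - deriv g a * (z - a)\<bar> \<le> M * w\<^sup>2" if "closed_segment a z \<subseteq> S" "\<bar>z - a\<bar> \<le> w" for z
  proof -
    have "\<bar>g z - g a - deriv g a * (z - a)\<bar> \<le> M * (z - a)\<^sup>2"
      using smooth_increment_bounds(2)[OF g] M1 M2 that(1) by blast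
    also have "\<dots> \<le> M * w\<^sup>2" using that(2) M0 power_mono[OF that(2), of 2] by (intro mult_left_mono) auto
    finally show ?thesis .
  qed
  have "\<bar>deriv g a * (b + c - 2 * a)\<bar> \<le> M * w2"
    unfolding abs_mult using M1[OF S(2)] w2 M0 by (intro mult_mono) auto
  moreover have "g b + g c - 2 * g a = deriv g a * (b + c - 2 * a)
      + (g b - g a - deriv g a * (b - a)) + (g c - g a - deriv g a * (c - a))"
    by (simp add: algebra_simps)
  ultimately show ?thesis using r[OF seg(1) w(1)] r[OF seg(2) w(2)] by linarith
qed

text \<open>C depends on F only through B. This uniformity is needed in \<open>nice_average\<close>,
  where F is replaced by the family \<open>c0 + r * F p\<close> under an integral over r.\<close>

lemma nice_with_smooth:
  assumes g: "smooth_fun g" and B: "0 \<le> B"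
  shows "\<exists>C. \<forall>F. nice_with d B F \<longrightarrow> nice_with d C (\<lambda>p. g (F p))"
proof -
  let ?S = "{-B..B}"
  have "\<exists>M. \<forall>s\<in>?S. \<bar>f s\<bar> \<le> M" if "smooth_fun f" for f
  proof -
    have "compact (f ` ?S)" by (intro compact_continuous_image smooth_fun_continuous that compact_Icc)
    then show ?thesis using bounded_iff[of "f ` ?S"] compact_imp_bounded by auto
  qed
  then obtain Ma Mb Mc where M: "\<And>s. s \<in> ?S \<Longrightarrow> \<bar>g s\<bar> \<le> Ma" "\<And>s. s \<in> ?S \<Longrightarrow> \<bar>deriv g s\<bar> \<le> Mb"
    "\<And>s. s \<in> ?S \<Longrightarrow> \<bar>deriv (deriv g) s\<bar> \<le> Mc"
    using g smooth_fun_deriv by metis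
  define M where "M = max Ma (max Mb Mc)"
  have M': "\<bar>g s\<bar> \<le> M" "\<bar>deriv g s\<bar> \<le> M" "\<bar>deriv (deriv g) s\<bar> \<le> M" if "s \<in> ?S" for s
    using M[OF that] by (auto simp: M_def)
  have M0: "0 \<le> M" using M'(1)[of 0] B by auto
  have "nice_with d (M + M * B + (M * B + 2 * (M * (B * B)))) (\<lambda>p. g (F p))" if F: "nice_with d B F" for F
  proof (rule nice_withI)
    have FS: "F p \<in> ?S" if "p \<in> dom_pt d" for p using nice_withD(2)[OF F that] by (auto simp: abs_le_iff)
    show "\<bar>g (F p)\<bar> \<le> M" if "p \<in> dom_pt d" for p using M'(1)[OF FS[OF that]] .
    show "\<bar>g (F p) - g (F q)\<bar> \<le> M * B * e" if n: "near d e p q" for e p q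
    proof -
      have "closed_segment (F q) (F p) \<subseteq> ?S"
        using FS[OF nearD(1)[OF n]] FS[OF nearD(2)[OF n]] by (intro closed_segment_subset) auto
      then have "\<bar>g (F p) - g (F q)\<bar> \<le> M * \<bar>F p - F q\<bar>"
        using smooth_increment_bounds(1)[OF g] M'(2,3) by blast
      also have "\<dots> \<le> M * (B * e)" using nice_withD(3)[OF F n] M0 by (intro mult_left_mono)
      finally show ?thesis by simp
    qed
    show "\<bar>g (F q) + g (F r) - 2 * g (F p)\<bar> \<le> (M * B + 2 * (M * (B * B))) * e\<^sup>2" if c: "centred d e p q r" for e p q r
    proof -
      note n = centredD[OF c]
      have "\<bar>g (F q) + g (F r) - 2 * g (F p)\<bar> \<le> M * (B * e\<^sup>2) + 2 * (M * (B * e)\<^sup>2)"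
      proof (rule smooth_second_difference[OF g, of ?S])
        show "F p \<in> ?S" "F q \<in> ?S" "F r \<in> ?S" using FS nearD n by blast+
        show "\<bar>F q - F p\<bar> \<le> B * e" "\<bar>F r - F p\<bar> \<le> B * e"
          using nice_withD(3)[OF F n(1)] nice_withD(3)[OF F n(2)] by (auto simp: abs_minus_commute)
        show "\<bar>F q + F r - 2 * F p\<bar> \<le> B * e\<^sup>2" by (rule nice_withD(4)[OF F c])
      qed (use M' in auto)
      then show ?thesis by (simp add: power2_eq_square algebra_simps)
    qed
  qed (use M0 B in auto)
  then show ?thesis by blast
qed

lemma nice_smooth: "smooth_fun g \<Longrightarrow> nice d F \<Longrightarrow> nice d (\<lambda>p. g (F p))"
  unfolding nice_def using nice_with_smooth nice_withD(1) by metis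

lemma nice_smooth_x:
  assumes f: "smooth_fun f" and "bounded (range f)" "bounded (range (deriv f))" "bounded (range (deriv (deriv f)))"
  shows "nice d (\<lambda>p. f (px p))"
proof -
  obtain Ma Mb Mc where M: "\<And>s. \<bar>f s\<bar> \<le> Ma" "\<And>s. \<bar>deriv f s\<bar> \<le> Mb" "\<And>s. \<bar>deriv (deriv f) s\<bar> \<le> Mc"
    using assms(2-4) unfolding bounded_iff by (metis rangeI real_norm_def)
  define M where "M = max Ma (max Mb Mc)"
  have M': "\<bar>f s\<bar> \<le> M" "\<bar>deriv f s\<bar> \<le> M" "\<bar>deriv (deriv f) s\<bar> \<le> M" for s
    using M[of s] by (auto simp: M_def)
  have M0: "0 \<le> M" using M'(1)[of 0] by linarith
  have "nice_with d (M + M + 2 * M) (\<lambda>p. f (px p))"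
  proof (rule nice_withI)
    show "\<bar>f (px p) - f (px q)\<bar> \<le> M * e" if n: "near d e p q" for e p q
    proof -
      have "\<bar>f (px p) - f (px q)\<bar> \<le> M * \<bar>px p - px q\<bar>" using smooth_increment_bounds(1)[OF f] M'(2,3) by blast
      also have "\<dots> \<le> M * e" using n M0 by (intro mult_left_mono) (auto simp: near_def)
      finally show ?thesis .
    qed
    show "\<bar>f (px q) + f (px r) - 2 * f (px p)\<bar> \<le> 2 * M * e\<^sup>2" if c: "centred d e p q r" for e p q r
    proof -
      note n = centredD[OF c]
      have "\<bar>f (px q) + f (px r) - 2 * f (px p)\<bar> \<le> M * 0 + 2 * (M * e\<^sup>2)"
        by (rule smooth_second_difference[OF f, of UNIV]) (use M' n c in \<open>auto simp: near_def centred_def abs_minus_commute\<close>)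
      then show ?thesis by simp
    qed
  qed (use M' M0 in auto)
  then show ?thesis unfolding nice_def by blast
qed

lemma nice_with_integral:
  fixes F :: "real \<Rightarrow> pt \<Rightarrow> real"
  assumes F: "\<And>r. r \<in> {0..1} \<Longrightarrow> nice_with d C (F r)"
    and cont: "\<And>p. continuous_on {0..1} (\<lambda>r. F r p)"
  shows "nice_with d C (\<lambda>p. integral {0..1} (\<lambda>r. F r p))"
proof -
  have int: "(\<lambda>r. F r p) integrable_on {0..1}" for p by (rule integrable_continuous_real[OF cont])
  have bnd: "\<bar>integral {0..1} f\<bar> \<le> B"
    if "continuous_on {0..1} f" "\<And>r. r \<in> {0..1} \<Longrightarrow> \<bar>f r\<bar> \<le> B" for f :: "real \<Rightarrow> real" and B
    using integral_bound[of 0 1 f B] that by auto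
  show ?thesis unfolding nice_with_def
  proof (intro conjI ballI allI impI)
    show "0 \<le> C" using nice_withD(1)[OF F[of 0]] by simp
    show "\<bar>integral {0..1} (\<lambda>r. F r p)\<bar> \<le> C" if "p \<in> dom_pt d" for p
      by (rule bnd[OF cont]) (rule nice_withD(2)[OF F that])
    show "\<bar>integral {0..1} (\<lambda>r. F r p) - integral {0..1} (\<lambda>r. F r q)\<bar> \<le> C * e" if n: "near d e p q" for e p q
    proof -
      have "integral {0..1} (\<lambda>r. F r p) - integral {0..1} (\<lambda>r. F r q) = integral {0..1} (\<lambda>r. F r p - F r q)"
        by (rule integral_diff[OF int int, symmetric])
      moreover have "\<bar>integral {0..1} (\<lambda>r. F r p - F r q)\<bar> \<le> C * e"
        by (rule bnd[OF continuous_on_diff[OF cont cont]]) (rule nice_withD(3)[OF F n])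
      ultimately show ?thesis by simp
    qed
    show "\<bar>integral {0..1} (\<lambda>r. F r q) + integral {0..1} (\<lambda>r. F r s) - 2 * integral {0..1} (\<lambda>r. F r p)\<bar> \<le> C * e\<^sup>2"
      if c: "centred d e p q s" for e p q s
    proof -
      have "integral {0..1} (\<lambda>r. F r q) + integral {0..1} (\<lambda>r. F r s) - 2 * integral {0..1} (\<lambda>r. F r p)
          = integral {0..1} (\<lambda>r. F r q + F r s - 2 * F r p)"
        using int by (simp add: integral_add integral_diff integrable_add integrable_on_mult_right)
      moreover have "\<bar>integral {0..1} (\<lambda>r. F r q + F r s - 2 * F r p)\<bar> \<le> C * e\<^sup>2"
        by (rule bnd) (intro continuous_intros cont, rule nice_withD(4)[OF F c])
      ultimately show ?thesis by simp
    qed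
  qed
qed

lemma nice_with_scale:
  assumes "nice_with d B F" "\<bar>w\<bar> \<le> 1"
  shows "nice_with d B (\<lambda>p. w * F p)"
proof -
  have *: "\<bar>w * a\<bar> \<le> b" if "\<bar>a\<bar> \<le> b" for a b :: real
    unfolding abs_mult using mult_right_mono[OF assms(2), of "\<bar>a\<bar>"] that by simp
  show ?thesis unfolding nice_with_def
  proof (intro conjI ballI allI impI)
    show "0 \<le> B" by (rule nice_withD(1)[OF assms(1)])
    show "\<bar>w * F p\<bar> \<le> B" if "p \<in> dom_pt d" for p by (rule *[OF nice_withD(2)[OF assms(1) that]])
    show "\<bar>w * F p - w * F q\<bar> \<le> B * e" if "near d e p q" for e p q
      using *[OF nice_withD(3)[OF assms(1) that]] by (simp only: right_diff_distrib)
    have "w * F q + w * F r - 2 * (w * F p) = w * (F q + F r - 2 * F p)" for p q r by (simp add: algebra_simps)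
    then show "\<bar>w * F q + w * F r - 2 * (w * F p)\<bar> \<le> B * e\<^sup>2" if "centred d e p q r" for e p q r
      using *[OF nice_withD(4)[OF assms(1) that]] by (simp only:)
  qed
qed

text \<open>Quotients such as c(u) / t are singular expressions at t = 0. As Taylor remainders they
  are averages of derivatives over a segment, which this lemma shows to be regular.\<close>

lemma nice_average:
  assumes g: "smooth_fun g" and "nice d F" and w: "continuous_on {0..1} w" "\<And>r. r \<in> {0..1} \<Longrightarrow> \<bar>w r\<bar> \<le> 1"
  shows "nice d (\<lambda>p. integral {0..1} (\<lambda>r. w r * g (c0 + r * F p)))"
proof -
  obtain B where F: "nice_with d B F" using assms unfolding nice_def by blast
  have B: "0 \<le> B" using nice_withD(1)[OF F] .
  obtain C where C: "\<And>F. nice_with d (\<bar>c0\<bar> + B) F \<Longrightarrow> nice_with d C (\<lambda>p. g (F p))"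
    using nice_with_smooth[OF g, of "\<bar>c0\<bar> + B"] B by auto
  have "nice_with d (\<bar>c0\<bar> + B) (\<lambda>p. c0 + r * F p)" if r: "r \<in> {0..1}" for r
  proof -
    have rF: "nice_with d B (\<lambda>p. r * F p)" using nice_with_scale[OF F] r by auto
    show ?thesis unfolding nice_with_def
    proof (intro conjI ballI allI impI)
      show "0 \<le> \<bar>c0\<bar> + B" using B by simp
      show "\<bar>c0 + r * F p\<bar> \<le> \<bar>c0\<bar> + B" if "p \<in> dom_pt d" for p using nice_withD(2)[OF rF that] by linarith
      show "\<bar>c0 + r * F p - (c0 + r * F q)\<bar> \<le> (\<bar>c0\<bar> + B) * e" if n: "near d e p q" for e p q
        using nice_withD(3)[OF rF n] mult_right_mono[of B "\<bar>c0\<bar> + B" e] nearD(3)[OF n] by simp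
      show "\<bar>c0 + r * F q + (c0 + r * F s) - 2 * (c0 + r * F p)\<bar> \<le> (\<bar>c0\<bar> + B) * e\<^sup>2" if n: "centred d e p q s" for e p q s
      proof -
        have "c0 + r * F q + (c0 + r * F s) - 2 * (c0 + r * F p) = r * F q + r * F s - 2 * (r * F p)"
          by (simp add: algebra_simps)
        moreover have "B * e\<^sup>2 \<le> (\<bar>c0\<bar> + B) * e\<^sup>2" by (intro mult_right_mono) auto
        ultimately show ?thesis using nice_withD(4)[OF rF n] by linarith
      qed
    qed
  qed
  from C[OF this] have "nice_with d C (\<lambda>p. w r * g (c0 + r * F p))" if "r \<in> {0..1}" for r
    using nice_with_scale w(2) that by blast
  then have "nice_with d C (\<lambda>p. integral {0..1} (\<lambda>r. w r * g (c0 + r * F p)))"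
  proof (rule nice_with_integral)
    show "continuous_on {0..1} (\<lambda>r. w r * g (c0 + r * F p))" for p
      by (intro continuous_intros w continuous_on_compose2[OF smooth_fun_continuous[OF g, of UNIV]]) auto
  qed
  then show ?thesis unfolding nice_def by blast
qed

section \<open>Systems with regular coefficients\<close>

lemma finite_uniform_bound:
  fixes P :: "'i \<Rightarrow> real \<Rightarrow> bool"
  assumes "finite I" and "\<And>i. i \<in> I \<Longrightarrow> \<exists>B. P i B" and mono: "\<And>i B B'. P i B \<Longrightarrow> B \<le> B' \<Longrightarrow> P i B'"
  shows "\<exists>B\<ge>0. \<forall>i\<in>I. P i B"
  using assms(1,2)
proof (induction I rule: finite_induct)
  case (insert i I)
  then obtain B where B: "0 \<le> B" "\<forall>i\<in>I. P i B" by auto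
  obtain B' where B': "P i B'" using insert by auto
  have "P j (max B B')" if "j \<in> insert i I" for j
    using that B B' mono max.cobounded1 max.cobounded2 by blast
  then show ?case using B(1) by (intro exI[of _ "max B B'"]) auto
qed auto

text \<open>The row sum S multiplies only the variation of y, while the variation of the
  coefficients is charged to a. In this way the row sum becomes the Lipschitz constant in y up to a
  small term.\<close>

lemma abs_sum_prod_diff_le:
  fixes q q' y y' :: "nat \<Rightarrow> real"
  assumes "\<And>j. j < n \<Longrightarrow> \<bar>q j - q' j\<bar> \<le> a" "\<And>j. \<bar>y' j\<bar> \<le> K" "\<And>j. \<bar>y j - y' j\<bar> \<le> e" "(\<Sum>j<n. \<bar>q j\<bar>) \<le> S"
  shows "\<bar>(\<Sum>j<n. q j * y j) - (\<Sum>j<n. q' j * y' j)\<bar> \<le> S * e + real n * (a * K)"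
proof -
  have e: "0 \<le> e" and K: "0 \<le> K" using assms(2,3)[of 0] by linarith+
  have "(\<Sum>j<n. q j * y j) - (\<Sum>j<n. q' j * y' j) = (\<Sum>j<n. q j * (y j - y' j) + (q j - q' j) * y' j)"
    by (simp add: sum_subtractf[symmetric] algebra_simps)
  also have "\<bar>\<dots>\<bar> \<le> (\<Sum>j<n. \<bar>q j * (y j - y' j) + (q j - q' j) * y' j\<bar>)" by (rule sum_abs)
  also have "\<dots> \<le> (\<Sum>j<n. \<bar>q j\<bar> * e + a * K)"
  proof (rule sum_mono)
    fix j assume "j \<in> {..<n}"
    then have j: "\<bar>q j - q' j\<bar> \<le> a" using assms(1) by simp
    have "\<bar>q j * (y j - y' j)\<bar> \<le> \<bar>q j\<bar> * e" unfolding abs_mult using assms(3) by (intro mult_left_mono) auto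
    moreover have "\<bar>(q j - q' j) * y' j\<bar> \<le> a * K" unfolding abs_mult using assms(2) j by (intro mult_mono) auto
    ultimately show "\<bar>q j * (y j - y' j) + (q j - q' j) * y' j\<bar> \<le> \<bar>q j\<bar> * e + a * K" by linarith
  qed
  also have "\<dots> = (\<Sum>j<n. \<bar>q j\<bar>) * e + real n * (a * K)" by (simp add: sum.distrib sum_distrib_right)
  also have "\<dots> \<le> S * e + real n * (a * K)" using assms(4) e by (simp add: mult_right_mono)
  finally show ?thesis .
qed

text \<open>The row sums are controlled only at t = 0 and vanishing unknowns, where they can be
  computed. Regularity of \<open>Q\<close> extends the control to short times, at the price of 5/4
  in place of 9/8.\<close>

locale fuchsian_system =
  fixes l A :: "nat \<Rightarrow> pt \<Rightarrow> real" and Q :: "nat \<Rightarrow> nat \<Rightarrow> pt \<Rightarrow> real" and n :: nat and d lam0 :: real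
  assumes d: "0 < d" and lam0: "lam0 \<le> 1"
    and nice_l: "\<And>i. i < n \<Longrightarrow> nice d (l i)"
    and nice_A: "\<And>i. i < n \<Longrightarrow> nice d (A i)"
    and nice_Q: "\<And>i j. i < n \<Longrightarrow> j < n \<Longrightarrow> nice d (Q i j)"
    and row: "\<And>i lam x. i < n \<Longrightarrow> \<bar>lam\<bar> \<le> lam0 \<Longrightarrow> (\<Sum>j<n. \<bar>Q i j (lam, 0, x, \<lambda>_. 0)\<bar>) \<le> 9 / 8"
begin

text \<open>The scheme works with \<open>y = W / t\<^sup>2\<close>, the coefficients with \<open>Y = t y\<close>: this makes their dependence on \<open>y\<close> weak for small \<open>t\<close>.\<close>

definition lc :: "real \<Rightarrow> nat \<Rightarrow> real \<Rightarrow> real \<Rightarrow> (nat \<Rightarrow> real) \<Rightarrow> real" where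
  "lc lam i t x y = (if i < n then l i (lam, t, x, \<lambda>j. t * y j) else 0)"

definition hc :: "real \<Rightarrow> nat \<Rightarrow> real \<Rightarrow> real \<Rightarrow> (nat \<Rightarrow> real) \<Rightarrow> real" where
  "hc lam i t x y = (if i < n then A i (lam, t, x, \<lambda>j. t * y j) + (\<Sum>j<n. Q i j (lam, t, x, \<lambda>j. t * y j) * y j) else 0)"

lemma uniform_bound:
  "\<exists>B\<ge>0. \<forall>i<n. nice_with d B (l i) \<and> nice_with d B (A i) \<and> (\<forall>j<n. nice_with d B (Q i j))"
proof -
  have "\<exists>B\<ge>0. \<forall>i\<in>{..<n}. nice_with d B (l i) \<and> nice_with d B (A i) \<and> (\<forall>j<n. nice_with d B (Q i j))"
  proof (rule finite_uniform_bound)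
    fix i assume "i \<in> {..<n}"
    then have i: "i < n" by simp
    obtain B1 B2 where B: "nice_with d B1 (l i)" "nice_with d B2 (A i)"
      using nice_l[OF i] nice_A[OF i] unfolding nice_def by blast
    have "\<exists>B\<ge>0. \<forall>j\<in>{..<n}. nice_with d B (Q i j)"
      by (rule finite_uniform_bound) (use nice_Q[OF i] nice_with_mono in \<open>auto simp: nice_def\<close>)
    then obtain B3 where B3: "\<forall>j<n. nice_with d B3 (Q i j)" by auto
    let ?B = "max B1 (max B2 B3)"
    have "nice_with d ?B (l i) \<and> nice_with d ?B (A i) \<and> (\<forall>j<n. nice_with d ?B (Q i j))"
      using nice_with_mono[OF B(1), of ?B] nice_with_mono[OF B(2), of ?B] nice_with_mono[of d B3 _ ?B] B3 by auto
    then show "\<exists>B. nice_with d B (l i) \<and> nice_with d B (A i) \<and> (\<forall>j<n. nice_with d B (Q i j))" by blast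
  qed (auto intro: nice_with_mono)
  then show ?thesis by auto
qed

lemma scheme:
  "\<exists>\<delta> K K1 K2 L \<theta>. 0 < \<delta> \<and> \<delta> \<le> d \<and> K * \<delta> \<le> 1 \<and>
    (\<forall>lam. \<bar>lam\<bar> \<le> lam0 \<longrightarrow> transport_scheme (lc lam) (hc lam) \<delta> K K1 K2 L \<theta>)"
proof -
  obtain B where B: "0 \<le> B" and nl: "\<And>i. i < n \<Longrightarrow> nice_with d B (l i)"
    and nA: "\<And>i. i < n \<Longrightarrow> nice_with d B (A i)" and nQ: "\<And>i j. i < n \<Longrightarrow> j < n \<Longrightarrow> nice_with d B (Q i j)"
    using uniform_bound by blast
  \<comment> \<open>With row sums at most 5/4 the source is bounded by \<open>B + 5 / 4 * K\<close>,
    and K = 2 B makes this at most \<open>2 * K\<close>.\<close>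
  define K where "K = 2 * B"
  define N where "N = real n"
  \<comment> \<open>The sum of all constants occurring in the Lipschitz and second difference
    estimates of l and h, collected in \<open>LB\<close>; the summand 1 absorbs errors of size
    1/16.\<close>
  define L where "L = 1 + B + B * (K + 1) + N * B + N * (B * (K + 1) * K) + N * (B * K + 2 * (B * 1))
    + (B + N * (B * K))"
  \<comment> \<open>This is 5/4 from the row sums plus 1/16 for the dependence of the coefficients
    on Y = t y.\<close>
  define \<theta> :: real where "\<theta> = 21 / 16"
  \<comment> \<open>Here \<open>L + \<theta> * K1\<close> is 25/4 L, below \<open>2 * K1\<close>,
    which is 8 L.\<close>
  define K1 where "K1 = 4 * L"
  define P where "P = L * (1 + K1)"
  \<comment> \<open>The same computation as for \<open>K1\<close>: with
    \<open>w = L * (1 + K1)\<^sup>2\<close>, the terms without \<open>\<delta>\<close> in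
    \<open>small2\<close> add up to 23/2 w, and the allowance is 16 w.\<close>
  define K2 where "K2 = 8 * (L * (1 + K1)\<^sup>2)"
  \<comment> \<open>Z dominates every quantity that has to become at most 1/16 after multiplication
    by \<open>\<delta>\<close>, so one choice of \<open>\<delta>\<close> serves all
    conditions.\<close>
  define Z where "Z = K + N * (B * (1 + K)) + (B + N * (B * K)) + K1 * P + K1 * L
    + (K2 * (2 * P + P\<^sup>2) + K1 * (L * (1 + K1)\<^sup>2 + L * K2))"
  have K: "0 \<le> K" and N: "0 \<le> N" using B by (auto simp: K_def N_def)
  have L: "1 \<le> L" unfolding L_def using B K N by simp
  have K1: "0 \<le> K1" using L by (simp add: K1_def)
  have P: "0 \<le> P" using L K1 by (simp add: P_def)
  have K2: "0 \<le> K2" using L by (simp add: K2_def)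
  have parts: "0 \<le> N * (B * (1 + K))" "0 \<le> B + N * (B * K)" "0 \<le> K1 * P" "0 \<le> K1 * L"
    "0 \<le> K2 * (2 * P + P\<^sup>2) + K1 * (L * (1 + K1)\<^sup>2 + L * K2)"
    using B K N L K1 K2 P by simp_all
  have Z: "0 \<le> Z" unfolding Z_def using parts K by linarith
  define \<delta> where "\<delta> = min d (1 / (16 * (Z + 1)))"
  have \<delta>: "0 < \<delta>" "\<delta> \<le> d" using d Z by (auto simp: \<delta>_def)
  have "\<delta> \<le> 1 / (16 * (Z + 1))" by (simp add: \<delta>_def)
  then have \<delta>Z1: "\<delta> * (16 * (Z + 1)) \<le> 1" using Z by (simp add: pos_le_divide_eq)
  have "\<delta> * (16 * (Z + 1)) = 16 * (\<delta> * Z) + 16 * \<delta>" by (simp add: algebra_simps)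
  then have \<delta>Z: "\<delta> * Z \<le> 1 / 16" "\<delta> \<le> 1 / 16"
    using \<delta>Z1 \<delta> mult_nonneg_nonneg[of \<delta> Z] Z by linarith+
  have small: "\<delta> * z \<le> 1 / 16" if "z \<le> Z" for z
    using mult_left_mono[OF that, of \<delta>] \<delta> \<delta>Z by linarith
  have sm: "\<delta> * K \<le> 1 / 16" "\<delta> * (N * (B * (1 + K))) \<le> 1 / 16" "\<delta> * (B + N * (B * K)) \<le> 1 / 16"
    "\<delta> * (K1 * P) \<le> 1 / 16" "\<delta> * (K1 * L) \<le> 1 / 16"
    "\<delta> * (K2 * (2 * P + P\<^sup>2) + K1 * (L * (1 + K1)\<^sup>2 + L * K2)) \<le> 1 / 16"
    using parts K by (intro small; simp only: Z_def; linarith)+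
  have sq: "\<delta>\<^sup>2 * z \<le> 1 / 16" if "\<delta> * z \<le> 1 / 16" "0 \<le> z" for z
  proof -
    have "\<delta>\<^sup>2 * z = \<delta> * (\<delta> * z)" by (simp add: power2_eq_square)
    also have "\<dots> \<le> 1 * (\<delta> * z)" using \<delta> \<delta>Z that by (intro mult_right_mono) auto
    finally show ?thesis using that by simp
  qed
  have "transport_scheme (lc lam) (hc lam) \<delta> K K1 K2 L \<theta>" if lam: "\<bar>lam\<bar> \<le> lam0" for lam
  proof -
    let ?p = "\<lambda>t x y. (lam, t, x, \<lambda>j. t * y j) :: pt"
    have ty: "\<bar>t * y j\<bar> \<le> 1" if "0 \<le> t" "t \<le> \<delta>" "\<And>j. \<bar>y j\<bar> \<le> K" for t y and j :: nat
    proof -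
      have "\<bar>t * y j\<bar> \<le> \<delta> * K" unfolding abs_mult using that \<delta> by (intro mult_mono) auto
      then show ?thesis using sm(1) by linarith
    qed
    have dom: "?p t x y \<in> dom_pt d" if "0 \<le> t" "t \<le> \<delta>" "\<And>j. \<bar>y j\<bar> \<le> K" for t x y
      using ty[OF that] that \<delta> lam lam0 by (auto simp: dom_pt_def)
    have near: "near d ((K + 1) * e) (?p t x y) (?p t' x' y')"
      if "0 \<le> t" "t \<le> \<delta>" "0 \<le> t'" "t' \<le> \<delta>" "\<And>j. \<bar>y j\<bar> \<le> K" "\<And>j. \<bar>y' j\<bar> \<le> K"
        "\<bar>t - t'\<bar> \<le> e" "\<bar>x - x'\<bar> \<le> e" "\<And>j. \<bar>y j - y' j\<bar> \<le> e" for t t' x x' y y' e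
    proof -
      have e0: "0 \<le> e" using that(7) by linarith
      have ee: "e \<le> (K + 1) * e" using K e0 by (simp add: algebra_simps)
      have "\<bar>t * y j - t' * y' j\<bar> \<le> (K + 1) * e" for j
      proof -
        have "t * y j - t' * y' j = (t - t') * y j + t' * (y j - y' j)" by (simp add: algebra_simps)
        moreover have "\<bar>(t - t') * y j\<bar> \<le> e * K" unfolding abs_mult using that(5,7) e0 by (intro mult_mono) auto
        moreover have "\<bar>t' * (y j - y' j)\<bar> \<le> 1 * e"
          unfolding abs_mult using that(3,4,9) \<delta>Z by (intro mult_mono) auto
        moreover have "(K + 1) * e = e * K + 1 * e" by (simp add: algebra_simps)
        ultimately show ?thesis by linarith
      qed
      then show ?thesis using dom[OF that(1,2,5)] dom[OF that(3,4,6)] that(7,8) ee by (auto simp: near_def)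
    qed
    \<comment> \<open>At equal times a change e of y moves Y only by \<open>t * e\<close>. The
      dependence of A and Q on Y therefore adds merely a multiple of t to the Lipschitz constant in
      y.\<close>
    have nearx: "near d (\<bar>x - x'\<bar> + t * e) (?p t x y) (?p t x' y')"
      if "0 \<le> t" "t \<le> \<delta>" "\<And>j. \<bar>y j\<bar> \<le> K" "\<And>j. \<bar>y' j\<bar> \<le> K" "\<And>j. \<bar>y j - y' j\<bar> \<le> e" for t x x' y y' e
    proof -
      have e0: "0 \<le> e" using that(5)[of 0] by linarith
      have te: "0 \<le> t * e" using e0 that by simp
      have "\<bar>t * y j - t * y' j\<bar> \<le> t * e" for j
        using mult_left_mono[OF that(5)[of j] that(1)] that(1) by (simp add: right_diff_distrib[symmetric] abs_mult)
      then show ?thesis using dom[OF that(1-3)] dom[OF that(1,2,4)] te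
        by (auto simp: near_def add_increasing intro: order_trans)
    qed
    have cen: "centred d e (?p t x (\<lambda>j. (y j + y' j) / 2)) (?p t (x + k) y) (?p t (x - k) y')"
      if "0 \<le> t" "t \<le> \<delta>" "\<And>j. \<bar>y j\<bar> \<le> K" "\<And>j. \<bar>y' j\<bar> \<le> K" "\<bar>k\<bar> \<le> e" "\<And>j. \<bar>y j - y' j\<bar> \<le> 2 * e" for t x k y y' e
    proof -
      have "\<bar>(y j + y' j) / 2\<bar> \<le> K" for j using that(3,4) by (rule abs_midpoint_le)
      note D = dom[OF that(1-3)] dom[OF that(1,2,4)] dom[OF that(1,2) this]
      have e0: "0 \<le> e" using that(5) by linarith
      have h: "\<bar>(y j - y' j) / 2\<bar> \<le> e" for j using that(6)[of j] by (simp add: abs_divide)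
      have t1: "\<bar>t * z\<bar> \<le> e" if z: "\<bar>z\<bar> \<le> e" for z
      proof -
        have "\<bar>t * z\<bar> \<le> 1 * e" unfolding abs_mult using z \<open>0 \<le> t\<close> \<open>t \<le> \<delta>\<close> \<delta>Z by (intro mult_mono) auto
        then show ?thesis by simp
      qed
      have eq: "t * ((y j + y' j) / 2) - t * y j = t * (- ((y j - y' j) / 2))"
        "t * ((y j + y' j) / 2) - t * y' j = t * ((y j - y' j) / 2)" for j by (simp_all add: field_simps)
      have "\<bar>t * ((y j + y' j) / 2) - t * y j\<bar> \<le> e" "\<bar>t * ((y j + y' j) / 2) - t * y' j\<bar> \<le> e" for j
        unfolding eq using h[of j] by (intro t1; simp)+
      moreover have "t * y j + t * y' j = 2 * (t * ((y j + y' j) / 2))" for j by (simp add: field_simps)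
      ultimately show ?thesis using D that(5) e0 unfolding centred_def near_def by simp
    qed
    \<comment> \<open>The point lies within distance \<open>\<delta> * (1 + K)\<close> of the
      reference point at t = 0, which changes the row sum by at most 1/16.\<close>
    have rowt: "(\<Sum>j<n. \<bar>Q i j (?p t x y)\<bar>) \<le> 5 / 4" if i: "i < n" and t: "0 \<le> t" "t \<le> \<delta>" "\<And>j. \<bar>y j\<bar> \<le> K" for i t x y
    proof -
      have "\<bar>Q i j (?p t x y)\<bar> \<le> \<bar>Q i j (lam, 0, x, \<lambda>_. 0)\<bar> + B * (\<delta> * (1 + K))" if "j < n" for j
      proof -
        have "\<bar>t * y j\<bar> \<le> \<delta> * (1 + K)" for j
          unfolding abs_mult using t(1,2) t(3)[of j] \<delta> by (intro mult_mono) auto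
        moreover have "t \<le> \<delta> * (1 + K)" "0 \<le> \<delta> * (1 + K)"
          using \<delta> K t by (simp_all add: algebra_simps add_increasing2)
        ultimately have "near d (\<delta> * (1 + K)) (?p t x y) (lam, 0, x, \<lambda>_. 0)"
          using dom[of t y x, OF t] dom[of 0 "\<lambda>_. 0" x] \<delta> K t(1) unfolding near_def by auto
        then have "\<bar>Q i j (?p t x y) - Q i j (lam, 0, x, \<lambda>_. 0)\<bar> \<le> B * (\<delta> * (1 + K))"
          by (rule nice_withD(3)[OF nQ[OF i that]])
        then show ?thesis by linarith
      qed
      then have "(\<Sum>j<n. \<bar>Q i j (?p t x y)\<bar>) \<le> (\<Sum>j<n. \<bar>Q i j (lam, 0, x, \<lambda>_. 0)\<bar> + B * (\<delta> * (1 + K)))"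
        by (intro sum_mono) auto
      also have "\<dots> = (\<Sum>j<n. \<bar>Q i j (lam, 0, x, \<lambda>_. 0)\<bar>) + \<delta> * (N * (B * (1 + K)))"
        by (simp add: sum.distrib N_def algebra_simps)
      finally show ?thesis using row[OF i lam, of x] sm(2) by linarith
    qed
    have LB: "B \<le> L" "B * (K + 1) \<le> L" "B * (K + 1) + (N * B + N * (B * (K + 1) * K)) \<le> L"
      "B + N * (B * K) \<le> L" "B + N * (B * K + 2 * (B * 1)) \<le> L"
      unfolding L_def using B K N by (simp_all add: add_nonneg_nonneg)
    show ?thesis
    proof
      show "0 < \<delta>" "\<delta> \<le> 1" using \<delta> \<delta>Z by auto
      show "0 \<le> K" "0 \<le> K1" "0 \<le> K2" "0 \<le> L" "0 \<le> \<theta>" using K K1 K2 L by (auto simp: \<theta>_def)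
      show "K1 * \<delta>\<^sup>2 * (L * (1 + K1)) + L + \<theta> * K1 \<le> 2 * K1"
      proof -
        have "K1 * \<delta>\<^sup>2 * (L * (1 + K1)) = \<delta>\<^sup>2 * (K1 * P)" by (simp add: P_def)
        also have "\<dots> \<le> 1 / 16" by (rule sq[OF sm(4) parts(3)])
        finally show ?thesis using L by (simp add: K1_def \<theta>_def)
      qed
      show "K2 * \<delta>\<^sup>2 * (2 * (L * (1 + K1)) + (L * (1 + K1))\<^sup>2) + K1 * \<delta>\<^sup>2 * (L * (1 + K1)\<^sup>2 + L * K2)
          + L * (1 + K1)\<^sup>2 + \<theta> * K2 \<le> 2 * K2"
      proof -
        have "K2 * \<delta>\<^sup>2 * (2 * (L * (1 + K1)) + (L * (1 + K1))\<^sup>2) + K1 * \<delta>\<^sup>2 * (L * (1 + K1)\<^sup>2 + L * K2)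
            = \<delta>\<^sup>2 * (K2 * (2 * P + P\<^sup>2) + K1 * (L * (1 + K1)\<^sup>2 + L * K2))"
          by (simp add: P_def algebra_simps)
        also have "\<dots> \<le> 1 / 16" by (rule sq[OF sm(6) parts(5)])
        finally have a: "K2 * \<delta>\<^sup>2 * (2 * (L * (1 + K1)) + (L * (1 + K1))\<^sup>2) + K1 * \<delta>\<^sup>2 * (L * (1 + K1)\<^sup>2 + L * K2) \<le> 1 / 16" .
        define w where "w = L * (1 + K1)\<^sup>2"
        have "1 \<le> (1 + K1)\<^sup>2" using K1 by (simp add: one_le_power)
        then have "1 \<le> w" using L mult_mono[of 1 L 1 "(1 + K1)\<^sup>2"] by (simp add: w_def)
        then show ?thesis using a unfolding K2_def w_def[symmetric] \<theta>_def by linarith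
      qed
      show "\<theta> + K1 * L * \<delta>\<^sup>2 \<le> 11 / 8"
        using sq[OF sm(5) parts(4)] by (simp add: \<theta>_def mult_ac)
    next
      fix i t x and y :: "nat \<Rightarrow> real"
      assume t: "0 \<le> t" "t \<le> \<delta>" and y: "\<And>j. \<bar>y j\<bar> \<le> K"
      have D: "?p t x y \<in> dom_pt d" by (rule dom[OF t y])
      show "\<bar>lc lam i t x y\<bar> \<le> L"
        using order_trans[OF nice_withD(2)[OF nl D] LB(1)] L by (auto simp: lc_def)
      show "\<bar>hc lam i t x y\<bar> \<le> 2 * K"
      proof (cases "i < n")
        case i: True
        have "\<bar>\<Sum>j<n. Q i j (?p t x y) * y j\<bar> \<le> (\<Sum>j<n. \<bar>Q i j (?p t x y)\<bar> * K)"
          by (rule order_trans[OF sum_abs sum_mono]) (use y in \<open>auto simp: abs_mult intro: mult_left_mono\<close>)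
        also have "\<dots> \<le> 5 / 4 * K" unfolding sum_distrib_right[symmetric] using rowt[OF i t y] K by (rule mult_right_mono)
        finally have "\<bar>hc lam i t x y\<bar> \<le> B + 5 / 4 * K"
          using nice_withD(2)[OF nA[OF i] D] i unfolding hc_def by simp
        then show ?thesis using B by (simp add: K_def)
      qed (use K in \<open>simp add: hc_def\<close>)
    next
      fix i t t' x x' e and y y' :: "nat \<Rightarrow> real"
      assume t: "0 \<le> t" "t \<le> \<delta>" "0 \<le> t'" "t' \<le> \<delta>" and y: "\<And>j. \<bar>y j\<bar> \<le> K" "\<And>j. \<bar>y' j\<bar> \<le> K"
        and e: "\<bar>t - t'\<bar> \<le> e" "\<bar>x - x'\<bar> \<le> e" "\<And>j. \<bar>y j - y' j\<bar> \<le> e"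
      note nr = near[OF t y e]
      have e0: "0 \<le> e" using e(1) by linarith
      show "\<bar>lc lam i t x y - lc lam i t' x' y'\<bar> \<le> L * e"
      proof (cases "i < n")
        case i: True
        have "\<bar>l i (?p t x y) - l i (?p t' x' y')\<bar> \<le> B * ((K + 1) * e)" by (rule nice_withD(3)[OF nl[OF i] nr])
        also have "\<dots> \<le> L * e" using LB(2) e0 by (simp only: mult.assoc[symmetric] mult_right_mono)
        finally show ?thesis using i by (simp add: lc_def)
      qed (use L e0 in \<open>simp add: lc_def\<close>)
      show "\<bar>hc lam i t x y - hc lam i t' x' y'\<bar> \<le> L * e"
      proof (cases "i < n")
        case i: True
        have 1: "\<bar>A i (?p t x y) - A i (?p t' x' y')\<bar> \<le> B * ((K + 1) * e)" by (rule nice_withD(3)[OF nA[OF i] nr])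
        \<comment> \<open>For the joint Lipschitz bound the size of the constant does not matter, so
          the crude row sum suffices; the sharp one enters only the estimate with
          \<open>\<theta>\<close> below.\<close>
        have "(\<Sum>j<n. \<bar>Q i j (?p t x y)\<bar>) \<le> (\<Sum>j<n. B)"
          by (intro sum_mono nice_withD(2)[OF nQ[OF i]] nearD(1)[OF nr]) auto
        then have S: "(\<Sum>j<n. \<bar>Q i j (?p t x y)\<bar>) \<le> N * B" by (simp add: N_def)
        have 2: "\<bar>(\<Sum>j<n. Q i j (?p t x y) * y j) - (\<Sum>j<n. Q i j (?p t' x' y') * y' j)\<bar>
            \<le> N * B * e + real n * (B * ((K + 1) * e) * K)"
          by (rule abs_sum_prod_diff_le[OF nice_withD(3)[OF nQ[OF i] nr] y(2) e(3) S])
        have "\<bar>hc lam i t x y - hc lam i t' x' y'\<bar> \<le> B * ((K + 1) * e) + (N * B * e + real n * (B * ((K + 1) * e) * K))"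
          using 1 2 i unfolding hc_def by simp
        also have "\<dots> = (B * (K + 1) + (N * B + N * (B * (K + 1) * K))) * e" by (simp add: N_def algebra_simps)
        also have "\<dots> \<le> L * e" using LB(3) e0 by (rule mult_right_mono)
        finally show ?thesis .
      qed (use L e0 in \<open>simp add: hc_def\<close>)
    next
      fix i t x x' e and y y' :: "nat \<Rightarrow> real"
      assume t: "0 \<le> t" "t \<le> \<delta>" and y: "\<And>j. \<bar>y j\<bar> \<le> K" "\<And>j. \<bar>y' j\<bar> \<le> K" and e: "\<And>j. \<bar>y j - y' j\<bar> \<le> e"
      have e0: "0 \<le> e" using e[of 0] by linarith
      let ?a = "\<bar>x - x'\<bar> + t * e"
      show "\<bar>hc lam i t x y - hc lam i t x' y'\<bar> \<le> L * \<bar>x - x'\<bar> + \<theta> * e"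
      proof (cases "i < n")
        case i: True
        note nr = nearx[OF t y e, of x x']
        have 1: "\<bar>A i (?p t x y) - A i (?p t x' y')\<bar> \<le> B * ?a" by (rule nice_withD(3)[OF nA[OF i] nr])
        have 2: "\<bar>(\<Sum>j<n. Q i j (?p t x y) * y j) - (\<Sum>j<n. Q i j (?p t x' y') * y' j)\<bar>
            \<le> 5 / 4 * e + real n * (B * ?a * K)"
          by (rule abs_sum_prod_diff_le[OF nice_withD(3)[OF nQ[OF i] nr] y(2) e rowt[OF i t y(1)]])
        have "\<bar>hc lam i t x y - hc lam i t x' y'\<bar> \<le> B * ?a + (5 / 4 * e + real n * (B * ?a * K))"
          using 1 2 i unfolding hc_def by simp
        also have "\<dots> = (B + N * (B * K)) * \<bar>x - x'\<bar> + (5 / 4 + t * (B + N * (B * K))) * e"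
          by (simp add: N_def algebra_simps)
        also have "\<dots> \<le> L * \<bar>x - x'\<bar> + \<theta> * e"
        proof (intro add_mono mult_right_mono LB e0 abs_ge_zero)
          have "t * (B + N * (B * K)) \<le> \<delta> * (B + N * (B * K))" using t parts(2) by (intro mult_right_mono)
          then show "5 / 4 + t * (B + N * (B * K)) \<le> \<theta>" using sm(3) unfolding \<theta>_def by linarith
        qed
        finally show ?thesis .
      qed (use L e0 in \<open>simp add: hc_def \<theta>_def\<close>)
    next
      fix i t x k e and y y' :: "nat \<Rightarrow> real"
      assume t: "0 \<le> t" "t \<le> \<delta>" and y: "\<And>j. \<bar>y j\<bar> \<le> K" "\<And>j. \<bar>y' j\<bar> \<le> K"
        and k: "\<bar>k\<bar> \<le> e" and e: "\<And>j. \<bar>y j - y' j\<bar> \<le> 2 * e"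
      let ?m = "\<lambda>j. (y j + y' j) / 2"
      have c: "centred d e (?p t x ?m) (?p t (x + k) y) (?p t (x - k) y')" by (rule cen[OF t y k e])
      note nr = centredD[OF c]
      have e2: "0 \<le> e\<^sup>2" by simp
      show "\<bar>lc lam i t (x + k) y + lc lam i t (x - k) y' - 2 * lc lam i t x ?m\<bar> \<le> L * e\<^sup>2"
      proof (cases "i < n")
        case i: True
        then show ?thesis using nice_withD(4)[OF nl[OF i] c] mult_right_mono[OF LB(1) e2] unfolding lc_def by simp
      qed (use L in \<open>simp add: lc_def\<close>)
      show "\<bar>hc lam i t (x + k) y + hc lam i t (x - k) y' - 2 * hc lam i t x ?m\<bar> \<le> L * e\<^sup>2"
      proof (cases "i < n")
        case i: True
        let ?q = "\<lambda>j. Q i j (?p t (x + k) y)" and ?q' = "\<lambda>j. Q i j (?p t (x - k) y')" and ?qm = "\<lambda>j. Q i j (?p t x ?m)"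
        have 1: "\<bar>A i (?p t (x + k) y) + A i (?p t (x - k) y') - 2 * A i (?p t x ?m)\<bar> \<le> B * e\<^sup>2"
          by (rule nice_withD(4)[OF nA[OF i] c])
        have eq: "(\<Sum>j<n. ?q j * y j) + (\<Sum>j<n. ?q' j * y' j) - 2 * (\<Sum>j<n. ?qm j * ?m j)
            = (\<Sum>j<n. ?q j * y j + ?q' j * y' j - 2 * (?qm j * ?m j))"
          by (simp only: sum.distrib sum_subtractf sum_distrib_left)
        have le: "\<bar>\<Sum>j<n. ?q j * y j + ?q' j * y' j - 2 * (?qm j * ?m j)\<bar> \<le> (\<Sum>j<n. K * (B * e\<^sup>2) + B * 0 + 2 * ((B * e) * e))"
        proof (rule order_trans[OF sum_abs sum_mono])
          fix j assume "j \<in> {..<n}"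
          then have j: "j < n" by simp
          have s: "\<bar>y j - ?m j\<bar> \<le> e" "\<bar>y' j - ?m j\<bar> \<le> e"
            using e[of j] by (auto simp: abs_le_iff field_simps)
          show "\<bar>?q j * y j + ?q' j * y' j - 2 * (?qm j * ?m j)\<bar> \<le> K * (B * e\<^sup>2) + B * 0 + 2 * ((B * e) * e)"
          proof (rule second_difference_product)
            show "\<bar>?qm j\<bar> \<le> B" by (rule nice_withD(2)[OF nQ[OF i j] nearD(1)[OF nr(1)]])
            show "\<bar>?m j\<bar> \<le> K" using y by (rule abs_midpoint_le)
            show "\<bar>?q j - ?qm j\<bar> \<le> B * e" "\<bar>?q' j - ?qm j\<bar> \<le> B * e"
              using nice_withD(3)[OF nQ[OF i j] nr(1)] nice_withD(3)[OF nQ[OF i j] nr(2)] by (auto simp: abs_minus_commute)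
            show "\<bar>?q j + ?q' j - 2 * ?qm j\<bar> \<le> B * e\<^sup>2" by (rule nice_withD(4)[OF nQ[OF i j] c])
          qed (use s in auto)
        qed
        have "(\<Sum>j<n. K * (B * e\<^sup>2) + B * 0 + 2 * ((B * e) * e)) = N * (K * (B * e\<^sup>2) + 2 * ((B * e) * e))"
          by (simp add: N_def)
        with le have 2: "\<bar>(\<Sum>j<n. ?q j * y j) + (\<Sum>j<n. ?q' j * y' j) - 2 * (\<Sum>j<n. ?qm j * ?m j)\<bar>
            \<le> N * (K * (B * e\<^sup>2) + 2 * ((B * e) * e))" unfolding eq by (simp only:)
        have lin: "(a + s) + (b + r) - 2 * (c + w) = (a + b - 2 * c) + (s + r - 2 * w)" for a b c r s w :: real by simp
        have "\<bar>hc lam i t (x + k) y + hc lam i t (x - k) y' - 2 * hc lam i t x ?m\<bar>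
            \<le> B * e\<^sup>2 + N * (K * (B * e\<^sup>2) + 2 * ((B * e) * e))"
          unfolding hc_def if_P[OF i] lin by (rule order_trans[OF abs_triangle_ineq add_mono[OF 1 2]])
        also have "\<dots> = (B + N * (B * K + 2 * (B * 1))) * e\<^sup>2" by (simp add: power2_eq_square algebra_simps)
        also have "\<dots> \<le> L * e\<^sup>2" using LB(5) e2 by (rule mult_right_mono)
        finally show ?thesis .
      qed (use L in \<open>simp add: hc_def\<close>)
    qed
  qed
  moreover have "K * \<delta> \<le> 1" using sm(1) by (simp add: mult.commute)
  ultimately show ?thesis using \<delta> by blast
qed

text \<open>The bound of W by t, a consequence of \<open>K * \<delta> \<le> 1\<close>, keeps W / t
  inside the domain on which the coefficients are regular.\<close>

theorem fuchsian_solution: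
  "\<exists>\<delta>>0. \<delta> \<le> d \<and> (\<forall>lam. \<bar>lam\<bar> \<le> lam0 \<longrightarrow> (\<exists>W Wt Wx. (\<forall>i. C1_strip \<delta> (W i) (Wt i) (Wx i)) \<and>
     (\<forall>i t x. 0 \<le> t \<and> t \<le> \<delta> \<longrightarrow> \<bar>W i t x\<bar> \<le> t) \<and> (\<forall>i x. i < n \<longrightarrow> W i 0 x = 0 \<and> Wt i 0 x = 0) \<and>
     (\<forall>i t x. i < n \<and> 0 < t \<and> t \<le> \<delta> \<longrightarrow>
        Wt i t x + t * l i (lam, t, x, \<lambda>j. W j t x / t) * Wx i t x =
        t * (A i (lam, t, x, \<lambda>j. W j t x / t) + (\<Sum>j<n. Q i j (lam, t, x, \<lambda>j. W j t x / t) * (W j t x / t\<^sup>2))))))"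
proof -
  obtain \<delta> K K1 K2 L \<theta> where \<delta>: "0 < \<delta>" "\<delta> \<le> d" "K * \<delta> \<le> 1"
    and S: "\<And>lam. \<bar>lam\<bar> \<le> lam0 \<Longrightarrow> transport_scheme (lc lam) (hc lam) \<delta> K K1 K2 L \<theta>"
    using scheme by blast
  have "\<exists>W Wt Wx. (\<forall>i. C1_strip \<delta> (W i) (Wt i) (Wx i)) \<and>
     (\<forall>i t x. 0 \<le> t \<and> t \<le> \<delta> \<longrightarrow> \<bar>W i t x\<bar> \<le> t) \<and> (\<forall>i x. i < n \<longrightarrow> W i 0 x = 0 \<and> Wt i 0 x = 0) \<and>
     (\<forall>i t x. i < n \<and> 0 < t \<and> t \<le> \<delta> \<longrightarrow>
        Wt i t x + t * l i (lam, t, x, \<lambda>j. W j t x / t) * Wx i t x =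
        t * (A i (lam, t, x, \<lambda>j. W j t x / t) + (\<Sum>j<n. Q i j (lam, t, x, \<lambda>j. W j t x / t) * (W j t x / t\<^sup>2))))"
    if lam: "\<bar>lam\<bar> \<le> lam0" for lam
  proof -
    from transport_scheme.transport_solution[OF S[OF lam]] obtain W Wt Wx where
      C: "\<forall>i. C1_strip \<delta> (W i) (Wt i) (Wx i)" and
      W: "\<forall>i t x. 0 \<le> t \<and> t \<le> \<delta> \<longrightarrow> \<bar>W i t x\<bar> \<le> K * t\<^sup>2 \<and>
        Wt i t x + t * lc lam i t x (\<lambda>j. W j t x / t\<^sup>2) * Wx i t x = t * hc lam i t x (\<lambda>j. W j t x / t\<^sup>2)" by blast
    have K: "0 \<le> K" using S[OF lam] by (auto simp: transport_scheme_def)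
    have "\<bar>W i t x\<bar> \<le> t" if "0 \<le> t \<and> t \<le> \<delta>" for i t x
    proof -
      have "\<bar>W i t x\<bar> \<le> K * t\<^sup>2" using W that by blast
      also have "\<dots> = (K * t) * t" by (simp add: power2_eq_square)
      also have "\<dots> \<le> 1 * t"
        using that K \<delta>(3) mult_left_mono[of t \<delta> K] by (intro mult_right_mono) auto
      finally show ?thesis by simp
    qed
    moreover have "W i 0 x = 0 \<and> Wt i 0 x = 0" for i x
      using W[rule_format, of 0 i x] \<delta> by simp
    moreover have "Wt i t x + t * l i (lam, t, x, \<lambda>j. W j t x / t) * Wx i t x =
        t * (A i (lam, t, x, \<lambda>j. W j t x / t) + (\<Sum>j<n. Q i j (lam, t, x, \<lambda>j. W j t x / t) * (W j t x / t\<^sup>2)))"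
      if "i < n \<and> 0 < t \<and> t \<le> \<delta>" for i t x
    proof -
      have "(\<lambda>j. t * (W j t x / t\<^sup>2)) = (\<lambda>j. W j t x / t)" using that by (simp add: power2_eq_square)
      moreover have "Wt i t x + t * lc lam i t x (\<lambda>j. W j t x / t\<^sup>2) * Wx i t x = t * hc lam i t x (\<lambda>j. W j t x / t\<^sup>2)"
        using W that by auto
      ultimately show ?thesis using that unfolding lc_def hc_def by simp
    qed
    ultimately show ?thesis using C by blast
  qed
  then show ?thesis using \<delta> by blast
qed

end

section \<open>The degenerate wave system\<close>

lemma nice_divide_const: "nice d F \<Longrightarrow> nice d (\<lambda>p. F p / c)"
  using nice_mult[OF _ nice_const[of d "inverse c"]] by (simp add: divide_inverse)

lemma nice_power2: "nice d F \<Longrightarrow> nice d (\<lambda>p. (F p)\<^sup>2)"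
  using nice_mult[of d F F] by (simp add: power2_eq_square)

lemmas nice_intros = nice_const nice_add nice_diff nice_minus nice_mult nice_lam nice_time nice_Y
  nice_divide_const nice_power2

lemma dom_pt_mono: "d \<le> d' \<Longrightarrow> p \<in> dom_pt d \<Longrightarrow> p \<in> dom_pt d'"
  by (auto simp: dom_pt_def)

section \<open>Taylor formulas with integral remainder\<close>

lemma smooth_fun_DERIV_affine:
  assumes "smooth_fun f"
  shows "((\<lambda>r. f (z + r * s)) has_real_derivative s * deriv f (z + r * s)) (at r)"
proof -
  have "((\<lambda>r. z + r * s) has_real_derivative s) (at r)" by (auto intro!: derivative_eq_intros)
  from DERIV_chain2[OF smooth_fun_DERIV[OF assms] this] show ?thesis by (simp add: mult.commute)
qed

text \<open>The weight 1 is written out so that the integral has the form treated in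
  \<open>nice_average\<close>.\<close>

lemma taylor_integral_1:
  assumes g: "smooth_fun g"
  shows "g (z + s) = g z + s * integral {0..1} (\<lambda>r. 1 * deriv g (z + r * s))"
proof -
  have "((\<lambda>r. s * (1 * deriv g (z + r * s))) has_integral (g (z + 1 * s) - g (z + 0 * s))) {0..1}"
  proof (rule fundamental_theorem_of_calculus)
    show "((\<lambda>r. g (z + r * s)) has_vector_derivative s * (1 * deriv g (z + r * s))) (at r within {0..1})" for r
      unfolding has_real_derivative_iff_has_vector_derivative[symmetric]
      using has_field_derivative_at_within[OF smooth_fun_DERIV_affine[OF g]] by simp
  qed simp
  then have "integral {0..1} (\<lambda>r. s * (1 * deriv g (z + r * s))) = g (z + 1 * s) - g (z + 0 * s)"
    by (rule integral_unique)
  then show ?thesis by simp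
qed

lemma taylor_integral_2:
  assumes g: "smooth_fun g"
  shows "g (z + s) = g z + s * (deriv g z + s * integral {0..1} (\<lambda>r. (1 - r) * deriv (deriv g) (z + r * s)))"
proof -
  \<comment> \<open>When ?F is differentiated in r, the first order terms cancel and only the
    integrand of the remainder is left.\<close>
  let ?F = "\<lambda>r. g (z + r * s) + (1 - r) * s * deriv g (z + r * s)"
  have "((\<lambda>r. s * s * ((1 - r) * deriv (deriv g) (z + r * s))) has_integral (?F 1 - ?F 0)) {0..1}"
  proof (rule fundamental_theorem_of_calculus)
    note * = smooth_fun_DERIV_affine
    have "(?F has_real_derivative s * deriv g (z + r * s) + (- s * deriv g (z + r * s) + (1 - r) * s * (s * deriv (deriv g) (z + r * s)))) (at r)" for r
      by (rule DERIV_cong, rule DERIV_add[OF *[OF g] DERIV_mult[OF _ *[OF smooth_fun_deriv[OF g]]]])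
         (auto intro!: derivative_eq_intros)
    then have "(?F has_real_derivative s * s * ((1 - r) * deriv (deriv g) (z + r * s))) (at r)" for r
      by (rule DERIV_cong) (simp add: algebra_simps)
    then show "(?F has_vector_derivative s * s * ((1 - r) * deriv (deriv g) (z + r * s))) (at r within {0..1})" for r
      unfolding has_real_derivative_iff_has_vector_derivative[symmetric]
      using has_field_derivative_at_within by blast
  qed simp
  then have "integral {0..1} (\<lambda>r. s * s * ((1 - r) * deriv (deriv g) (z + r * s))) = ?F 1 - ?F 0"
    by (rule integral_unique)
  then have "s * s * integral {0..1} (\<lambda>r. (1 - r) * deriv (deriv g) (z + r * s)) = g (z + s) - (g z + s * deriv g z)"
    unfolding integral_mult_right by simp
  then show ?thesis unfolding distrib_left mult.assoc[symmetric] by linarith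
qed

text \<open>The weight \<epsilon> obeys two constraints: the bound by \<open>\<psi>0 / 4\<close>
  keeps the quotient \<open>(u - \<phi>\<^sub>1) / t\<close> away from 0, and the last condition
  keeps the coupling of R2 and S2 to the remainder of u small in the row sums.\<close>

locale wave_data =
  fixes c a \<phi>2 \<psi>1 \<psi>2 :: "real \<Rightarrow> real" and \<phi>1 m0 \<psi>0 \<epsilon> :: real
  assumes c_smooth: "smooth_fun c" and a_smooth: "smooth_fun a"
    and m0_pos: "m0 > 0"
    and c'_lower: "\<And>z. \<bar>deriv c z\<bar> \<ge> m0"
    and a_lower: "\<And>z. \<bar>a z\<bar> \<ge> m0"
    and c_phi1: "c \<phi>1 = 0"
    and phi2_smooth: "smooth_fun \<phi>2" and psi1_smooth: "smooth_fun \<psi>1" and psi2_smooth: "smooth_fun \<psi>2"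
    and phi2_bdd: "\<And>j. j \<in> {1,2,3,4} \<Longrightarrow> bounded (range ((deriv ^^ j) \<phi>2))"
    and psi1_bdd: "\<And>k. k \<in> {0,1,2,3} \<Longrightarrow> bounded (range ((deriv ^^ k) \<psi>1))"
    and psi2_bdd: "\<And>k. k \<in> {0,1,2,3} \<Longrightarrow> bounded (range ((deriv ^^ k) \<psi>2))"
    and psi0_pos: "\<psi>0 > 0"
    and psi1_lower: "\<And>x. \<bar>\<psi>1 x\<bar> \<ge> \<psi>0"
    and eps: "0 < \<epsilon>" "\<epsilon> \<le> 1" "\<epsilon> \<le> \<psi>0 / 4" "\<And>x. \<epsilon> * \<bar>deriv c \<phi>1 * deriv \<phi>2 x\<bar> \<le> 1 / 16"
begin

text \<open>
  The components \<open>W\<^sub>0, \<dots>, W\<^sub>5\<close> are the remainders of \<open>R1, S1, R2, S2, u / \<epsilon>, v\<close>. The factor \<open>\<epsilon>\<close> is there because \<open>u\<close> enters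
  the equations of \<open>R2, S2\<close> with the coefficient \<open>c'(\<phi>\<^sub>1) \<phi>\<^sub>2'\<close>, which need not be small. In terms of a point,
  \<open>sg = (u - \<phi>\<^sub>1) / t\<close>, \<open>c(u) = t sg C1\<close>, \<open>E = t / c(u)\<close>, \<open>pp = (R2 - S2) / c(u)\<close>; the functions \<open>bd\<close> and \<open>gd\<close> are the difference
  quotients of \<open>a a'\<close> and \<open>a' / a\<close> between \<open>\<phi>\<^sub>1\<close> and \<open>u\<close>, and \<open>M\<close> comes from \<open>pp - 2 \<phi>\<^sub>2' = O(t)\<close>.
\<close>

definition \<kappa> where "\<kappa> = deriv c \<phi>1"
definition a0 where "a0 = a \<phi>1"
definition a1 where "a1 = deriv a \<phi>1"
definition P1 where "P1 p = \<psi>1 (px p)" for p :: pt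
definition P1x where "P1x p = deriv \<psi>1 (px p)" for p :: pt
definition P2 where "P2 p = \<psi>2 (px p)" for p :: pt
definition P2x where "P2x p = deriv \<psi>2 (px p)" for p :: pt
definition X where "X p = deriv \<phi>2 (px p)" for p :: pt
definition Xx where "Xx p = deriv (deriv \<phi>2) (px p)" for p :: pt
definition F11 where "F11 p = a0 * a1 * (P2 p)\<^sup>2 + 2 * pl p * a0 * a1 * X p" for p
definition F11x where "F11x p = a0 * a1 * (2 * P2 p * P2x p) + 2 * pl p * a0 * a1 * Xx p" for p
definition F21 where "F21 p = \<kappa> * P1 p * X p - 2 * a1 / a0 * P1 p * P2 p" for p
definition F21x where "F21x p = \<kappa> * (P1x p * X p + P1 p * Xx p) - 2 * a1 / a0 * (P1x p * P2 p + P1 p * P2x p)" for p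
definition F22 where "F22 p = - \<kappa> * P1 p * X p - 2 * a1 / a0 * P1 p * P2 p" for p
definition F22x where "F22x p = - \<kappa> * (P1x p * X p + P1 p * Xx p) - 2 * a1 / a0 * (P1x p * P2 p + P1 p * P2x p)" for p
definition sg where "sg p = P1 p + pt p * (F11 p / 2) + \<epsilon> * pY p 4" for p
definition ts where "ts p = pt p * sg p" for p
definition C2 where "C2 p = integral {0..1} (\<lambda>r. (1 - r) * deriv (deriv c) (\<phi>1 + r * ts p))" for p
definition C1 where "C1 p = \<kappa> + ts p * C2 p" for p
definition cp where "cp p = deriv c (\<phi>1 + ts p)" for p
definition A where "A p = a (\<phi>1 + ts p)" for p
definition Ap where "Ap p = deriv a (\<phi>1 + ts p)" for p
definition Dc where "Dc p = integral {0..1} (\<lambda>r. 1 * deriv (deriv c) (\<phi>1 + r * ts p))" for p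
definition Da where "Da p = integral {0..1} (\<lambda>r. 1 * deriv a (\<phi>1 + r * ts p))" for p
definition Dap where "Dap p = integral {0..1} (\<lambda>r. 1 * deriv (deriv a) (\<phi>1 + r * ts p))" for p
definition E where "E p = inverse (sg p * C1 p)" for p
definition iA where "iA p = inverse (A p)" for p
definition R1 where "R1 p = P1 p + pt p * (F11 p + pY p 0)" for p
definition S1 where "S1 p = P1 p + pt p * (F11 p + pY p 1)" for p
definition R2 where "R2 p = P2 p + pt p * (F21 p + pY p 2)" for p
definition S2 where "S2 p = P2 p + pt p * (F22 p + pY p 3)" for p
definition pp where "pp p = (2 * \<kappa> * P1 p * X p + pY p 2 - pY p 3) * E p" for p
definition bd where "bd p = Da p * Ap p + a0 * Dap p" for p
definition gd where "gd p = Dap p * iA p - a1 / a0 * Da p * iA p" for p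
definition M where "M p = - 2 * X p * (P1 p * sg p * C2 p + F11 p / 2 * C1 p)" for p
text \<open>\<open>G1\<close> and \<open>G2\<close> collect the regular terms of order t in the
  sources, divided by t; \<open>G1\<close> excludes the value at t = 0 and the part linear in y.
  They are read off from \<open>source_1\<close> and \<open>source_2\<close>.\<close>

definition G1 where "G1 p = pl p * (A p * Ap p * E p * M p + 2 * X p * sg p * bd p) - (A p)\<^sup>2 * cp p / 4 * (pp p)\<^sup>2 * (sg p * C1 p)
  + sg p * bd p * R2 p * S2 p
  + a0 * a1 * (P2 p * (F21 p + pY p 2 + (F22 p + pY p 3)) + pt p * (F21 p + pY p 2) * (F22 p + pY p 3))" for p
definition G2 where "G2 p = sg p * gd p * (R1 p * S2 p + S1 p * R2 p)
  + a1 / a0 * (P1 p * (F22 p + pY p 3) + P2 p * (F11 p + pY p 0) + pt p * (F11 p + pY p 0) * (F22 p + pY p 3)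
    + P1 p * (F21 p + pY p 2) + P2 p * (F11 p + pY p 1) + pt p * (F11 p + pY p 1) * (F21 p + pY p 2))" for p

text \<open>The terms with \<open>sg p * C1 p\<close> outside \<open>G1\<close> and
  \<open>G2\<close> are c(u) / t times the x-derivative of the Taylor polynomial. They appear as
  sources because only the remainder is transported.\<close>

definition Af :: "nat \<Rightarrow> pt \<Rightarrow> real" where
  "Af i = [\<lambda>p. G1 p + sg p * C1 p * (P1x p + pt p * F11x p),
     \<lambda>p. G1 p - sg p * C1 p * (P1x p + pt p * F11x p),
     \<lambda>p. cp p * R1 p * E p / 2 * M p + X p * (sg p * Dc p * R1 p + \<kappa> * (F11 p + pY p 0)) - G2 p + sg p * C1 p * (P2x p + pt p * F21x p),
     \<lambda>p. - (cp p * S1 p * E p / 2 * M p + X p * (sg p * Dc p * S1 p + \<kappa> * (F11 p + pY p 1))) - G2 p - sg p * C1 p * (P2x p + pt p * F22x p),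
     \<lambda>p. 0, \<lambda>p. 0] ! i"

definition lf :: "nat \<Rightarrow> pt \<Rightarrow> real" where
  "lf i = [\<lambda>p. - (sg p * C1 p), \<lambda>p. sg p * C1 p, \<lambda>p. - (sg p * C1 p), \<lambda>p. sg p * C1 p, \<lambda>p. 0, \<lambda>p. 0] ! i"

definition Qc where "Qc p = cp p * (R1 p + S1 p) * E p / 4" for p
definition Ql where "Ql p = pl p * A p * Ap p * E p" for p
definition Qe where "Qe p = - 2 * \<epsilon> * (X p * C1 p)" for p
definition Qg where "Qg p = pl p * Ap p * iA p * E p" for p
definition Qr where "Qr p = cp p * R1 p * E p / 2" for p
definition Qs where "Qs p = cp p * S1 p * E p / 2" for p

text \<open>Column j multiplies \<open>W\<^sub>j / t\<^sup>2\<close>. The last two rows belong to u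
  and v, whose equations have no singular term; written in the common form they carry a factor t and
  vanish at t = 0.\<close>

definition Qf :: "nat \<Rightarrow> nat \<Rightarrow> pt \<Rightarrow> real" where
  "Qf i j = [[Qc, \<lambda>p. - Qc p, Ql, \<lambda>p. - Ql p, \<lambda>p. Ql p * Qe p, \<lambda>p. 0],
     [\<lambda>p. - Qc p, Qc, Ql, \<lambda>p. - Ql p, \<lambda>p. Ql p * Qe p, \<lambda>p. 0],
     [\<lambda>p. - Qg p, Qg, Qr, \<lambda>p. - Qr p, \<lambda>p. Qr p * Qe p, \<lambda>p. 0],
     [\<lambda>p. - Qg p, Qg, \<lambda>p. - Qs p, Qs, \<lambda>p. - (Qs p * Qe p), \<lambda>p. 0],
     [\<lambda>p. pt p / (2 * \<epsilon>), \<lambda>p. pt p / (2 * \<epsilon>), \<lambda>p. 0, \<lambda>p. 0, \<lambda>p. 0, \<lambda>p. 0],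
     [\<lambda>p. 0, \<lambda>p. 0, \<lambda>p. pt p / 2, \<lambda>p. pt p / 2, \<lambda>p. 0, \<lambda>p. 0]] ! i ! j"

section \<open>Regularity and lower bounds of the coefficients\<close>

lemma a_ne: "a z \<noteq> 0" using a_lower[of z] m0_pos by auto

text \<open>Regularity of a function of x takes two bounded derivatives beyond the function itself.
  Since the sources contain the second derivative of \<open>\<phi>2\<close> and the first ones of
  \<open>\<psi>1\<close> and \<open>\<psi>2\<close>, derivatives up to orders 4 and 3 enter.\<close>

lemma nice_data: "nice d P1" "nice d P1x" "nice d P2" "nice d P2x" "nice d X" "nice d Xx"
  unfolding P1_def[abs_def] P1x_def[abs_def] P2_def[abs_def] P2x_def[abs_def] X_def[abs_def] Xx_def[abs_def]
  using psi1_smooth psi2_smooth phi2_smooth psi1_bdd psi2_bdd phi2_bdd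
    psi1_bdd[of 0] psi1_bdd[of 1] psi1_bdd[of 2] psi1_bdd[of 3]
    psi2_bdd[of 0] psi2_bdd[of 1] psi2_bdd[of 2] psi2_bdd[of 3]
    phi2_bdd[of 1] phi2_bdd[of 2] phi2_bdd[of 3] phi2_bdd[of 4]
  by (intro nice_smooth_x; simp add: smooth_fun_deriv eval_nat_numeral)+

lemma nice_F: "nice d F11" "nice d F11x" "nice d F21" "nice d F21x" "nice d F22" "nice d F22x" "nice d sg" "nice d ts"
proof -
  show F: "nice d F11" "nice d F11x" "nice d F21" "nice d F21x" "nice d F22" "nice d F22x"
    unfolding F11_def[abs_def] F11x_def[abs_def] F21_def[abs_def] F21x_def[abs_def] F22_def[abs_def] F22x_def[abs_def]
    by (intro nice_intros nice_data)+
  show sg: "nice d sg" unfolding sg_def[abs_def] by (intro nice_intros nice_data F)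
  show "nice d ts" unfolding ts_def[abs_def] by (intro nice_intros sg)
qed

lemma nice_coeff: "nice d C2" "nice d C1" "nice d cp" "nice d A" "nice d Ap" "nice d Dc" "nice d Da" "nice d Dap"
proof -
  note sm = c_smooth a_smooth smooth_fun_deriv
  show C2: "nice d C2" unfolding C2_def[abs_def]
    by (rule nice_average[OF _ nice_F(8)]) (auto intro!: sm continuous_intros)
  show "nice d C1" unfolding C1_def[abs_def] by (intro nice_intros nice_F C2)
  show "nice d Dc" "nice d Da" "nice d Dap" unfolding Dc_def[abs_def] Da_def[abs_def] Dap_def[abs_def]
    by (rule nice_average[OF _ nice_F(8)]; auto intro!: sm continuous_intros)+
  have s: "nice d (\<lambda>p. \<phi>1 + ts p)" by (intro nice_intros nice_F)
  show "nice d cp" "nice d A" "nice d Ap" unfolding cp_def[abs_def] A_def[abs_def] Ap_def[abs_def]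
    by (intro nice_smooth[OF _ s] sm)+
qed

lemma nice_iA: "nice d iA"
  unfolding iA_def[abs_def] using m0_pos a_lower by (intro nice_inverse[OF nice_coeff(4)]) (auto simp: A_def)

lemma c_eq: "c (\<phi>1 + ts p) = ts p * C1 p"
  using taylor_integral_2[OF c_smooth, of \<phi>1 "ts p"] c_phi1 by (simp add: C1_def C2_def \<kappa>_def)

text \<open>\<open>C1\<close> is the difference quotient of c between \<open>\<phi>1\<close> and u,
  hence a value of the derivative of c by the mean value theorem. The bound thus holds without any
  restriction to u near \<open>\<phi>1\<close>.\<close>

lemma C1_lower: "m0 \<le> \<bar>C1 p\<bar>"
proof (cases "ts p = 0")
  case True
  then show ?thesis using c'_lower[of \<phi>1] by (simp add: C1_def \<kappa>_def)
next
  case False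
  have "\<exists>z. c (\<phi>1 + ts p) - c \<phi>1 = ts p * deriv c z"
  proof (cases "ts p > 0")
    case True
    then obtain z where "c (\<phi>1 + ts p) - c \<phi>1 = (\<phi>1 + ts p - \<phi>1) * deriv c z"
      using MVT2[of \<phi>1 "\<phi>1 + ts p" c "deriv c"] smooth_fun_DERIV[OF c_smooth] by auto
    then show ?thesis by auto
  next
    case neg: False
    then obtain z where "c \<phi>1 - c (\<phi>1 + ts p) = (\<phi>1 - (\<phi>1 + ts p)) * deriv c z"
      using MVT2[of "\<phi>1 + ts p" \<phi>1 c "deriv c"] smooth_fun_DERIV[OF c_smooth] False by auto
    then show ?thesis by (intro exI[of _ z]) (simp add: algebra_simps)
  qed
  then obtain z where "ts p * C1 p = ts p * deriv c z" using c_eq c_phi1 by auto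
  then show ?thesis using False c'_lower by simp
qed

text \<open>Both perturbations of \<open>\<psi>1\<close> in \<open>sg\<close> are at most
  \<open>\<psi>0 / 4\<close>: the term in \<open>F11\<close> by the choice of d, the remainder of u
  by that of \<epsilon>.\<close>

lemma sg_lower: "\<exists>d>0. d \<le> 1 \<and> (\<forall>p\<in>dom_pt d. \<psi>0 / 2 \<le> \<bar>sg p\<bar>)"
proof -
  obtain B where B: "nice_with 1 B F11" using nice_F(1) unfolding nice_def by blast
  have B0: "0 \<le> B" by (rule nice_withD(1)[OF B])
  define d where "d = min 1 (\<psi>0 / (2 * (B + 1)))"
  have d: "0 < d" "d \<le> 1" "d \<le> \<psi>0 / (2 * (B + 1))" using psi0_pos B0 by (auto simp: d_def)
  have "\<psi>0 / 2 \<le> \<bar>sg p\<bar>" if p: "p \<in> dom_pt d" for p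
  proof -
    have q: "0 \<le> pt p" "pt p \<le> d" "\<bar>pY p 4\<bar> \<le> 1" using p by (auto simp: dom_pt_def)
    have "\<bar>F11 p\<bar> \<le> B" by (rule nice_withD(2)[OF B dom_pt_mono[OF d(2) p]])
    then have "\<bar>pt p * (F11 p / 2)\<bar> \<le> \<psi>0 / (2 * (B + 1)) * ((B + 1) / 2)"
      unfolding abs_mult using q d B0 psi0_pos by (intro mult_mono) auto
    also have "\<dots> = \<psi>0 / 4" using B0 by (simp add: field_simps)
    finally have 1: "\<bar>pt p * (F11 p / 2)\<bar> \<le> \<psi>0 / 4" .
    have "\<bar>\<epsilon> * pY p 4\<bar> \<le> \<epsilon> * 1" unfolding abs_mult using eps q by (intro mult_mono) auto
    then have 2: "\<bar>\<epsilon> * pY p 4\<bar> \<le> \<psi>0 / 4" using eps by simp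
    have "\<psi>0 \<le> \<bar>P1 p\<bar>" using psi1_lower by (simp add: P1_def)
    then show ?thesis unfolding sg_def using 1 2 by linarith
  qed
  then show ?thesis using d by blast
qed

end

text \<open>All six unknowns have this form, a polynomial of degree 2 in t plus a weighted
  remainder. For R1, S1, R2, S2 the function k is 0; the weight e differs from the literal 1 only
  for u.\<close>

lemma C1_strip_expansion:
  assumes f: "\<And>x. (f has_real_derivative f' x) (at x)" and f': "continuous_on UNIV f'"
    and g: "\<And>x. (g has_real_derivative g' x) (at x)" and g': "continuous_on UNIV g'"
    and k: "\<And>x. (k has_real_derivative k' x) (at x)" and k': "continuous_on UNIV k'"
    and W: "C1_strip d W Wt Wx"
  shows "C1_strip d (\<lambda>t x. f x + t * g x + t\<^sup>2 * k x + e * W t x) (\<lambda>t x. g x + 2 * t * k x + e * Wt t x)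
    (\<lambda>t x. f' x + t * g' x + t\<^sup>2 * k' x + e * Wx t x)"
  unfolding C1_strip_def
proof (intro conjI ballI)
  have cont: "continuous_on UNIV g" "continuous_on UNIV k"
    by (rule DERIV_continuous_on, rule g, rule DERIV_continuous_on, rule k)
  have snd: "continuous_on (strip d) (\<lambda>p. h (snd p))" if "continuous_on UNIV h" for h :: "real \<Rightarrow> real"
    by (intro continuous_on_compose2[OF that] continuous_intros) auto
  have Wc: "continuous_on (strip d) (\<lambda>p. Wt (fst p) (snd p))" "continuous_on (strip d) (\<lambda>p. Wx (fst p) (snd p))"
    using W unfolding C1_strip_def by auto
  show "continuous_on (strip d) (\<lambda>p. g (snd p) + 2 * fst p * k (snd p) + e * Wt (fst p) (snd p))"
    by (intro continuous_intros snd cont Wc)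
  show "continuous_on (strip d) (\<lambda>p. f' (snd p) + fst p * g' (snd p) + (fst p)\<^sup>2 * k' (snd p) + e * Wx (fst p) (snd p))"
    by (intro continuous_intros snd f' g' k' Wc)
  fix p assume p: "p \<in> strip d"
  have D: "((\<lambda>q. h (snd q)) has_derivative (\<lambda>z. snd z * h')) (at p within strip d)"
    if "(h has_real_derivative h') (at (snd p))" for h h'
    by (rule DERIV_compose_FDERIV[where g = snd, OF that]) (intro derivative_eq_intros, auto)
  have DW: "((\<lambda>q. W (fst q) (snd q)) has_derivative (\<lambda>z. Wt (fst p) (snd p) * fst z + Wx (fst p) (snd p) * snd z)) (at p within strip d)"
    using W p unfolding C1_strip_def by blast
  have T: "(fst has_derivative fst) (at p within strip d)" by (intro derivative_eq_intros) auto
  show "((\<lambda>q. f (snd q) + fst q * g (snd q) + (fst q)\<^sup>2 * k (snd q) + e * W (fst q) (snd q)) has_derivative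
      (\<lambda>z. (g (snd p) + 2 * fst p * k (snd p) + e * Wt (fst p) (snd p)) * fst z +
        (f' (snd p) + fst p * g' (snd p) + (fst p)\<^sup>2 * k' (snd p) + e * Wx (fst p) (snd p)) * snd z)) (at p within strip d)"
    by (rule has_derivative_eq_rhs,
        rule has_derivative_add[OF has_derivative_add[OF has_derivative_add[OF D[OF f] has_derivative_mult[OF T D[OF g]]]
          has_derivative_mult[OF has_derivative_power[OF T, of 2] D[OF k]]] has_derivative_mult_right[OF DW]])
       (auto simp: fun_eq_iff algebra_simps)
qed

section \<open>Row sums at the initial time\<close>

context wave_data
begin

text \<open>At t = 0 the entries containing \<open>\<lambda>\<close> are \<open>\<lambda>\<close>
  times \<open>a0 * a1\<close> or \<open>a1 / a0\<close>, divided by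
  \<open>\<psi>\<^sub>1 * \<kappa>\<close>, which is at least \<open>\<psi>0 * m0\<close> in
  absolute value. The choice makes each of them at most 1/32.\<close>

definition lam0 where
  "lam0 = min 1 (1 / (32 * (1 + \<bar>a0 * a1\<bar> / (\<psi>0 * m0) + \<bar>a1 / a0\<bar> / (\<psi>0 * m0))))"

lemma lam0_bounds: "0 < lam0" "lam0 \<le> 1"
proof -
  have "0 < 1 + \<bar>a0 * a1\<bar> / (\<psi>0 * m0) + \<bar>a1 / a0\<bar> / (\<psi>0 * m0)"
    using psi0_pos m0_pos by (intro add_pos_nonneg divide_nonneg_nonneg) auto
  then show "0 < lam0" "lam0 \<le> 1" unfolding lam0_def by auto
qed

lemma less_6: "i < 6 \<longleftrightarrow> i \<in> {0, 1, 2, 3, 4, 5 :: nat}" by auto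

lemma sum_6: "(\<Sum>j<6. f j) = f 0 + f 1 + f 2 + f 3 + f 4 + f (5 :: nat)" for f :: "nat \<Rightarrow> real"
  by (simp add: eval_nat_numeral)

text \<open>At t = 0 each of the first four rows has two entries of modulus 1/2, coming from the
  quotient with c(u), and two entries of size at most 1/32. The coupling to u adds at most 1/16 in
  the rows of R2 and S2, which gives exactly 1 + 1/16 + 1/16 = 9/8.\<close>

lemma row_sum:
  assumes lam: "\<bar>lam\<bar> \<le> lam0" and i: "i < 6"
  shows "(\<Sum>j<6. \<bar>Qf i j (lam, 0, x, \<lambda>_. 0)\<bar>) \<le> 9 / 8"
proof -
  let ?p = "(lam, 0, x, \<lambda>_. 0) :: pt"
  let ?u = "\<psi>1 x"
  have nz: "?u \<noteq> 0" "\<kappa> \<noteq> 0" using psi1_lower[of x] psi0_pos c'_lower[of \<phi>1] m0_pos by (auto simp: \<kappa>_def)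
  have b: "sg ?p = ?u" "ts ?p = 0" "C1 ?p = \<kappa>" "R1 ?p = ?u" "S1 ?p = ?u"
    by (auto simp: sg_def ts_def C1_def R1_def S1_def P1_def)
  have b': "cp ?p = \<kappa>" "A ?p = a0" "Ap ?p = a1" "iA ?p = inverse a0" "E ?p = inverse (?u * \<kappa>)"
    by (auto simp: cp_def A_def Ap_def iA_def E_def b \<kappa>_def a0_def a1_def)
  have half: "Qc ?p = 1 / 2" "Qr ?p = 1 / 2" "Qs ?p = 1 / 2"
    using nz by (auto simp: Qc_def Qr_def Qs_def b b' field_simps)
  have e: "\<bar>Qe ?p\<bar> \<le> 1 / 8" using eps(4)[of x] eps(1) by (simp add: Qe_def b X_def \<kappa>_def abs_mult mult_ac)
  have "\<psi>0 * m0 \<le> \<bar>?u\<bar> * \<bar>\<kappa>\<bar>"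
    using psi1_lower[of x] c'_lower[of \<phi>1] psi0_pos m0_pos by (intro mult_mono) (auto simp: \<kappa>_def)
  then have w: "\<bar>inverse (?u * \<kappa>)\<bar> \<le> 1 / (\<psi>0 * m0)"
    using psi0_pos m0_pos by (simp add: abs_mult abs_inverse inverse_eq_divide frac_le)
  have lamb: "\<bar>lam * z * inverse (?u * \<kappa>)\<bar> \<le> 1 / 32"
    if "\<bar>z\<bar> / (\<psi>0 * m0) \<le> \<bar>a0 * a1\<bar> / (\<psi>0 * m0) + \<bar>a1 / a0\<bar> / (\<psi>0 * m0)" for z
  proof -
    define s where "s = 1 + \<bar>a0 * a1\<bar> / (\<psi>0 * m0) + \<bar>a1 / a0\<bar> / (\<psi>0 * m0)"
    have s: "0 < s" unfolding s_def using psi0_pos m0_pos by (intro add_pos_nonneg divide_nonneg_nonneg) auto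
    have "\<bar>lam * z * inverse (?u * \<kappa>)\<bar> = \<bar>lam\<bar> * (\<bar>z\<bar> * \<bar>inverse (?u * \<kappa>)\<bar>)" by (simp add: abs_mult)
    also have "\<dots> \<le> 1 / (32 * s) * (\<bar>z\<bar> * (1 / (\<psi>0 * m0)))"
      using lam w s by (intro mult_mono mult_left_mono) (auto simp: lam0_def s_def)
    also have "\<dots> \<le> 1 / (32 * s) * s" using that s by (intro mult_left_mono) (auto simp: s_def)
    also have "\<dots> = 1 / 32" using s by simp
    finally show ?thesis .
  qed
  have pos: "0 \<le> \<bar>a0 * a1\<bar> / (\<psi>0 * m0)" "0 \<le> \<bar>a1 / a0\<bar> / (\<psi>0 * m0)"
    using psi0_pos m0_pos by (auto intro!: divide_nonneg_nonneg mult_nonneg_nonneg)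
  have l: "\<bar>Ql ?p\<bar> \<le> 1 / 32" using lamb[of "a0 * a1"] pos(2) by (simp add: Ql_def b' mult.assoc)
  have "Qg ?p = lam * (a1 / a0) * inverse (?u * \<kappa>)" unfolding Qg_def b' divide_inverse by (simp only: mult.assoc fst_conv)
  moreover have "\<bar>lam * (a1 / a0) * inverse (?u * \<kappa>)\<bar> \<le> 1 / 32" by (rule lamb) (use pos(1) in linarith)
  ultimately have g: "\<bar>Qg ?p\<bar> \<le> 1 / 32" by (simp only:)
  have le: "\<bar>Ql ?p * Qe ?p\<bar> \<le> 1 / 32 * (1 / 8)" unfolding abs_mult using l e by (intro mult_mono) auto
  show ?thesis using i l g le e unfolding less_6 sum_6 Qf_def by (auto simp: half)
qed

lemma system:
  assumes d: "0 < d" and sgl: "\<And>p. p \<in> dom_pt d \<Longrightarrow> \<psi>0 / 2 \<le> \<bar>sg p\<bar>"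
  shows "fuchsian_system lf Af Qf 6 d lam0"
proof -
  have "\<psi>0 / 2 * m0 \<le> \<bar>sg p * C1 p\<bar>" if "p \<in> dom_pt d" for p
    unfolding abs_mult using sgl[OF that] C1_lower[of p] psi0_pos m0_pos by (intro mult_mono) auto
  then have E: "nice d E" unfolding E_def[abs_def]
    using psi0_pos m0_pos by (intro nice_inverse[where m = "\<psi>0 / 2 * m0"] nice_intros nice_F nice_coeff) auto
  note n1 = nice_intros nice_data nice_F nice_coeff nice_iA E
  have n2: "nice d R1" "nice d S1" "nice d R2" "nice d S2" "nice d pp" "nice d bd" "nice d gd" "nice d M"
    unfolding R1_def[abs_def] S1_def[abs_def] R2_def[abs_def] S2_def[abs_def] pp_def[abs_def] bd_def[abs_def]
      gd_def[abs_def] M_def[abs_def] by (intro n1)+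
  have n3: "nice d G1" "nice d G2" "nice d Qc" "nice d Ql" "nice d Qe" "nice d Qg" "nice d Qr" "nice d Qs"
    unfolding G1_def[abs_def] G2_def[abs_def] Qc_def[abs_def] Ql_def[abs_def] Qe_def[abs_def]
      Qg_def[abs_def] Qr_def[abs_def] Qs_def[abs_def] by (intro n1 n2)+
  show ?thesis
  proof
    show "0 < d" "lam0 \<le> 1" using d lam0_bounds by auto
    show "nice d (lf i)" if "i < 6" for i
      using that unfolding less_6 lf_def by (elim insertE emptyE) (simp_all, (intro n1)+)
    show "nice d (Af i)" if "i < 6" for i
      using that unfolding less_6 Af_def by (elim insertE emptyE) (simp_all, (intro n1 n2 n3)+)
    show "nice d (Qf i j)" if "i < 6" "j < 6" for i j
      using that unfolding less_6 Qf_def by (elim insertE emptyE) (simp_all, (intro n1 n2 n3)+)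
    show "(\<Sum>j<6. \<bar>Qf i j (lam, 0, x, \<lambda>_. 0)\<bar>) \<le> 9 / 8" if "i < 6" "\<bar>lam\<bar> \<le> lam0" for i lam x
      by (rule row_sum[OF that(2,1)])
  qed
qed

section \<open>Expansion of the sources at the initial time\<close>

lemma A_eq: "A p = a0 + pt p * sg p * Da p"
  using taylor_integral_1[OF a_smooth, of \<phi>1 "ts p"] by (simp add: A_def Da_def a0_def ts_def)

lemma Ap_eq: "Ap p = a1 + pt p * sg p * Dap p"
  using taylor_integral_1[OF smooth_fun_deriv[OF a_smooth], of \<phi>1 "ts p"] by (simp add: Ap_def Dap_def a1_def ts_def)

lemma cp_eq: "cp p = \<kappa> + pt p * sg p * Dc p"
  using taylor_integral_1[OF smooth_fun_deriv[OF c_smooth], of \<phi>1 "ts p"] by (simp add: cp_def Dc_def \<kappa>_def ts_def)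

lemma AAp_eq: "A p * Ap p = a0 * a1 + pt p * (sg p * bd p)"
proof -
  have "A p * Ap p = a0 * Ap p + pt p * sg p * Da p * Ap p" by (subst A_eq) (simp add: algebra_simps)
  also have "a0 * Ap p = a0 * a1 + pt p * sg p * (a0 * Dap p)" by (subst Ap_eq) (simp add: algebra_simps)
  finally show ?thesis by (simp add: bd_def algebra_simps)
qed

lemma ApiA_eq: "Ap p * iA p = a1 / a0 + pt p * (sg p * gd p)"
proof -
  have a0: "a0 \<noteq> 0" using a_ne by (simp add: a0_def)
  have iA: "iA p * A p = 1" using a_ne by (simp add: iA_def A_def)
  have "Ap p * iA p - a1 / a0 * (iA p * A p) = iA p * (Ap p - a1 / a0 * A p)" by (simp add: algebra_simps)
  also have "Ap p - a1 / a0 * A p = pt p * sg p * (Dap p - a1 / a0 * Da p)"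
    unfolding Ap_eq A_eq using a0 by (simp add: algebra_simps)
  finally show ?thesis unfolding iA gd_def by (simp add: algebra_simps)
qed

lemma source_2: "Ap p * iA p * (R1 p * S2 p + S1 p * R2 p) = 2 * a1 / a0 * P1 p * P2 p + pt p * G2 p"
proof -
  have "R1 p * S2 p + S1 p * R2 p = 2 * P1 p * P2 p + pt p * (P1 p * (F22 p + pY p 3) + P2 p * (F11 p + pY p 0) + pt p * (F11 p + pY p 0) * (F22 p + pY p 3)
    + P1 p * (F21 p + pY p 2) + P2 p * (F11 p + pY p 1) + pt p * (F11 p + pY p 1) * (F21 p + pY p 2))"
    (is "_ = _ + pt p * ?G")
    unfolding R1_def R2_def S1_def S2_def by (simp add: algebra_simps)
  then have "a1 / a0 * (R1 p * S2 p + S1 p * R2 p) = a1 / a0 * (2 * P1 p * P2 p) + pt p * (a1 / a0 * ?G)" by (simp add: algebra_simps)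
  then show ?thesis unfolding ApiA_eq distrib_right G2_def by (simp add: algebra_simps)
qed

context
  fixes p :: pt and y :: "nat \<Rightarrow> real"
  assumes y: "\<And>j. pY p j = pt p * y j" and sg0: "sg p \<noteq> 0"
begin

lemma E_inv: "E p * (sg p * C1 p) = 1"
proof -
  have "C1 p \<noteq> 0" using C1_lower[of p] m0_pos by auto
  then show ?thesis unfolding E_def using sg0 by (intro left_inverse) simp
qed

text \<open>Numerator and denominator of (R2 - S2) / c(u) both vanish to first order in t, with
  leading coefficients \<open>2 * \<kappa> * P1 * X\<close> and \<open>\<kappa> * P1\<close>. The
  quotient therefore starts with 2 \<open>\<phi>\<^sub>2'\<close>, and the next order is linear in y
  up to the regular term \<open>M\<close>.\<close>

lemma pp_eq: "pp p = 2 * X p + pt p * (E p * (y 2 - y 3 + M p + Qe p * y 4))"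
proof -
  have s: "sg p = P1 p + pt p * (F11 p / 2 + \<epsilon> * y 4)" by (simp add: sg_def y algebra_simps)
  have "P1 p * C1 p = P1 p * \<kappa> + pt p * (P1 p * sg p * C2 p)" by (simp add: C1_def ts_def algebra_simps)
  moreover have "sg p * C1 p = P1 p * C1 p + pt p * (F11 p / 2 + \<epsilon> * y 4) * C1 p"
    by (subst s) (simp add: algebra_simps)
  ultimately have sC: "sg p * C1 p = P1 p * \<kappa> + pt p * (P1 p * sg p * C2 p) + pt p * (F11 p / 2 + \<epsilon> * y 4) * C1 p" by simp
  \<comment> \<open>By \<open>sC\<close>, \<open>sg p * C1 p\<close> differs from
    \<open>\<kappa> * P1 p\<close> by a multiple of t, so that multiple times
    \<open>- 2 * X p\<close> is the whole error of replacing one by the other.\<close>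
  have key: "2 * \<kappa> * P1 p * X p = 2 * X p * (sg p * C1 p) + pt p * (M p + Qe p * y 4)"
    unfolding sC M_def Qe_def by (simp add: algebra_simps)
  have "pp p = (2 * X p * (sg p * C1 p) + pt p * (M p + Qe p * y 4) + pt p * y 2 - pt p * y 3) * E p"
    unfolding pp_def key y ..
  also have "\<dots> = 2 * X p * (E p * (sg p * C1 p)) + pt p * (E p * (y 2 - y 3 + M p + Qe p * y 4))"
    by (simp add: algebra_simps)
  finally show ?thesis unfolding E_inv by simp
qed

text \<open>This identifies f11 as the compatible initial derivative: the squared difference over
  c(u) equals \<open>(pp p)\<^sup>2\<close> times c(u) and vanishes at t = 0, while the
  \<open>\<lambda>\<close> term tends to 2 \<open>\<lambda>\<close> a a'
  \<open>\<phi>\<^sub>2'\<close> and the last product to a a'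
  \<open>\<psi>\<^sub>2\<^sup>2\<close>.\<close>

lemma source_1:
  "pl p * A p * Ap p * pp p - (A p)\<^sup>2 * cp p / 4 * ((pp p)\<^sup>2 * (pt p * (sg p * C1 p))) + A p * Ap p * R2 p * S2 p
    = F11 p + pt p * (G1 p + Ql p * (y 2 - y 3) + Ql p * Qe p * y 4)"
proof -
  have 1: "pl p * A p * Ap p * pp p = pl p * (A p * Ap p) * (2 * X p) + pt p * (Ql p * (y 2 - y 3 + M p + Qe p * y 4))"
    unfolding pp_eq Ql_def by (simp add: algebra_simps)
  have 2: "pl p * (A p * Ap p) * (2 * X p) = 2 * pl p * a0 * a1 * X p + pt p * (pl p * (2 * X p * sg p * bd p))"
    unfolding AAp_eq by (simp add: algebra_simps)
  have 3: "A p * Ap p * R2 p * S2 p = a0 * a1 * (R2 p * S2 p) + pt p * (sg p * bd p * R2 p * S2 p)"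
    unfolding AAp_eq by (simp add: algebra_simps)
  have 4: "R2 p * S2 p = (P2 p)\<^sup>2 + pt p * (P2 p * (F21 p + pY p 2 + (F22 p + pY p 3)) + pt p * (F21 p + pY p 2) * (F22 p + pY p 3))"
    unfolding R2_def S2_def by (simp add: power2_eq_square algebra_simps)
  show ?thesis unfolding 1 2 3 unfolding 4 unfolding G1_def F11_def Ql_def by (simp add: algebra_simps)
qed

text \<open>Z is R1 or S1. The leading term is the first summand of f21; in the equation of S2 it
  occurs with the opposite sign, as in f22.\<close>

lemma source_3:
  assumes "Z = P1 p + pt p * z"
  shows "cp p * Z / 2 * pp p = \<kappa> * P1 p * X p + pt p * (cp p * Z * E p / 2 * (y 2 - y 3 + M p + Qe p * y 4) + X p * (sg p * Dc p * Z + \<kappa> * z))"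
proof -
  have 1: "cp p * Z / 2 * pp p = cp p * Z * X p + pt p * (cp p * Z * E p / 2 * (y 2 - y 3 + M p + Qe p * y 4))"
    unfolding pp_eq by (simp add: algebra_simps)
  have 2: "cp p * Z * X p = \<kappa> * Z * X p + pt p * (X p * (sg p * Dc p * Z))" by (subst cp_eq) (simp add: algebra_simps)
  have 3: "\<kappa> * Z * X p = \<kappa> * P1 p * X p + pt p * (X p * (\<kappa> * z))" unfolding assms by (simp add: algebra_simps)
  show ?thesis unfolding 1 2 3 by (simp add: algebra_simps)
qed

end

section \<open>The Taylor coefficients as functions of x\<close>

lemma f_derivs:
  "(f11 a \<phi>1 lam \<phi>2 \<psi>2 has_real_derivative F11x (lam, t, x, Y)) (at x)"
  "(f21 c a \<phi>1 \<phi>2 \<psi>1 \<psi>2 has_real_derivative F21x (lam, t, x, Y)) (at x)"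
  "(f22 c a \<phi>1 \<phi>2 \<psi>1 \<psi>2 has_real_derivative F22x (lam, t, x, Y)) (at x)"
proof -
  define q where "q = 2 * deriv a \<phi>1 / a \<phi>1"
  note D = smooth_fun_DERIV[OF psi1_smooth] smooth_fun_DERIV[OF psi2_smooth] smooth_fun_DERIV[OF smooth_fun_deriv[OF phi2_smooth]]
  show "(f11 a \<phi>1 lam \<phi>2 \<psi>2 has_real_derivative F11x (lam, t, x, Y)) (at x)"
    unfolding f11_def[abs_def] F11x_def P2_def P2x_def Xx_def a0_def a1_def
    by (auto intro!: derivative_eq_intros D)
  show "(f21 c a \<phi>1 \<phi>2 \<psi>1 \<psi>2 has_real_derivative F21x (lam, t, x, Y)) (at x)"
    unfolding f21_def[abs_def] F21x_def P1_def P1x_def P2_def P2x_def X_def Xx_def a0_def a1_def \<kappa>_def q_def[symmetric]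
    by (auto intro!: derivative_eq_intros D simp: algebra_simps)
  show "(f22 c a \<phi>1 \<phi>2 \<psi>1 \<psi>2 has_real_derivative F22x (lam, t, x, Y)) (at x)"
    unfolding f22_def[abs_def] F22x_def P1_def P1x_def P2_def P2x_def X_def Xx_def a0_def a1_def \<kappa>_def q_def[symmetric]
    by (auto intro!: derivative_eq_intros D simp: algebra_simps)
qed

lemma f_derivs_continuous:
  "continuous_on UNIV (\<lambda>x. F11x (lam, t, x, Y))" "continuous_on UNIV (\<lambda>x. F21x (lam, t, x, Y))"
  "continuous_on UNIV (\<lambda>x. F22x (lam, t, x, Y))"
  unfolding F11x_def F21x_def F22x_def P1_def P1x_def P2_def P2x_def X_def Xx_def fst_conv snd_conv
  by (intro continuous_intros smooth_fun_continuous smooth_fun_deriv psi1_smooth psi2_smooth phi2_smooth)+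

lemma f_values: "f11 a \<phi>1 lam \<phi>2 \<psi>2 x = F11 (lam, t, x, Y)" "f21 c a \<phi>1 \<phi>2 \<psi>1 \<psi>2 x = F21 (lam, t, x, Y)"
  "f22 c a \<phi>1 \<phi>2 \<psi>1 \<psi>2 x = F22 (lam, t, x, Y)"
  by (auto simp: f11_def F11_def f21_def F21_def f22_def F22_def P1_def P2_def X_def a0_def a1_def \<kappa>_def)

section \<open>From the remainder equations back to the wave system\<close>

context
  fixes p :: pt and w wt wx :: "nat \<Rightarrow> real"
  assumes t: "pt p > 0" and Y: "\<And>j. pY p j = w j / pt p" and sg0: "sg p \<noteq> 0"
    and eq: "\<And>i. i < 6 \<Longrightarrow> wt i + pt p * lf i p * wx i = pt p * (Af i p + (\<Sum>j<6. Qf i j p * (w j / (pt p)\<^sup>2)))"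
begin

lemma Y': "pY p j = pt p * (w j / (pt p)\<^sup>2)"
  using t by (simp add: Y power2_eq_square)

lemma speed: "c (\<phi>1 + ts p) = pt p * (sg p * C1 p)"
  unfolding c_eq by (simp add: ts_def)

lemma speed_ne: "c (\<phi>1 + ts p) \<noteq> 0"
  using t sg0 C1_lower[of p] m0_pos by (auto simp: speed)

text \<open>R1 and S1 have the same Taylor polynomial, so their difference is that of the
  remainders, of order t^2; division by c(u) leaves a factor t, as required of a right-hand
  side.\<close>

lemma quot_1: "(R1 p - S1 p) / c (\<phi>1 + ts p) = pt p * ((w 0 / (pt p)\<^sup>2 - w 1 / (pt p)\<^sup>2) * E p)"
proof -
  have "R1 p - S1 p = pt p * (pt p * (w 0 / (pt p)\<^sup>2 - w 1 / (pt p)\<^sup>2))"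
    unfolding R1_def S1_def Y' by (simp only: algebra_simps)
  then show ?thesis using t unfolding speed E_def by (simp add: divide_inverse)
qed

lemma quot_2: "(R2 p - S2 p) / c (\<phi>1 + ts p) = pp p"
proof -
  have "R2 p - S2 p = pt p * (2 * \<kappa> * P1 p * X p + pY p 2 - pY p 3)"
    unfolding R2_def S2_def F21_def F22_def by (simp add: algebra_simps)
  then show ?thesis using t unfolding speed pp_def E_def by (simp add: divide_inverse)
qed

lemma quot_3: "(R2 p - S2 p)\<^sup>2 / c (\<phi>1 + ts p) = (pp p)\<^sup>2 * (pt p * (sg p * C1 p))"
proof -
  have "R2 p - S2 p = pp p * c (\<phi>1 + ts p)" using quot_2 speed_ne by (simp add: field_simps)
  then show ?thesis using speed_ne by (simp add: power2_eq_square speed)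
qed

lemma wave_R1: "F11 p + wt 0 - c (\<phi>1 + ts p) * (P1x p + pt p * F11x p + wx 0) =
    cp p * (R1 p + S1 p) / 4 * ((R1 p - S1 p) / c (\<phi>1 + ts p)) + pl p * A p * Ap p * ((R2 p - S2 p) / c (\<phi>1 + ts p))
    - (A p)\<^sup>2 * cp p / 4 * ((R2 p - S2 p)\<^sup>2 / c (\<phi>1 + ts p)) + A p * Ap p * R2 p * S2 p"
proof -
  define y where "y j = w j / (pt p)\<^sup>2" for j
  have "wt 0 = pt p * (sg p * C1 p) * wx 0 + pt p * (G1 p + sg p * C1 p * (P1x p + pt p * F11x p) + (Qc p * y 0 - Qc p * y 1 + Ql p * y 2 - Ql p * y 3 + Ql p * Qe p * y 4))"
    using eq[of 0] unfolding sum_6 y_def by (simp add: lf_def Af_def Qf_def)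
  moreover have "pl p * A p * Ap p * pp p - (A p)\<^sup>2 * cp p / 4 * ((pp p)\<^sup>2 * (pt p * (sg p * C1 p))) + A p * Ap p * R2 p * S2 p
    = F11 p + pt p * (G1 p + Ql p * (y 2 - y 3) + Ql p * Qe p * y 4)"
    by (rule source_1[OF _ sg0]) (simp only: Y' y_def)
  moreover have "cp p * (R1 p + S1 p) / 4 * (pt p * ((y 0 - y 1) * E p)) = pt p * (Qc p * (y 0 - y 1))" by (simp add: Qc_def)
  ultimately show ?thesis unfolding quot_1 quot_2 quot_3 y_def[symmetric] unfolding speed by (simp add: algebra_simps)
qed

lemma wave_S1: "F11 p + wt 1 + c (\<phi>1 + ts p) * (P1x p + pt p * F11x p + wx 1) =
    cp p * (R1 p + S1 p) / 4 * ((S1 p - R1 p) / c (\<phi>1 + ts p)) + pl p * A p * Ap p * ((R2 p - S2 p) / c (\<phi>1 + ts p))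
    - (A p)\<^sup>2 * cp p / 4 * ((R2 p - S2 p)\<^sup>2 / c (\<phi>1 + ts p)) + A p * Ap p * R2 p * S2 p"
proof -
  define y where "y j = w j / (pt p)\<^sup>2" for j
  have q: "(S1 p - R1 p) / c (\<phi>1 + ts p) = - (pt p * ((y 0 - y 1) * E p))"
    using quot_1 unfolding y_def by (metis minus_diff_eq minus_divide_left)
  have "wt 1 = - (pt p * (sg p * C1 p) * wx 1) + pt p * (G1 p - sg p * C1 p * (P1x p + pt p * F11x p) + (- Qc p * y 0 + Qc p * y 1 + Ql p * y 2 - Ql p * y 3 + Ql p * Qe p * y 4))"
    using eq[of 1] unfolding sum_6 y_def by (simp add: lf_def Af_def Qf_def)
  moreover have "pl p * A p * Ap p * pp p - (A p)\<^sup>2 * cp p / 4 * ((pp p)\<^sup>2 * (pt p * (sg p * C1 p))) + A p * Ap p * R2 p * S2 p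
    = F11 p + pt p * (G1 p + Ql p * (y 2 - y 3) + Ql p * Qe p * y 4)"
    by (rule source_1[OF _ sg0]) (simp only: Y' y_def)
  moreover have "cp p * (R1 p + S1 p) / 4 * - (pt p * ((y 0 - y 1) * E p)) = - (pt p * (Qc p * (y 0 - y 1)))" by (simp add: Qc_def)
  ultimately show ?thesis unfolding q quot_2 quot_3 unfolding speed by (simp add: algebra_simps)
qed

lemma wave_R2: "F21 p + wt 2 - c (\<phi>1 + ts p) * (P2x p + pt p * F21x p + wx 2) =
    cp p * R1 p / 2 * ((R2 p - S2 p) / c (\<phi>1 + ts p)) - pl p * Ap p / A p * ((R1 p - S1 p) / c (\<phi>1 + ts p))
    - Ap p / A p * (R1 p * S2 p + S1 p * R2 p)"
proof -
  define y where "y j = w j / (pt p)\<^sup>2" for j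
  have "wt 2 = pt p * (sg p * C1 p) * wx 2 + pt p * (Qr p * M p + X p * (sg p * Dc p * R1 p + \<kappa> * (F11 p + pY p 0)) - G2 p
      + sg p * C1 p * (P2x p + pt p * F21x p) + (- Qg p * y 0 + Qg p * y 1 + Qr p * y 2 - Qr p * y 3 + Qr p * Qe p * y 4))"
    using eq[of 2] unfolding sum_6 y_def by (simp add: lf_def Af_def Qf_def Qr_def)
  moreover have "cp p * R1 p / 2 * pp p = \<kappa> * P1 p * X p + pt p * (Qr p * (y 2 - y 3 + M p + Qe p * y 4) + X p * (sg p * Dc p * R1 p + \<kappa> * (F11 p + pY p 0)))"
    unfolding Qr_def by (rule source_3[OF _ sg0 R1_def]) (simp only: Y' y_def)
  moreover have "Ap p / A p * (R1 p * S2 p + S1 p * R2 p) = 2 * a1 / a0 * P1 p * P2 p + pt p * G2 p"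
    using source_2[of p] by (simp add: iA_def divide_inverse)
  moreover have "pl p * Ap p / A p * (pt p * ((y 0 - y 1) * E p)) = pt p * (Qg p * (y 0 - y 1))"
    by (simp add: Qg_def iA_def divide_inverse)
  ultimately show ?thesis unfolding quot_1 quot_2 y_def[symmetric] unfolding speed F21_def by (simp add: algebra_simps)
qed

lemma wave_S2: "F22 p + wt 3 + c (\<phi>1 + ts p) * (P2x p + pt p * F22x p + wx 3) =
    cp p * S1 p / 2 * ((S2 p - R2 p) / c (\<phi>1 + ts p)) - pl p * Ap p / A p * ((R1 p - S1 p) / c (\<phi>1 + ts p))
    - Ap p / A p * (R1 p * S2 p + S1 p * R2 p)"
proof -
  define y where "y j = w j / (pt p)\<^sup>2" for j
  have q: "(S2 p - R2 p) / c (\<phi>1 + ts p) = - pp p"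
    using quot_2 by (metis minus_diff_eq minus_divide_left)
  have "wt 3 = - (pt p * (sg p * C1 p) * wx 3) + pt p * (- (Qs p * M p + X p * (sg p * Dc p * S1 p + \<kappa> * (F11 p + pY p 1))) - G2 p
      - sg p * C1 p * (P2x p + pt p * F22x p) + (- Qg p * y 0 + Qg p * y 1 - Qs p * y 2 + Qs p * y 3 - Qs p * Qe p * y 4))"
    using eq[of 3] unfolding sum_6 y_def by (simp add: lf_def Af_def Qf_def Qs_def)
  moreover have "cp p * S1 p / 2 * pp p = \<kappa> * P1 p * X p + pt p * (Qs p * (y 2 - y 3 + M p + Qe p * y 4) + X p * (sg p * Dc p * S1 p + \<kappa> * (F11 p + pY p 1)))"
    unfolding Qs_def by (rule source_3[OF _ sg0 S1_def]) (simp only: Y' y_def)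
  moreover have "Ap p / A p * (R1 p * S2 p + S1 p * R2 p) = 2 * a1 / a0 * P1 p * P2 p + pt p * G2 p"
    using source_2[of p] by (simp add: iA_def divide_inverse)
  moreover have "pl p * Ap p / A p * (pt p * ((y 0 - y 1) * E p)) = pt p * (Qg p * (y 0 - y 1))"
    by (simp add: Qg_def iA_def divide_inverse)
  ultimately show ?thesis unfolding q quot_1 y_def[symmetric] unfolding speed F22_def by (simp add: algebra_simps)
qed

text \<open>The factor t in row 4, the outer factor t and the denominator t^2 cancel, and \<epsilon>
  removes the scaling of the remainder of u.\<close>

lemma wave_u: "P1 p + pt p * F11 p + \<epsilon> * wt 4 = (R1 p + S1 p) / 2"
proof -
  have "wt 4 = pt p * (pt p / (2 * \<epsilon>) * (w 0 / (pt p)\<^sup>2) + pt p / (2 * \<epsilon>) * (w 1 / (pt p)\<^sup>2))"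
    using eq[of 4] unfolding sum_6 by (simp add: lf_def Af_def Qf_def)
  moreover have "pt p * (pt p / (2 * \<epsilon>) * (z / (pt p)\<^sup>2)) = z / (2 * \<epsilon>)" for z
    using t by (simp add: power2_eq_square)
  ultimately have "wt 4 = w 0 / (2 * \<epsilon>) + w 1 / (2 * \<epsilon>)" by (simp only: distrib_left)
  then have "\<epsilon> * wt 4 = (w 0 + w 1) / 2" using eps(1) by (simp add: field_simps)
  moreover have "pt p * (F11 p + w j / pt p) = pt p * F11 p + w j" for j using t by (simp add: distrib_left)
  ultimately show ?thesis unfolding R1_def S1_def Y by simp
qed

lemma wave_v: "P2 p + pt p * ((F21 p + F22 p) / 2) + wt 5 = (R2 p + S2 p) / 2"
proof -
  have "wt 5 = pt p * (pt p / 2 * (w 2 / (pt p)\<^sup>2) + pt p / 2 * (w 3 / (pt p)\<^sup>2))"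
    using eq[of 5] unfolding sum_6 by (simp add: lf_def Af_def Qf_def)
  moreover have "pt p * (pt p / 2 * (z / (pt p)\<^sup>2)) = z / 2" for z
    using t by (simp add: power2_eq_square)
  ultimately have "wt 5 = w 2 / 2 + w 3 / 2" by (simp only: distrib_left)
  moreover have "pt p * (z + w j / pt p) = pt p * z + w j" for z j using t by (simp add: distrib_left)
  ultimately show ?thesis unfolding R2_def S2_def Y by (simp add: field_simps)
qed

end

end

theorem theorem1p1:
  fixes c a \<phi>2 \<psi>1 \<psi>2 :: "real \<Rightarrow> real" and \<phi>1 m0 \<psi>0 :: real
  assumes c_smooth: "smooth_fun c" and a_smooth: "smooth_fun a"
    and c_bdd: "\<And>l. l \<in> {1,2,3} \<Longrightarrow> bounded (range ((deriv ^^ l) c))"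
    and a_bdd: "\<And>l. l \<in> {1,2,3} \<Longrightarrow> bounded (range ((deriv ^^ l) a))"
    and m0_pos: "m0 > 0"
    and c'_lower: "\<And>z. \<bar>deriv c z\<bar> \<ge> m0"
    and a_lower: "\<And>z. \<bar>a z\<bar> \<ge> m0"
    and c_phi1: "c \<phi>1 = 0"
    and phi2_smooth: "smooth_fun \<phi>2" and psi1_smooth: "smooth_fun \<psi>1" and psi2_smooth: "smooth_fun \<psi>2"
    and phi2_bdd: "\<And>j. j \<in> {1,2,3,4} \<Longrightarrow> bounded (range ((deriv ^^ j) \<phi>2))"
    and psi1_bdd: "\<And>k. k \<in> {0,1,2,3} \<Longrightarrow> bounded (range ((deriv ^^ k) \<psi>1))"
    and psi2_bdd: "\<And>k. k \<in> {0,1,2,3} \<Longrightarrow> bounded (range ((deriv ^^ k) \<psi>2))"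
    and psi0_pos: "\<psi>0 > 0"
    and psi1_lower: "\<And>x. \<bar>\<psi>1 x\<bar> \<ge> \<psi>0"
  shows "\<exists>lam0 > 0. \<exists>\<delta> > 0. \<forall>lam::real. \<bar>lam\<bar> \<le> lam0 \<longrightarrow>
    (\<exists>R1 S1 R2 S2 u v R1t R1x S1t S1x R2t R2x S2t S2x ut ux vt vx :: real \<Rightarrow> real \<Rightarrow> real.
       C1_strip \<delta> R1 R1t R1x \<and> C1_strip \<delta> S1 S1t S1x \<and>
       C1_strip \<delta> R2 R2t R2x \<and> C1_strip \<delta> S2 S2t S2x \<and>
       C1_strip \<delta> u ut ux \<and> C1_strip \<delta> v vt vx \<and>
       (\<forall>t x. 0 < t \<and> t \<le> \<delta> \<longrightarrow>
          (let U = u t x; C = c U; C' = deriv c U; A = a U; A' = deriv a U in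
            C \<noteq> 0 \<and>
            R1t t x - C * R1x t x =
              C' * (R1 t x + S1 t x) / 4 * ((R1 t x - S1 t x) / C)
              + lam * A * A' * ((R2 t x - S2 t x) / C)
              - A\<^sup>2 * C' / 4 * ((R2 t x - S2 t x)\<^sup>2 / C)
              + A * A' * R2 t x * S2 t x \<and>
            S1t t x + C * S1x t x =
              C' * (R1 t x + S1 t x) / 4 * ((S1 t x - R1 t x) / C)
              + lam * A * A' * ((R2 t x - S2 t x) / C)
              - A\<^sup>2 * C' / 4 * ((R2 t x - S2 t x)\<^sup>2 / C)
              + A * A' * R2 t x * S2 t x \<and>
            R2t t x - C * R2x t x =
              C' * R1 t x / 2 * ((R2 t x - S2 t x) / C)
              - lam * A' / A * ((R1 t x - S1 t x) / C)
              - A' / A * (R1 t x * S2 t x + S1 t x * R2 t x) \<and>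
            S2t t x + C * S2x t x =
              C' * S1 t x / 2 * ((S2 t x - R2 t x) / C)
              - lam * A' / A * ((R1 t x - S1 t x) / C)
              - A' / A * (R1 t x * S2 t x + S1 t x * R2 t x) \<and>
            ut t x = (R1 t x + S1 t x) / 2 \<and>
            vt t x = (R2 t x + S2 t x) / 2)) \<and>
       (\<forall>x. R1 0 x = \<psi>1 x \<and> S1 0 x = \<psi>1 x \<and> R2 0 x = \<psi>2 x \<and> S2 0 x = \<psi>2 x \<and>
            R1t 0 x = f11 a \<phi>1 lam \<phi>2 \<psi>2 x \<and> S1t 0 x = f11 a \<phi>1 lam \<phi>2 \<psi>2 x \<and>
            R2t 0 x = f21 c a \<phi>1 \<phi>2 \<psi>1 \<psi>2 x \<and> S2t 0 x = f22 c a \<phi>1 \<phi>2 \<psi>1 \<psi>2 x \<and>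
            u 0 x = \<phi>1 \<and> ut 0 x = \<psi>1 x \<and> v 0 x = \<phi>2 x \<and> vt 0 x = \<psi>2 x))"
proof -
  let "\<exists>lam0>0. \<exists>\<delta>>0. \<forall>lam. \<bar>lam\<bar> \<le> lam0 \<longrightarrow> ?Sol \<delta> lam" = ?thesis
  have coefficient_bound: "\<exists>B>0. \<forall>x. \<bar>deriv c \<phi>1 * deriv \<phi>2 x\<bar> \<le> B"
  proof -
    obtain B where B: "\<And>x. \<bar>deriv \<phi>2 x\<bar> \<le> B" using phi2_bdd[of 1] by (auto simp: bounded_iff)
    have "\<bar>deriv c \<phi>1 * deriv \<phi>2 x\<bar> \<le> \<bar>deriv c \<phi>1\<bar> * B + 1" for x
      using mult_left_mono[OF B[of x], of "\<bar>deriv c \<phi>1\<bar>"] by (simp add: abs_mult)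
    moreover have "0 \<le> \<bar>deriv c \<phi>1\<bar> * B" using order_trans[OF abs_ge_zero B] by simp
    ultimately show ?thesis by (intro exI[of _ "\<bar>deriv c \<phi>1\<bar> * B + 1"]) auto
  qed
  then obtain B where B: "B > 0" "\<And>x. \<bar>deriv c \<phi>1 * deriv \<phi>2 x\<bar> \<le> B" by blast
  \<comment> \<open>The three entries correspond to the conditions on \<epsilon> in
    \<open>wave_data\<close>; B bounds the coefficient of u in the equations of R2 and S2.\<close>
  define \<epsilon> where "\<epsilon> = min 1 (min (\<psi>0 / 4) (1 / (16 * B)))"
  have eps: "0 < \<epsilon>" "\<epsilon> \<le> 1" "\<epsilon> \<le> \<psi>0 / 4" "\<epsilon> \<le> 1 / (16 * B)" using B psi0_pos by (auto simp: \<epsilon>_def)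
  have eps': "\<epsilon> * \<bar>deriv c \<phi>1 * deriv \<phi>2 x\<bar> \<le> 1 / 16" for x
  proof -
    have "\<epsilon> * \<bar>deriv c \<phi>1 * deriv \<phi>2 x\<bar> \<le> 1 / (16 * B) * B" using eps B by (intro mult_mono) auto
    then show ?thesis using B by simp
  qed
  interpret wave_data c a \<phi>2 \<psi>1 \<psi>2 \<phi>1 m0 \<psi>0 \<epsilon>
    by unfold_locales (fact assms eps eps')+
  obtain d where d: "0 < d" "d \<le> 1" and sgl: "\<And>p. p \<in> dom_pt d \<Longrightarrow> \<psi>0 / 2 \<le> \<bar>sg p\<bar>" using sg_lower by blast
  interpret fuchsian_system lf Af Qf 6 d lam0 by (rule system[OF d(1) sgl])
  obtain \<delta> where \<delta>: "0 < \<delta>" "\<delta> \<le> d" and sol: "\<And>lam. \<bar>lam\<bar> \<le> lam0 \<Longrightarrow>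
     \<exists>W Wt Wx. (\<forall>i. C1_strip \<delta> (W i) (Wt i) (Wx i)) \<and>
     (\<forall>i t x. 0 \<le> t \<and> t \<le> \<delta> \<longrightarrow> \<bar>W i t x\<bar> \<le> t) \<and> (\<forall>i x. i < 6 \<longrightarrow> W i 0 x = 0 \<and> Wt i 0 x = 0) \<and>
     (\<forall>i t x. i < 6 \<and> 0 < t \<and> t \<le> \<delta> \<longrightarrow>
        Wt i t x + t * lf i (lam, t, x, \<lambda>j. W j t x / t) * Wx i t x =
        t * (Af i (lam, t, x, \<lambda>j. W j t x / t) + (\<Sum>j<6. Qf i j (lam, t, x, \<lambda>j. W j t x / t) * (W j t x / t\<^sup>2))))"
    using fuchsian_solution by blast
  show ?thesis
  proof (rule exI[of _ lam0], rule conjI[OF lam0_bounds(1)], rule exI[of _ \<delta>], rule conjI[OF \<delta>(1)], intro allI impI)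
    fix lam :: real assume lam: "\<bar>lam\<bar> \<le> lam0"
    obtain W Wt Wx where C: "\<And>i. C1_strip \<delta> (W i) (Wt i) (Wx i)"
      and Wb: "\<And>i t x. 0 \<le> t \<Longrightarrow> t \<le> \<delta> \<Longrightarrow> \<bar>W i t x\<bar> \<le> t"
      and W0: "\<And>i x. i < 6 \<Longrightarrow> W i 0 x = 0" "\<And>i x. i < 6 \<Longrightarrow> Wt i 0 x = 0"
      and Weq: "\<And>i t x. i < 6 \<Longrightarrow> 0 < t \<Longrightarrow> t \<le> \<delta> \<Longrightarrow>
        Wt i t x + t * lf i (lam, t, x, \<lambda>j. W j t x / t) * Wx i t x =
        t * (Af i (lam, t, x, \<lambda>j. W j t x / t) + (\<Sum>j<6. Qf i j (lam, t, x, \<lambda>j. W j t x / t) * (W j t x / t\<^sup>2)))"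
      using sol[OF lam] by blast
    let ?f1 = "f11 a \<phi>1 lam \<phi>2 \<psi>2" and ?f2 = "f21 c a \<phi>1 \<phi>2 \<psi>1 \<psi>2" and ?f3 = "f22 c a \<phi>1 \<phi>2 \<psi>1 \<psi>2"
    \<comment> \<open>\<open>F11x\<close>, \<open>F21x\<close> and \<open>F22x\<close> depend only
      on \<open>\<lambda>\<close> and x, so the time and the unknowns can be set to 0 here and agree
      with the values at p below.\<close>
    let ?q = "\<lambda>x. (lam, 0, x, \<lambda>_. 0) :: pt"
    let ?g1 = "\<lambda>x. F11x (?q x)" and ?g2 = "\<lambda>x. F21x (?q x)" and ?g3 = "\<lambda>x. F22x (?q x)"
    note D = smooth_fun_DERIV[OF psi1_smooth] smooth_fun_DERIV[OF psi2_smooth] smooth_fun_DERIV[OF phi2_smooth]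
    note Cn = smooth_fun_continuous[OF smooth_fun_deriv[OF psi1_smooth]] smooth_fun_continuous[OF smooth_fun_deriv[OF psi2_smooth]]
      smooth_fun_continuous[OF smooth_fun_deriv[OF phi2_smooth]]
    have z: "((\<lambda>x. k) has_real_derivative (\<lambda>x. 0) x) (at x)" "continuous_on UNIV (\<lambda>x. 0 :: real)" for k x :: real by auto
    have Dh: "((\<lambda>x. ?f1 x / 2) has_real_derivative ?g1 x / 2) (at x)" for x by (rule DERIV_cdivide[OF f_derivs(1)])
    have Dq: "((\<lambda>x. (?f2 x + ?f3 x) / 4) has_real_derivative (?g2 x + ?g3 x) / 4) (at x)" for x
      by (rule DERIV_cdivide[OF DERIV_add[OF f_derivs(2,3)]])
    have Ch: "continuous_on UNIV (\<lambda>x. ?g1 x / 2)" "continuous_on UNIV (\<lambda>x. (?g2 x + ?g3 x) / 4)"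
      by (intro continuous_intros f_derivs_continuous; simp)+
    \<comment> \<open>The summands with 0 and the factors 1 are kept so that the expressions match
      \<open>C1_strip_expansion\<close> literally.\<close>
    let ?R1 = "\<lambda>t x. \<psi>1 x + t * ?f1 x + t\<^sup>2 * 0 + 1 * W 0 t x" and ?R1t = "\<lambda>t x. ?f1 x + 2 * t * 0 + 1 * Wt 0 t x"
      and ?R1x = "\<lambda>t x. deriv \<psi>1 x + t * ?g1 x + t\<^sup>2 * 0 + 1 * Wx 0 t x"
    let ?S1 = "\<lambda>t x. \<psi>1 x + t * ?f1 x + t\<^sup>2 * 0 + 1 * W 1 t x" and ?S1t = "\<lambda>t x. ?f1 x + 2 * t * 0 + 1 * Wt 1 t x"
      and ?S1x = "\<lambda>t x. deriv \<psi>1 x + t * ?g1 x + t\<^sup>2 * 0 + 1 * Wx 1 t x"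
    let ?R2 = "\<lambda>t x. \<psi>2 x + t * ?f2 x + t\<^sup>2 * 0 + 1 * W 2 t x" and ?R2t = "\<lambda>t x. ?f2 x + 2 * t * 0 + 1 * Wt 2 t x"
      and ?R2x = "\<lambda>t x. deriv \<psi>2 x + t * ?g2 x + t\<^sup>2 * 0 + 1 * Wx 2 t x"
    let ?S2 = "\<lambda>t x. \<psi>2 x + t * ?f3 x + t\<^sup>2 * 0 + 1 * W 3 t x" and ?S2t = "\<lambda>t x. ?f3 x + 2 * t * 0 + 1 * Wt 3 t x"
      and ?S2x = "\<lambda>t x. deriv \<psi>2 x + t * ?g3 x + t\<^sup>2 * 0 + 1 * Wx 3 t x"
    let ?u = "\<lambda>t x. \<phi>1 + t * \<psi>1 x + t\<^sup>2 * (?f1 x / 2) + \<epsilon> * W 4 t x" and ?ut = "\<lambda>t x. \<psi>1 x + 2 * t * (?f1 x / 2) + \<epsilon> * Wt 4 t x"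
      and ?ux = "\<lambda>t x. 0 + t * deriv \<psi>1 x + t\<^sup>2 * (?g1 x / 2) + \<epsilon> * Wx 4 t x"
    let ?v = "\<lambda>t x. \<phi>2 x + t * \<psi>2 x + t\<^sup>2 * ((?f2 x + ?f3 x) / 4) + 1 * W 5 t x"
      and ?vt = "\<lambda>t x. \<psi>2 x + 2 * t * ((?f2 x + ?f3 x) / 4) + 1 * Wt 5 t x"
      and ?vx = "\<lambda>t x. deriv \<phi>2 x + t * deriv \<psi>2 x + t\<^sup>2 * ((?g2 x + ?g3 x) / 4) + 1 * Wx 5 t x"
    have C1: "C1_strip \<delta> ?R1 ?R1t ?R1x" "C1_strip \<delta> ?S1 ?S1t ?S1x"
      by (rule C1_strip_expansion[OF D(1) Cn(1) f_derivs(1) f_derivs_continuous(1) z C])+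
    have C2: "C1_strip \<delta> ?R2 ?R2t ?R2x" by (rule C1_strip_expansion[OF D(2) Cn(2) f_derivs(2) f_derivs_continuous(2) z C])
    have C3: "C1_strip \<delta> ?S2 ?S2t ?S2x" by (rule C1_strip_expansion[OF D(2) Cn(2) f_derivs(3) f_derivs_continuous(3) z C])
    have C4: "C1_strip \<delta> ?u ?ut ?ux" by (rule C1_strip_expansion[OF z D(1) Cn(1) Dh Ch(1) C])
    have C5: "C1_strip \<delta> ?v ?vt ?vx" by (rule C1_strip_expansion[OF D(3) Cn(3) D(2) Cn(2) Dq Ch(2) C])
    have pde: "let U = ?u t x; C = c U; C' = deriv c U; A = a U; A' = deriv a U in
            C \<noteq> 0 \<and>
            ?R1t t x - C * ?R1x t x =
              C' * (?R1 t x + ?S1 t x) / 4 * ((?R1 t x - ?S1 t x) / C)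
              + lam * A * A' * ((?R2 t x - ?S2 t x) / C)
              - A\<^sup>2 * C' / 4 * ((?R2 t x - ?S2 t x)\<^sup>2 / C)
              + A * A' * ?R2 t x * ?S2 t x \<and>
            ?S1t t x + C * ?S1x t x =
              C' * (?R1 t x + ?S1 t x) / 4 * ((?S1 t x - ?R1 t x) / C)
              + lam * A * A' * ((?R2 t x - ?S2 t x) / C)
              - A\<^sup>2 * C' / 4 * ((?R2 t x - ?S2 t x)\<^sup>2 / C)
              + A * A' * ?R2 t x * ?S2 t x \<and>
            ?R2t t x - C * ?R2x t x =
              C' * ?R1 t x / 2 * ((?R2 t x - ?S2 t x) / C)
              - lam * A' / A * ((?R1 t x - ?S1 t x) / C)
              - A' / A * (?R1 t x * ?S2 t x + ?S1 t x * ?R2 t x) \<and>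
            ?S2t t x + C * ?S2x t x =
              C' * ?S1 t x / 2 * ((?S2 t x - ?R2 t x) / C)
              - lam * A' / A * ((?R1 t x - ?S1 t x) / C)
              - A' / A * (?R1 t x * ?S2 t x + ?S1 t x * ?R2 t x) \<and>
            ?ut t x = (?R1 t x + ?S1 t x) / 2 \<and>
            ?vt t x = (?R2 t x + ?S2 t x) / 2" if t: "0 < t \<and> t \<le> \<delta>" for t x
    proof -
      define p where "p = ((lam, t, x, \<lambda>j. W j t x / t) :: pt)"
      have t': "0 < t" "t \<le> \<delta>" "t \<noteq> 0" using t by auto
      have "\<bar>W j t x / t\<bar> \<le> 1" for j using Wb[of t j x] t' by (simp add: abs_divide)
      \<comment> \<open>The bound of W by t places p in the domain on which \<open>sg\<close> is
        bounded away from 0; this also gives a nonzero wave speed.\<close>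
      then have "p \<in> dom_pt d" using t' \<delta> lam lam0_bounds by (simp add: p_def dom_pt_def)
      then have sg0: "sg p \<noteq> 0" using sgl psi0_pos by fastforce
      have pt: "pt p > 0" "\<And>j. pY p j = W j t x / pt p" using t' by (auto simp: p_def)
      have eqs: "Wt i t x + pt p * lf i p * Wx i t x = pt p * (Af i p + (\<Sum>j<6. Qf i j p * (W j t x / (pt p)\<^sup>2)))"
        if "i < 6" for i using Weq[OF that t'(1,2)] unfolding p_def fst_conv snd_conv .
      have fv: "?f1 x = F11 p" "?f2 x = F21 p" "?f3 x = F22 p" unfolding p_def by (rule f_values)+
      have gv: "?g1 x = F11x p" "?g2 x = F21x p" "?g3 x = F22x p"
        by (simp_all add: p_def F11x_def F21x_def F22x_def P1_def P2_def P1x_def P2x_def X_def Xx_def)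
      have pv: "\<psi>1 x = P1 p" "\<psi>2 x = P2 p" "deriv \<psi>1 x = P1x p" "deriv \<psi>2 x = P2x p" "t = pt p" "lam = pl p"
        by (simp_all add: p_def P1_def P2_def P1x_def P2x_def)
      have u: "?u t x = \<phi>1 + ts p"
        unfolding fv unfolding pv(1) ts_def sg_def unfolding pt(2) unfolding pv(5)[symmetric] using t'
        by (simp add: power2_eq_square field_simps)
      have v: "?R1 t x = R1 p" "?S1 t x = S1 p" "?R2 t x = R2 p" "?S2 t x = S2 p"
        unfolding fv unfolding pv(1,2) R1_def S1_def R2_def S2_def unfolding pt(2) unfolding pv(5)[symmetric] using t'
        by (simp_all add: field_simps)
      have dv: "?R1t t x = F11 p + Wt 0 t x" "?S1t t x = F11 p + Wt 1 t x" "?R2t t x = F21 p + Wt 2 t x" "?S2t t x = F22 p + Wt 3 t x"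
        unfolding fv by simp_all
      have dx: "?R1x t x = P1x p + pt p * F11x p + Wx 0 t x" "?S1x t x = P1x p + pt p * F11x p + Wx 1 t x"
        "?R2x t x = P2x p + pt p * F21x p + Wx 2 t x" "?S2x t x = P2x p + pt p * F22x p + Wx 3 t x"
        unfolding gv pv(3,4) unfolding pv(5)[symmetric] by simp_all
      have du: "?ut t x = P1 p + pt p * F11 p + \<epsilon> * Wt 4 t x" "?vt t x = P2 p + pt p * ((F21 p + F22 p) / 2) + Wt 5 t x"
        unfolding fv pv(1,2) unfolding pv(5)[symmetric] by simp_all
      note args = pt sg0 eqs
      note cA = cp_def[symmetric] A_def[symmetric] Ap_def[symmetric]
      note waves = wave_R1[OF args] wave_S1[OF args] wave_R2[OF args] wave_S2[OF args]
      show ?thesis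
        unfolding Let_def u v dv dx du cA
        by (intro conjI speed_ne[OF args] waves[unfolded pv(6)[symmetric]] wave_u[OF args] wave_v[OF args])
    qed
    have init: "?R1 0 x = \<psi>1 x \<and> ?S1 0 x = \<psi>1 x \<and> ?R2 0 x = \<psi>2 x \<and> ?S2 0 x = \<psi>2 x \<and>
            ?R1t 0 x = f11 a \<phi>1 lam \<phi>2 \<psi>2 x \<and> ?S1t 0 x = f11 a \<phi>1 lam \<phi>2 \<psi>2 x \<and>
            ?R2t 0 x = f21 c a \<phi>1 \<phi>2 \<psi>1 \<psi>2 x \<and> ?S2t 0 x = f22 c a \<phi>1 \<phi>2 \<psi>1 \<psi>2 x \<and>
            ?u 0 x = \<phi>1 \<and> ?ut 0 x = \<psi>1 x \<and> ?v 0 x = \<phi>2 x \<and> ?vt 0 x = \<psi>2 x" for x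
      using W0 by simp
    show "?Sol \<delta> lam"
      by (rule exI[of _ ?R1], rule exI[of _ ?S1], rule exI[of _ ?R2], rule exI[of _ ?S2], rule exI[of _ ?u], rule exI[of _ ?v],
          rule exI[of _ ?R1t], rule exI[of _ ?R1x], rule exI[of _ ?S1t], rule exI[of _ ?S1x],
          rule exI[of _ ?R2t], rule exI[of _ ?R2x], rule exI[of _ ?S2t], rule exI[of _ ?S2x],
          rule exI[of _ ?ut], rule exI[of _ ?ux], rule exI[of _ ?vt], rule exI[of _ ?vx],
          intro conjI C1 C2 C3 C4 C5, intro allI impI, erule pde, intro allI, rule init)
  qed
qed

end
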